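(* Let $0<\alpha<1$, $T>0$, and for $u_0\in H$ consider the problem $$\mathrm{i}\,\partial_t^\alpha u(t)+Au(t)=0,\quad t\in(0,T),\qquad u(0)=u_0. \tag{P}$$ **(i) Case $0<\alpha\le\frac35$.** (a) (Uniqueness) Let $u_0\in H$. If the solution $u$ to (P) satisfies $u(T)=0$, then $u_0=0$ and hence $u(t)=0$ for all $t\in[0,T]$. (b) (Existence) For any $u_T\in H_1$ there exists a unique weak solution $u\in C([0,T];H)\cap C((0,T];H_1)$ to (P) (for some initial datum $u_0\in H$) such that $\partial_t^\alpha u,\,Au\in C((0,T];H)$ and $u(T)=u_T$. (c) (Stability) There exist constants $C_1,C_2>0$ such that for any solution $u$ to (P) (with any $u_0\in H$), $$C_1\|u(0)\|\le\|u(T)\|_1\le C_2\|u(0)\|.$$ **(ii) Case $\frac35<\alpha<1$.** (a) If $T$ is sufficiently large (i.e. there is $T_0>0$, depending on $\alpha$ and $A$, such that for all $T>T_0$), then for any $u_T\in H_1$ there exists a unique weak solution $u\in C([0,T];H)\cap C((0,T];H_1)$ to (P) (for some initial datum $u_0\in H$) such that $\partial_t^\alpha u,\,Au\in C((0,T];H)$ and $u(T)=u_T$. Moreover, there exist constants $C_1,C_2>0$ such that for any solution $u$ to (P), $$C_1\|u(0)\|\le\|u(T)\|_1\le C_2\|u(0)\|.$$ (b) For any $T>0$, $$\dim\{u_0\in H:\ \text{the solution } u \text{ to (P) satisfies } u(T)=0\}<\infty.$$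
   Context: $(H,\langle\cdot,\cdot\rangle)$ is a complex Hilbert space with norm $\|\cdot\|$; $A:D(A)\subset H\to H$ is a negative-definite self-adjoint operator with compact resolvent. The eigenvalues of $-A$ are $0<\lambda_1\le\lambda_2\le\cdots\to\infty$, with a corresponding orthonormal (Hilbert) basis of eigenvectors $\{\varphi_n\}_{n\ge1}\subset D(A)$. For $s\ge0$, $H_s=\{u\in H:\sum_n\lambda_n^{2s}|\langle u,\varphi_n\rangle|^2<\infty\}$ with $\|u\|_s^2=\sum_n\lambda_n^{2s}|\langle u,\varphi_n\rangle|^2$; thus $H_0=H$, $H_1=D(A)$. Caputo derivative for $0<\alpha<1$: $\partial_t^\alpha u(t)=\frac{1}{\Gamma(1-\alpha)}\int_0^t(t-s)^{-\alpha}\partial_su(s)\,\mathrm{d}s$ whenever the right-hand side is well-defined. For $u(t)=\sum_n u_n(t)\varphi_n$ it is understood coefficientwise, $\partial_t^\alpha u(t)=\sum_n\partial_t^\alpha u_n(t)\varphi_n$, the scalar functions $u_n$ being absolutely continuous on $[0,T]$. Weak solution (= solution) of (P) for $u_0\in H$: a function $u$ such that (1) $u\in C([0,T];H)$; (2) $\partial_t^\alpha u(t),Au(t)\in H$ for almost all $t\in(0,T)$ and the equation holds in $H$ for almost all $t\in(0,T)$; (3) $\lim_{t\to0^+}\|u(t)-u_0\|=0$. For each $u_0\in H$ there is exactly one weak solution, given by $u(t)=\sum_{n}\langle u_0,\varphi_n\rangle E_{\alpha,1}(-\mathrm{i}\lambda_nt^\alpha)\varphi_n$, where $E_{\alpha,\beta}(z)=\sum_{k\ge0}z^k/\Gamma(\alpha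 k+\beta)$ is the Mittag-Leffler function. *)

theory Defs
  imports "HOL-Analysis.Analysis"
begin

section \<open>Complex Hilbert spaces\<close>

text \<open>The inner product is linear in the first and conjugate linear in the second
  argument, so that \<open>cinner u (\<phi> n)\<close> is the coefficient of \<open>u\<close> with respect to an
  orthonormal basis \<open>\<phi>\<close>. Completeness is inherited from \<^class>\<open>banach\<close>.\<close>

class complex_hilbert_space = banach +
  fixes scaleC :: "complex \<Rightarrow> 'a \<Rightarrow> 'a"  (infixr "*\<^sub>C" 75)
    and cinner :: "'a \<Rightarrow> 'a \<Rightarrow> complex"
  assumes scaleC_add_right: "a *\<^sub>C (x + y) = a *\<^sub>C x + a *\<^sub>C y"
    and scaleC_add_left: "(a + b) *\<^sub>C x = a *\<^sub>C x + b *\<^sub>C x"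
    and scaleC_scaleC: "a *\<^sub>C (b *\<^sub>C x) = (a * b) *\<^sub>C x"
    and scaleC_of_real: "complex_of_real r *\<^sub>C x = r *\<^sub>R x"
    and cinner_commute: "cinner x y = cnj (cinner y x)"
    and cinner_add_left: "cinner (x + y) z = cinner x z + cinner y z"
    and cinner_scaleC_left: "cinner (a *\<^sub>C x) y = a * cinner x y"
    and cinner_self: "cinner x x = complex_of_real ((norm x)\<^sup>2)"

interpretation complex_vector: vector_space
  "scaleC :: complex \<Rightarrow> 'a \<Rightarrow> 'a::complex_hilbert_space"
proof unfold_locales
  show "1 *\<^sub>C x = x" for x :: 'a
    using scaleC_of_real[of 1 x] by simp
qed (simp_all add: scaleC_add_right scaleC_add_left scaleC_scaleC)

abbreviation csubspace :: "'a::complex_hilbert_space set \<Rightarrow> bool" where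
  "csubspace \<equiv> module.subspace scaleC"

abbreviation cspan :: "'a::complex_hilbert_space set \<Rightarrow> 'a set" where
  "cspan \<equiv> module.span scaleC"

definition finite_dim_csubspace :: "'a::complex_hilbert_space set \<Rightarrow> bool" where
  "finite_dim_csubspace S \<longleftrightarrow> csubspace S \<and> (\<exists>B. finite B \<and> S = cspan B)"

definition orthonormal_basis :: "(nat \<Rightarrow> 'a::complex_hilbert_space) \<Rightarrow> bool" where
  "orthonormal_basis \<phi> \<longleftrightarrow>
     (\<forall>m n. cinner (\<phi> m) (\<phi> n) = (if m = n then 1 else 0)) \<and>
     closure (cspan (range \<phi>)) = UNIV"


section \<open>Unbounded operators\<close>

text \<open>An operator with domain \<open>D\<close> is represented by a total function \<open>A\<close> whose values
  outside \<open>D\<close> are irrelevant.\<close>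

definition linear_operator ::
    "'a::complex_hilbert_space set \<Rightarrow> ('a \<Rightarrow> 'a) \<Rightarrow> bool" where
  "linear_operator D A \<longleftrightarrow> csubspace D \<and>
     (\<forall>x\<in>D. \<forall>y\<in>D. A (x + y) = A x + A y) \<and>
     (\<forall>c. \<forall>x\<in>D. A (c *\<^sub>C x) = c *\<^sub>C A x)"

definition adjoint_graph ::
    "'a::complex_hilbert_space set \<Rightarrow> ('a \<Rightarrow> 'a) \<Rightarrow> ('a \<times> 'a) set" where
  "adjoint_graph D A = {(v, w). \<forall>x\<in>D. cinner (A x) v = cinner x w}"

definition self_adjoint ::
    "'a::complex_hilbert_space set \<Rightarrow> ('a \<Rightarrow> 'a) \<Rightarrow> bool" where
  "self_adjoint D A \<longleftrightarrow> linear_operator D A \<and> closure D = UNIV \<and>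
     adjoint_graph D A = {(x, A x) | x. x \<in> D}"

text \<open>For self-adjoint \<open>A\<close> the number \<open>cinner (A x) x\<close> is real.\<close>

definition negative_definite ::
    "'a::complex_hilbert_space set \<Rightarrow> ('a \<Rightarrow> 'a) \<Rightarrow> bool" where
  "negative_definite D A \<longleftrightarrow> (\<forall>x\<in>D. x \<noteq> 0 \<longrightarrow> Re (cinner (A x) x) < 0)"

text \<open>Relative compactness of the image of the unit ball entails that the resolvent is
  bounded; one point of the resolvent set suffices by the resolvent identity.\<close>

definition compact_resolvent ::
    "'a::complex_hilbert_space set \<Rightarrow> ('a \<Rightarrow> 'a) \<Rightarrow> bool" where
  "compact_resolvent D A \<longleftrightarrow>
     (\<exists>z. bij_betw (\<lambda>x. z *\<^sub>C x - A x) D UNIV \<and>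
          compact (closure (the_inv_into D (\<lambda>x. z *\<^sub>C x - A x) ` cball 0 1)))"

text \<open>The sequences are indexed from \<open>0\<close>. Since \<open>\<phi>\<close> is a basis, \<open>\<lambda>\<close> lists all eigenvalues
  of \<open>- A\<close>, repeated according to multiplicity.\<close>

definition eigensystem ::
    "'a::complex_hilbert_space set \<Rightarrow> ('a \<Rightarrow> 'a) \<Rightarrow> (nat \<Rightarrow> real) \<Rightarrow> (nat \<Rightarrow> 'a) \<Rightarrow> bool" where
  "eigensystem D A lam \<phi> \<longleftrightarrow>
     0 < lam 0 \<and> incseq lam \<and> filterlim lam at_top sequentially \<and>
     orthonormal_basis \<phi> \<and>
     (\<forall>n. \<phi> n \<in> D \<and> - A (\<phi> n) = complex_of_real (lam n) *\<^sub>C \<phi> n)"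


section \<open>The spaces \<open>H\<^sub>s\<close>\<close>

definition Hs :: "(nat \<Rightarrow> real) \<Rightarrow> (nat \<Rightarrow> 'a::complex_hilbert_space) \<Rightarrow> real \<Rightarrow> 'a set" where
  "Hs lam \<phi> s = {x. summable (\<lambda>n. lam n powr (2 * s) * (cmod (cinner x (\<phi> n)))\<^sup>2)}"

definition Hs_norm ::
    "(nat \<Rightarrow> real) \<Rightarrow> (nat \<Rightarrow> 'a::complex_hilbert_space) \<Rightarrow> real \<Rightarrow> 'a \<Rightarrow> real" where
  "Hs_norm lam \<phi> s x = sqrt (\<Sum>n. lam n powr (2 * s) * (cmod (cinner x (\<phi> n)))\<^sup>2)"

definition Hs_continuous_on ::
    "(nat \<Rightarrow> real) \<Rightarrow> (nat \<Rightarrow> 'a::complex_hilbert_space) \<Rightarrow> real \<Rightarrow>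
     real set \<Rightarrow> (real \<Rightarrow> 'a) \<Rightarrow> bool" where
  "Hs_continuous_on lam \<phi> s I u \<longleftrightarrow>
     (\<forall>t\<in>I. u t \<in> Hs lam \<phi> s) \<and>
     (\<forall>t\<in>I. ((\<lambda>r. Hs_norm lam \<phi> s (u r - u t)) \<longlongrightarrow> 0) (at t within I))"


section \<open>The Caputo derivative\<close>

definition absolutely_continuous_on :: "real \<Rightarrow> real \<Rightarrow> (real \<Rightarrow> complex) \<Rightarrow> bool" where
  "absolutely_continuous_on x y f \<longleftrightarrow>
     (\<forall>\<epsilon>>0. \<exists>\<delta>>0. \<forall>(n::nat) a b.
        (\<forall>i<n. x \<le> a i \<and> a i \<le> b i \<and> b i \<le> y) \<longrightarrow>
        (\<forall>i<n. \<forall>j<n. i \<noteq> j \<longrightarrow> {a i<..<b i} \<inter> {a j<..<b j} = {}) \<longrightarrow>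
        (\<Sum>i<n. b i - a i) < \<delta> \<longrightarrow>
        (\<Sum>i<n. cmod (f (b i) - f (a i))) < \<epsilon>)"

text \<open>\<open>has_caputo \<alpha> f d t\<close>: the Caputo derivative of order \<open>\<alpha>\<close> of \<open>f\<close> at \<open>t\<close> is well-defined
  and equals \<open>d\<close>.\<close>

definition has_caputo :: "real \<Rightarrow> (real \<Rightarrow> complex) \<Rightarrow> complex \<Rightarrow> real \<Rightarrow> bool" where
  "has_caputo \<alpha> f d t \<longleftrightarrow>
     (AE s in lebesgue. s \<in> {0<..<t} \<longrightarrow> f differentiable (at s)) \<and>
     set_integrable lebesgue {0<..<t}
       (\<lambda>s. (t - s) powr (- \<alpha>) *\<^sub>R vector_derivative f (at s)) \<and>
     d = (1 / Gamma (1 - \<alpha>)) *\<^sub>R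
         (LINT s:{0<..<t}|lebesgue. (t - s) powr (- \<alpha>) *\<^sub>R vector_derivative f (at s))"

text \<open>The coefficientwise Caputo derivative of an \<open>H\<close>-valued function, with the resulting
  series converging in \<open>H\<close> to \<open>w\<close>.\<close>

definition has_caputo_H ::
    "real \<Rightarrow> (nat \<Rightarrow> 'a::complex_hilbert_space) \<Rightarrow> (real \<Rightarrow> 'a) \<Rightarrow> 'a \<Rightarrow> real \<Rightarrow> bool" where
  "has_caputo_H \<alpha> \<phi> u w t \<longleftrightarrow>
     (\<exists>d. (\<forall>n. has_caputo \<alpha> (\<lambda>s. cinner (u s) (\<phi> n)) (d n) t) \<and>
          (\<lambda>n. d n *\<^sub>C \<phi> n) sums w)"


section \<open>Solutions\<close>

text \<open>Functions on \<open>[0,T]\<close> are total functions on the reals whose values outside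
  \<open>[0,T]\<close> are irrelevant.\<close>

definition weak_solution ::
    "real \<Rightarrow> 'a::complex_hilbert_space set \<Rightarrow> ('a \<Rightarrow> 'a) \<Rightarrow> (nat \<Rightarrow> 'a) \<Rightarrow>
     real \<Rightarrow> 'a \<Rightarrow> (real \<Rightarrow> 'a) \<Rightarrow> bool" where
  "weak_solution \<alpha> D A \<phi> T u0 u \<longleftrightarrow>
     continuous_on {0..T} u \<and>
     (\<forall>n. absolutely_continuous_on 0 T (\<lambda>t. cinner (u t) (\<phi> n))) \<and>
     (AE t in lebesgue. t \<in> {0<..<T} \<longrightarrow>
        u t \<in> D \<and> (\<exists>w. has_caputo_H \<alpha> \<phi> u w t \<and> \<i> *\<^sub>C w + A (u t) = 0)) \<and>
     ((\<lambda>t. norm (u t - u0)) \<longlongrightarrow> 0) (at_right 0)"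

text \<open>A weak solution, for some initial datum, in \<open>C([0,T];H) \<inter> C((0,T];H\<^sub>1)\<close> whose Caputo
  derivative and whose image under \<open>A\<close> are everywhere defined and continuous on \<open>(0,T]\<close>.\<close>

definition regular_weak_solution ::
    "real \<Rightarrow> 'a::complex_hilbert_space set \<Rightarrow> ('a \<Rightarrow> 'a) \<Rightarrow> (nat \<Rightarrow> real) \<Rightarrow> (nat \<Rightarrow> 'a) \<Rightarrow>
     real \<Rightarrow> (real \<Rightarrow> 'a) \<Rightarrow> bool" where
  "regular_weak_solution \<alpha> D A lam \<phi> T u \<longleftrightarrow>
     (\<exists>u0. weak_solution \<alpha> D A \<phi> T u0 u) \<and>
     Hs_continuous_on lam \<phi> 1 {0<..T} u \<and>
     (\<exists>w. continuous_on {0<..T} w \<and> (\<forall>t\<in>{0<..T}. has_caputo_H \<alpha> \<phi> u (w t) t)) \<and>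
     (\<forall>t\<in>{0<..T}. u t \<in> D) \<and> continuous_on {0<..T} (\<lambda>t. A (u t))"

end

theory Submission
  imports Defs "HOL-Complex_Analysis.Complex_Analysis"
begin

text \<open>The \<open>n\<close>-th Fourier coefficient of a weak solution solves a scalar Caputo equation and therefore
  equals \<open>c\<^sub>n E(- \<i> \<lambda>\<^sub>n t\<^sup>\<alpha>)\<close> with the Mittag-Leffler function \<open>E\<close> of order \<open>\<alpha>\<close>. Everything thus
  reduces to two facts on \<open>E\<close>: both \<open>y \<bar>E(- \<i> y)\<bar>\<close> and its reciprocal stay bounded as \<open>y\<close> tends to
  infinity, and \<open>E(- \<i> y)\<close> has no zero \<open>y > 0\<close> if \<open>\<alpha> \<le> 3/5\<close>. Since only finitely many \<open>\<lambda>\<^sub>n t\<^sup>\<alpha>\<close> lie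
  below a given bound, the first fact alone yields the finite-dimensionality and the result for large
  times.

  Collapsing the contour of the inverse Laplace transform to the negative real axis writes
  \<open>E(- \<i> t\<^sup>\<alpha>)\<close> as an exponential \<open>exp(t p\<^sub>0) / \<alpha>\<close>, present only for \<open>\<alpha> > 1/2\<close>, plus an integral whose
  imaginary part is negative and of exact order \<open>t\<^sup>-\<^sup>\<alpha>\<close>. Here \<open>p\<^sub>0 = exp(- \<i> \<theta>)\<close> with \<open>\<theta> = pi / (2 \<alpha>)\<close>,
  and \<open>\<alpha> \<le> 3/5\<close> means \<open>\<theta> \<ge> 5 pi / 6\<close>: then the imaginary part of the exponential can be positive only
  for \<open>t \<ge> 2 pi\<close>, where the exponential is already smaller than the integral.\<close>

section \<open>Complex Hilbert spaces\<close>

text \<open>No inverse Laplace transform is taken. The exponential plus the integral is checked to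
  have the same Laplace transform as \<open>relaxation\<close> for all \<open>p > 1\<close>, and a
  continuous function of exponential growth is determined by such values. What has to be computed is
  then the Stieltjes transform of the kernel of the integral. The residue theorem does this in the
  variable \<open>w = ln z\<close>: the plane cut along the negative axis becomes the strip between
  \<open>Im w = - pi\<close> and \<open>Im w = pi\<close>, the branched power becomes
  \<open>exp (\<alpha> * w)\<close>, the branch point moves to infinity, and a keyhole contour
  becomes a rectangle. The equation holds only almost everywhere and the coefficients are only
  absolutely continuous. Uniqueness for the scalar equation is therefore read off an equivalent
  Volterra integral equation, and passing to it takes the fundamental theorem of calculus for
  absolutely continuous functions.\<close>

lemma cinner_add_right: "cinner x (y + z) = cinner x y + cinner x (z :: 'a :: complex_hilbert_space)"
  by (metis cinner_add_left cinner_commute complex_cnj_add)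

lemma cinner_scaleC_right: "cinner x (a *\<^sub>C y) = cnj a * cinner x (y :: 'a :: complex_hilbert_space)"
  by (metis cinner_commute cinner_scaleC_left complex_cnj_mult)

lemma cinner_zero_left [simp]: "cinner 0 y = 0" for y :: "'a::complex_hilbert_space"
  by (metis add_cancel_right_left cinner_add_left)

lemma cinner_zero_right [simp]: "cinner x 0 = 0" for x :: "'a::complex_hilbert_space"
  by (metis cinner_commute cinner_zero_left complex_cnj_zero)

lemma cinner_scaleR_left: "cinner (r *\<^sub>R x) y = r *\<^sub>R cinner x y"
  for x :: "'a::complex_hilbert_space"
  by (metis cinner_scaleC_left scaleC_of_real scaleR_conv_of_real)

lemma cinner_diff_left: "cinner (x - z) y = cinner x y - cinner z y"
  for x :: "'a::complex_hilbert_space"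
  by (metis add_diff_cancel_right' cinner_add_left diff_add_cancel)

lemma norm_scaleC: "norm (a *\<^sub>C x) = cmod a * norm x" for x :: "'a::complex_hilbert_space"
proof -
  have "complex_of_real ((norm (a *\<^sub>C x))\<^sup>2) = complex_of_real ((cmod a * norm x)\<^sup>2)"
    unfolding cinner_self [symmetric] cinner_scaleC_left cinner_scaleC_right
    by (simp add: cinner_self power_mult_distrib complex_norm_square[of a] del: of_real_power)
  then have "(norm (a *\<^sub>C x))\<^sup>2 = (cmod a * norm x)\<^sup>2"
    using of_real_eq_iff by blast
  then show ?thesis by simp
qed

lemma norm_add_square:
  "(norm (x + y))\<^sup>2 = (norm x)\<^sup>2 + 2 * Re (cinner x y) + (norm y)\<^sup>2"
  for x :: "'a::complex_hilbert_space"
proof -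
  have "complex_of_real ((norm (x + y))\<^sup>2)
      = of_real ((norm x)\<^sup>2) + of_real ((norm y)\<^sup>2) + (cinner x y + cnj (cinner x y))"
    unfolding cinner_self [symmetric] by (simp add: cinner_add_left cinner_add_right flip: cinner_commute)
  then show ?thesis
    by (simp add: complex_eq_iff)
qed

text \<open>Cauchy-Schwarz: the component of \<open>x\<close> orthogonal to \<open>y\<close> has
  nonnegative squared norm.\<close>

lemma cinner_norm_le: "cmod (cinner x y) \<le> norm x * norm y" for x :: "'a::complex_hilbert_space"
proof (cases "y = 0")
  case False
  \<comment> \<open>\<open>x + a *\<^sub>C y\<close> is that orthogonal component.\<close>
  define a where "a = - (cinner x y / of_real ((norm y)\<^sup>2))"
  have "cinner x (a *\<^sub>C y) = - of_real ((cmod (cinner x y))\<^sup>2 / (norm y)\<^sup>2)"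
    unfolding cinner_scaleC_right a_def by (simp add: complex_norm_square mult.commute del: of_real_power)
  then have *: "Re (cinner x (a *\<^sub>C y)) = - ((cmod (cinner x y))\<^sup>2 / (norm y)\<^sup>2)"
    by (simp only: uminus_complex.sel Re_complex_of_real)
  have "(norm (a *\<^sub>C y))\<^sup>2 = (cmod (cinner x y))\<^sup>2 / (norm y)\<^sup>2"
    using False
    by (simp add: norm_scaleC a_def norm_divide norm_power power_mult_distrib power_divide
        power2_eq_square[of "(norm y)\<^sup>2"] field_simps)
  then have "0 \<le> (norm x)\<^sup>2 - (cmod (cinner x y))\<^sup>2 / (norm y)\<^sup>2"
    using norm_add_square[of x "a *\<^sub>C y"] * zero_le_power2[of "norm (x + a *\<^sub>C y)"] by simp
  then have "(cmod (cinner x y))\<^sup>2 \<le> (norm x * norm y)\<^sup>2"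
    using False by (simp add: field_simps)
  then show ?thesis by (rule power2_le_imp_le) simp
qed simp

lemma bounded_linear_cinner_left: "bounded_linear (\<lambda>x. cinner x y)"
  for y :: "'a::complex_hilbert_space"
  by (rule bounded_linear_intro[where K = "norm y"])
     (simp_all add: cinner_add_left cinner_scaleR_left cinner_norm_le)

lemma bounded_linear_cinner_right_cnj: "bounded_linear (\<lambda>y. cnj (cinner x y))"
  for x :: "'a::complex_hilbert_space"
  using bounded_linear_cinner_left[of x] by (simp flip: cinner_commute)

lemma bounded_linear_scaleC: "bounded_linear (\<lambda>a. a *\<^sub>C x)" for x :: "'a::complex_hilbert_space"
proof (rule bounded_linear_intro[where K = "norm x"])
  show "(r *\<^sub>R a) *\<^sub>C x = r *\<^sub>R a *\<^sub>C x" for r a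
    by (metis scaleC_of_real scaleC_scaleC scaleR_conv_of_real)
qed (simp_all add: scaleC_add_left norm_scaleC)

section \<open>Expansions in an orthonormal basis\<close>

locale hilbert_basis =
  fixes \<phi> :: "nat \<Rightarrow> 'a::complex_hilbert_space"
  assumes onb: "orthonormal_basis \<phi>"
begin

definition synth :: "(nat \<Rightarrow> complex) \<Rightarrow> 'a" where
  "synth c = (\<Sum>n. c n *\<^sub>C \<phi> n)"

definition square_summable :: "(nat \<Rightarrow> complex) \<Rightarrow> bool" where
  "square_summable c \<longleftrightarrow> summable (\<lambda>n. (cmod (c n))\<^sup>2)"

lemma cinner_basis: "cinner (\<phi> m) (\<phi> n) = (if m = n then 1 else 0)"
  using onb by (simp add: orthonormal_basis_def)

lemma cinner_sum: "finite F \<Longrightarrow> cinner (\<Sum>n\<in>F. c n *\<^sub>C \<phi> n) (\<phi> m) = (if m \<in> F then c m else 0)"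
  by (simp add: linear_sum[OF bounded_linear.linear[OF bounded_linear_cinner_left]]
      cinner_scaleC_left cinner_basis if_distrib[of "(*) _"] cong: if_cong)

lemma norm_sum_basis: "finite F \<Longrightarrow> (norm (\<Sum>n\<in>F. c n *\<^sub>C \<phi> n))\<^sup>2 = (\<Sum>n\<in>F. (cmod (c n))\<^sup>2)"
proof (induction F rule: finite_induct)
  case (insert m F)
  let ?S = "\<Sum>n\<in>F. c n *\<^sub>C \<phi> n"
  have "cinner (c m *\<^sub>C \<phi> m) ?S = 0"
    unfolding cinner_scaleC_left using cinner_commute[of "\<phi> m" ?S] insert by (simp add: cinner_sum)
  moreover have "norm (\<phi> m) = 1"
    using cinner_self[of "\<phi> m"] by (simp add: cinner_basis power2_eq_1_iff flip: of_real_power)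
      (metis neg_0_le_iff_le norm_ge_zero not_one_le_zero)
  ultimately show ?case
    using insert by (simp add: norm_add_square norm_scaleC)
qed simp

lemma square_summable_tail:
  assumes "square_summable c" shows "(\<lambda>N. \<Sum>n. (cmod (c (n + N)))\<^sup>2) \<longlonglongrightarrow> 0"
  using suminf_exist_split2[OF assms[unfolded square_summable_def]] .

text \<open>By Pythagoras the squared norm of a block of the series is the corresponding block of
  the convergent series of squares, so the partial sums are Cauchy.\<close>

lemma Riesz_Fischer:
  assumes c: "square_summable c"
  shows "(\<lambda>n. c n *\<^sub>C \<phi> n) sums synth c"
proof -
  have "summable (\<lambda>n. c n *\<^sub>C \<phi> n)"
    unfolding summable_Cauchy
  proof (intro allI impI)
    fix e :: real assume "e > 0"
    then have "e\<^sup>2 > 0" by simp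
    with c obtain N where N: "\<And>m n. m \<ge> N \<Longrightarrow> norm (\<Sum>k=m..<n. (cmod (c k))\<^sup>2) < e\<^sup>2"
      unfolding square_summable_def summable_Cauchy by blast
    show "\<exists>N. \<forall>m\<ge>N. \<forall>n. norm (\<Sum>k=m..<n. c k *\<^sub>C \<phi> k) < e"
    proof (intro exI allI impI)
      fix m n assume "m \<ge> N"
      have "(norm (\<Sum>k=m..<n. c k *\<^sub>C \<phi> k))\<^sup>2 < e\<^sup>2"
        using N[OF \<open>m \<ge> N\<close>, of n] by (simp add: norm_sum_basis sum_nonneg)
      then show "norm (\<Sum>k=m..<n. c k *\<^sub>C \<phi> k) < e"
        using \<open>e > 0\<close> by (simp add: power2_less_imp_less)
    qed
  qed
  then show ?thesis by (simp add: synth_def summable_sums)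
qed

lemma coef_synth:
  assumes c: "square_summable c"
  shows "cinner (synth c) (\<phi> m) = c m"
proof -
  have "(\<lambda>n. cinner (c n *\<^sub>C \<phi> n) (\<phi> m)) sums cinner (synth c) (\<phi> m)"
    by (rule bounded_linear.sums[OF bounded_linear_cinner_left Riesz_Fischer[OF c]])
  then have "(\<lambda>n. if n = m then c n else 0) sums cinner (synth c) (\<phi> m)"
    by (simp add: cinner_scaleC_left cinner_basis if_distrib[of "(*) _"] cong: if_cong)
  then show ?thesis
    using sums_single[of m c] sums_unique2 by blast
qed

text \<open>The vectors orthogonal to \<open>x\<close> form a closed subspace containing the basis,
  hence the whole space and in particular \<open>x\<close> itself.\<close>

lemma coef_eq_0_imp:
  assumes "\<And>n. cinner x (\<phi> n) = 0" shows "x = 0"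
proof -
  have "module.span scaleC (range \<phi>) \<subseteq> {y. cinner x y = 0}"
    using assms
    by (intro complex_vector.span_minimal)
       (auto simp: complex_vector.subspace_def cinner_add_right cinner_scaleC_right)
  moreover have "closed {y. cnj (cinner x y) = 0}"
    by (intro closed_Collect_eq linear_continuous_on bounded_linear_cinner_right_cnj continuous_on_const)
  ultimately have "closure (module.span scaleC (range \<phi>)) \<subseteq> {y. cinner x y = 0}"
    by (simp add: closure_minimal)
  then have "cinner x x = 0"
    using onb unfolding orthonormal_basis_def by blast
  then show ?thesis by (simp add: cinner_self)
qed

lemma coef_eqI:
  assumes "\<And>n. cinner x (\<phi> n) = cinner y (\<phi> n)" shows "x = y"
  using coef_eq_0_imp[of "x - y"] assms by (simp add: cinner_diff_left)

text \<open>Bessel's inequality: the squared distance from \<open>x\<close> to a partial expansion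
  is \<open>(norm x)\<^sup>2\<close> minus the partial sum of squares.\<close>

lemma square_summable_coef: "square_summable (\<lambda>n. cinner x (\<phi> n))"
  unfolding square_summable_def
proof (rule bounded_imp_summable)
  fix N
  let ?p = "\<Sum>n\<le>N. cinner x (\<phi> n) *\<^sub>C \<phi> n"
  let ?s = "\<Sum>n\<le>N. (cmod (cinner x (\<phi> n)))\<^sup>2"
  have "cnj (cinner x ?p) = (\<Sum>n\<le>N. cnj (cinner x (cinner x (\<phi> n) *\<^sub>C \<phi> n)))"
    by (rule linear_sum[OF bounded_linear.linear[OF bounded_linear_cinner_right_cnj]])
  also have "\<dots> = of_real ?s"
    by (simp add: cinner_scaleC_right complex_norm_square mult_ac del: of_real_power)
  finally have "Re (cinner x ?p) = ?s"
    by (metis Re_complex_of_real complex_cnj_complex_of_real complex_cnj_cnj)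
  moreover have "cinner x (- ?p) = - cinner x ?p"
    using cinner_scaleC_right[of x "-1" ?p] complex_vector.scale_minus_left[of 1 ?p] by simp
  ultimately have "(norm (x + - ?p))\<^sup>2 = (norm x)\<^sup>2 - ?s"
    using norm_add_square[of x "- ?p"] by (simp add: norm_sum_basis)
  then show "?s \<le> (norm x)\<^sup>2"
    using zero_le_power2[of "norm (x + - ?p)"] by linarith
qed simp

lemma synth_coef: "synth (\<lambda>n. cinner x (\<phi> n)) = x"
  by (rule coef_eqI) (simp add: coef_synth square_summable_coef)

lemma basis_expansion: "(\<lambda>n. cinner x (\<phi> n) *\<^sub>C \<phi> n) sums x"
  using Riesz_Fischer[OF square_summable_coef[of x]] by (simp add: synth_coef)

lemma Parseval: "(\<lambda>n. (cmod (cinner x (\<phi> n)))\<^sup>2) sums (norm x)\<^sup>2"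
proof -
  have "(\<lambda>N. (norm (\<Sum>n<N. cinner x (\<phi> n) *\<^sub>C \<phi> n))\<^sup>2) \<longlonglongrightarrow> (norm x)\<^sup>2"
    using basis_expansion[of x] unfolding sums_def by (intro tendsto_intros)
  then show ?thesis by (simp add: norm_sum_basis sums_def)
qed

lemma norm_square_eq: "(norm x)\<^sup>2 = (\<Sum>n. (cmod (cinner x (\<phi> n)))\<^sup>2)"
  using Parseval sums_unique by blast

lemma Parseval_cinner: "(\<lambda>n. cinner x (\<phi> n) * cnj (cinner y (\<phi> n))) sums cinner x y"
  using bounded_linear.sums[OF bounded_linear_cinner_left[of y] basis_expansion[of x]]
  by (simp add: cinner_scaleC_left flip: cinner_commute)

lemma square_summable_comparison:
  assumes "square_summable c" "\<And>n. cmod (d n) \<le> C * cmod (c n)"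
  shows "square_summable d"
  unfolding square_summable_def
proof (rule summable_comparison_test)
  show "summable (\<lambda>n. C\<^sup>2 * (cmod (c n))\<^sup>2)"
    using assms(1) unfolding square_summable_def by (rule summable_mult)
  show "\<exists>N. \<forall>n\<ge>N. norm ((cmod (d n))\<^sup>2) \<le> C\<^sup>2 * (cmod (c n))\<^sup>2"
    using assms(2) by (auto simp: power_mult_distrib[symmetric] intro!: power_mono)
qed

lemma norm_le_of_coef_le:
  assumes "\<And>n. cmod (cinner x (\<phi> n)) \<le> C * cmod (cinner y (\<phi> n))" "0 \<le> C"
  shows "norm x \<le> C * norm y"
proof (rule power2_le_imp_le)
  have "(norm x)\<^sup>2 \<le> C\<^sup>2 * (norm y)\<^sup>2"
    using assms
    by (intro sums_le[OF _ Parseval[of x] sums_mult[OF Parseval[of y]]])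
       (auto simp: power_mult_distrib[symmetric] intro!: power_mono)
  then show "(norm x)\<^sup>2 \<le> (C * norm y)\<^sup>2" by (simp add: power_mult_distrib)
qed (use assms in simp)

text \<open>The majorant \<open>c\<close> is the same for all \<open>t\<close>, so the tails are
  small uniformly in \<open>t\<close> and the continuous partial sums converge uniformly.\<close>

lemma continuous_on_synth:
  fixes m :: "real \<Rightarrow> nat \<Rightarrow> complex"
  assumes c: "square_summable c"
    and m: "\<And>n. continuous_on S (\<lambda>t. m t n)"
    and bound: "\<And>t n. t \<in> S \<Longrightarrow> cmod (m t n) \<le> C * cmod (c n)"
  shows "continuous_on S (\<lambda>t. synth (m t))"
proof (rule uniform_limit_theorem)
  show "\<forall>\<^sub>F N in sequentially. continuous_on S (\<lambda>t. \<Sum>n<N. m t n *\<^sub>C \<phi> n)"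
    by (intro always_eventually allI continuous_on_sum bounded_linear.continuous_on
        [OF bounded_linear_scaleC] m)
  show "uniform_limit S (\<lambda>N t. \<Sum>n<N. m t n *\<^sub>C \<phi> n) (\<lambda>t. synth (m t)) sequentially"
    unfolding uniform_limit_iff
  proof (intro allI impI)
    fix e :: real assume e: "e > 0"
    have "(\<lambda>N. C\<^sup>2 * (\<Sum>n. (cmod (c (n + N)))\<^sup>2)) \<longlonglongrightarrow> C\<^sup>2 * 0"
      by (intro tendsto_intros square_summable_tail c)
    then have "\<forall>\<^sub>F N in sequentially. C\<^sup>2 * (\<Sum>n. (cmod (c (n + N)))\<^sup>2) < e\<^sup>2"
      by (rule order_tendstoD) (use e in simp)
    then show "\<forall>\<^sub>F N in sequentially. \<forall>t\<in>S. dist (\<Sum>n<N. m t n *\<^sub>C \<phi> n) (synth (m t)) < e"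
    proof (eventually_elim, intro ballI)
      fix N t assume N: "C\<^sup>2 * (\<Sum>n. (cmod (c (n + N)))\<^sup>2) < e\<^sup>2" and t: "t \<in> S"
      have mt: "square_summable (m t)"
        using square_summable_comparison[OF c bound[OF t]] .
      have "cinner (synth (m t) - (\<Sum>n<N. m t n *\<^sub>C \<phi> n)) (\<phi> n) = (if n < N then 0 else m t n)" for n
        by (simp add: cinner_diff_left coef_synth mt cinner_sum)
      then have "(\<lambda>n. (cmod (if n < N then 0 else m t n))\<^sup>2) sums
          (norm (synth (m t) - (\<Sum>n<N. m t n *\<^sub>C \<phi> n)))\<^sup>2"
        using Parseval[of "synth (m t) - (\<Sum>n<N. m t n *\<^sub>C \<phi> n)"] by simp
      from sums_split_initial_segment[OF this, of N]
      have s: "(\<lambda>n. (cmod (m t (n + N)))\<^sup>2) sums (norm (synth (m t) - (\<Sum>n<N. m t n *\<^sub>C \<phi> n)))\<^sup>2"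
        by simp
      have cN: "(\<lambda>n. C\<^sup>2 * (cmod (c (n + N)))\<^sup>2) sums (C\<^sup>2 * (\<Sum>n. (cmod (c (n + N)))\<^sup>2))"
        using c unfolding square_summable_def
        by (intro sums_mult summable_sums) (rule summable_ignore_initial_segment)
      have "(norm (synth (m t) - (\<Sum>n<N. m t n *\<^sub>C \<phi> n)))\<^sup>2 \<le> C\<^sup>2 * (\<Sum>n. (cmod (c (n + N)))\<^sup>2)"
        using bound[OF t]
        by (intro sums_le[OF _ s cN]) (auto simp: power_mult_distrib[symmetric] intro!: power_mono)
      with N have "(norm (synth (m t) - (\<Sum>n<N. m t n *\<^sub>C \<phi> n)))\<^sup>2 < e\<^sup>2" by linarith
      then show "dist (\<Sum>n<N. m t n *\<^sub>C \<phi> n) (synth (m t)) < e"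
        using e by (simp add: dist_norm norm_minus_commute power2_less_imp_less)
    qed
  qed
qed simp

end

section \<open>A self-adjoint operator that is diagonal in the basis\<close>

locale spectral_operator = hilbert_basis \<phi> for \<phi> :: "nat \<Rightarrow> 'a::complex_hilbert_space" +
  fixes D :: "'a set" and A :: "'a \<Rightarrow> 'a" and lam :: "nat \<Rightarrow> real"
  assumes self_adjoint: "self_adjoint D A"
    and eigensystem: "eigensystem D A lam \<phi>"
begin

lemma lam_pos: "0 < lam n" and lam_ge: "lam 0 \<le> lam n"
  using eigensystem incseqD[of lam 0 n] by (auto simp: eigensystem_def dest: less_le_trans)

lemma lam_pow: "lam n powr 2 = (lam n)\<^sup>2"
  using lam_pos[of n] by simp

text \<open>Self-adjointness enters as symmetry: the graph of \<open>A\<close> lies in the adjoint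
  graph.\<close>

lemma coef_A:
  assumes "x \<in> D" shows "cinner (A x) (\<phi> n) = - of_real (lam n) * cinner x (\<phi> n)"
proof -
  have "(\<phi> n, A (\<phi> n)) \<in> adjoint_graph D A"
    using self_adjoint eigensystem by (auto simp: self_adjoint_def eigensystem_def)
  then have "cinner (A x) (\<phi> n) = cinner x (A (\<phi> n))"
    using assms by (simp add: adjoint_graph_def)
  also have "A (\<phi> n) = (- of_real (lam n)) *\<^sub>C \<phi> n"
    using eigensystem unfolding eigensystem_def by (metis complex_vector.scale_minus_left minus_minus)
  finally show ?thesis by (simp add: cinner_scaleC_right del: complex_vector.scale_minus_left)
qed

text \<open>Here the opposite inclusion counts. By Parseval, \<open>x\<close> together with the
  diagonal candidate for \<open>A x\<close> lies in the adjoint graph, which is the graph of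
  \<open>A\<close>; so decay of coefficients yields membership in the domain.\<close>

lemma domainI:
  assumes "square_summable (\<lambda>n. of_real (lam n) * cinner x (\<phi> n))"
  shows "x \<in> D" and "A x = synth (\<lambda>n. - of_real (lam n) * cinner x (\<phi> n))"
proof -
  let ?w = "synth (\<lambda>n. - of_real (lam n) * cinner x (\<phi> n))"
  have ss: "square_summable (\<lambda>n. - of_real (lam n) * cinner x (\<phi> n))"
    by (rule square_summable_comparison[OF assms, of _ 1]) (simp add: norm_mult)
  have "cinner (A y) x = cinner y ?w" if "y \<in> D" for y
  proof -
    have "(\<lambda>n. cinner (A y) (\<phi> n) * cnj (cinner x (\<phi> n))) sums cinner (A y) x"
      by (rule Parseval_cinner)
    moreover have "cinner (A y) (\<phi> n) * cnj (cinner x (\<phi> n)) = cinner y (\<phi> n) * cnj (cinner ?w (\<phi> n))" for n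
      by (simp only: coef_A[OF that] coef_synth[OF ss]) simp
    ultimately show ?thesis
      using Parseval_cinner[of y ?w] sums_unique2 by simp
  qed
  then have "(x, ?w) \<in> adjoint_graph D A"
    by (simp add: adjoint_graph_def)
  then show "x \<in> D" "A x = ?w"
    using self_adjoint by (auto simp: self_adjoint_def)
qed

lemma Hs_1_iff: "x \<in> Hs lam \<phi> 1 \<longleftrightarrow> square_summable (\<lambda>n. of_real (lam n) * cinner x (\<phi> n))"
  by (simp add: Hs_def square_summable_def norm_mult power_mult_distrib lam_pow)

lemma Hs_norm_1_eq:
  assumes "x \<in> Hs lam \<phi> 1"
  shows "Hs_norm lam \<phi> 1 x = norm (synth (\<lambda>n. of_real (lam n) * cinner x (\<phi> n)))"
proof -
  have "(norm (synth (\<lambda>n. of_real (lam n) * cinner x (\<phi> n))))\<^sup>2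
      = (\<Sum>n. lam n powr (2 * 1) * (cmod (cinner x (\<phi> n)))\<^sup>2)"
    using assms unfolding Hs_1_iff
    by (subst norm_square_eq)
       (simp add: coef_synth norm_mult power_mult_distrib lam_pow)
  then show ?thesis
    unfolding Hs_norm_def by (metis norm_ge_zero real_sqrt_unique)
qed

end

section \<open>Absolutely continuous functions\<close>

text \<open>A Henstock gauge argument. At tags outside the exceptional null set the derivative
  controls the increment over the interval; the intervals tagged inside it lie in an open set of
  small measure, where absolute continuity controls the sum of increments.\<close>

lemma fundamental_theorem_of_calculus_absolutely_continuous:
  fixes f :: "real \<Rightarrow> complex"
  assumes ab: "a \<le> b" and ac: "absolutely_continuous_on a b f" and N: "negligible N"
    and f': "\<And>x. x \<in> {a<..<b} - N \<Longrightarrow> (f has_vector_derivative f' x) (at x)"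
  shows "(f' has_integral (f b - f a)) {a..b}"
proof -
  \<comment> \<open>The end points join the exceptional set because differentiability is given only
    in the interior.\<close>
  define N' where "N' = N \<union> {a, b}"
  define g where "g x = (if x \<in> N' then 0 else f' x)" for x
  have N': "negligible N'"
    unfolding N'_def by (intro negligible_Un N) (simp add: negligible_insert)
  have "(g has_integral (f b - f a)) {a..b}"
    unfolding has_integral_real
  proof (intro allI impI)
    fix e :: real assume e: "e > 0"
    \<comment> \<open>With this tolerance the regular tags contribute at most
      \<open>\<epsilon> * (b - a) < e / 2\<close>.\<close>
    define \<epsilon> where "\<epsilon> = e / (2 * (b - a + 1))"
    have \<epsilon>: "\<epsilon> > 0" using e ab by (simp add: \<epsilon>_def)
    obtain \<delta> where \<delta>: "\<delta> > 0" and ac': "\<forall>(n::nat) A B.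
        (\<forall>i<n. a \<le> A i \<and> A i \<le> B i \<and> B i \<le> b) \<longrightarrow>
        (\<forall>i<n. \<forall>j<n. i \<noteq> j \<longrightarrow> {A i<..<B i} \<inter> {A j<..<B j} = {}) \<longrightarrow>
        (\<Sum>i<n. B i - A i) < \<delta> \<longrightarrow> (\<Sum>i<n. cmod (f (B i) - f (A i))) < e / 2"
      using ac half_gt_zero[OF e] unfolding absolutely_continuous_on_def by blast
    obtain G where G: "open G" "N' \<subseteq> G" "G \<in> lmeasurable" "measure lebesgue G < \<delta>"
    proof -
      obtain G where G: "open G" "N' \<subseteq> G" "G - N' \<in> lmeasurable" "emeasure lebesgue (G - N') < ennreal \<delta>"
        using sets_lebesgue_outer_open[OF negligible_imp_sets[OF N'] \<delta>] by blast
      have un: "G = (G - N') \<union> N'" using G(2) by blast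
      have N'm: "N' \<in> lmeasurable" "measure lebesgue N' = 0"
        using N' by (simp_all add: negligible_iff_measure)
      have "G \<in> lmeasurable"
        by (subst un) (intro fmeasurable.Un G N'm)
      moreover have "measure lebesgue (G - N') < \<delta>"
        using G(3,4) \<delta> by (simp add: emeasure_eq_measure2 ennreal_less_iff)
      moreover have "measure lebesgue G \<le> measure lebesgue (G - N') + measure lebesgue N'"
        by (subst un) (intro measure_Un_le fmeasurableD G N'm)
      ultimately show thesis using that[of G] G(1,2) N'm(2) by simp
    qed
    have "\<exists>d>0. \<forall>y. \<bar>y - x\<bar> < d \<longrightarrow> cmod (f y - f x - (y - x) *\<^sub>R f' x) \<le> \<epsilon> * \<bar>y - x\<bar>"
      if "x \<in> {a..b} - N'" for x
      using f'[of x] that \<epsilon> unfolding has_vector_derivative_def has_derivative_at_alt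
      by (auto simp: N'_def)
    then obtain d where d: "\<And>x. x \<in> {a..b} - N' \<Longrightarrow> d x > 0"
      and d': "\<And>x y. \<lbrakk>x \<in> {a..b} - N'; \<bar>y - x\<bar> < d x\<rbrakk> \<Longrightarrow>
        cmod (f y - f x - (y - x) *\<^sub>R f' x) \<le> \<epsilon> * \<bar>y - x\<bar>"
      by metis
    define \<gamma> where "\<gamma> x = (if x \<in> N' then G else if x \<in> {a..b} then ball x (d x) else ball x 1)" for x
    have gauge: "gauge \<gamma>"
      using G d by (auto simp: gauge_def \<gamma>_def)
    have small: "norm (sum (\<lambda>(x,k). measure lborel k *\<^sub>R g x) p - (f b - f a)) < e"
      if p: "p tagged_division_of {a..b}" and fine: "\<gamma> fine p" for p
    proof -
      note tp = tagged_division_ofD[OF p]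
      define h where "h = (\<lambda>(x,k). measure lborel k *\<^sub>R g x - (f (Sup k) - f (Inf k)))"
      define p1 where "p1 = {q \<in> p. fst q \<notin> N'}"
      define p2 where "p2 = {q \<in> p. fst q \<in> N'}"
      have fin: "finite p" "finite p1" "finite p2" using tp(1) by (auto simp: p1_def p2_def)
      have ivl: "\<exists>u v. k = {u..v} \<and> u \<le> v \<and> a \<le> u \<and> v \<le> b \<and> x \<in> {u..v}" if "(x, k) \<in> p" for x k
        using tp(2,3)[OF that] tp(4)[OF that] by (auto simp: box_real)
      have "sum (\<lambda>(x,k). measure lborel k *\<^sub>R g x) p - (f b - f a) = sum h p"
        unfolding additive_tagged_division_1[OF ab p, of f, symmetric] h_def
        by (subst sum_subtractf[symmetric]) (auto intro: sum.cong)
      also have "sum h p = sum h p1 + sum h p2"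
        using fin by (subst sum.union_disjoint[symmetric]) (auto simp: p1_def p2_def intro: sum.cong)
      finally have eq: "sum (\<lambda>(x,k). measure lborel k *\<^sub>R g x) p - (f b - f a) = sum h p1 + sum h p2" .
      have "norm (sum h p1) \<le> (\<Sum>(x,k)\<in>p1. \<epsilon> * measure lborel k)"
      proof (rule sum_norm_le, clarify)
        fix x k assume xk: "(x, k) \<in> p1"
        then have xkp: "(x, k) \<in> p" and x: "x \<notin> N'" by (auto simp: p1_def)
        obtain u v where uv: "k = {u..v}" "u \<le> v" "a \<le> u" "v \<le> b" "x \<in> {u..v}"
          using ivl[OF xkp] by blast
        have "k \<subseteq> ball x (d x)"
          using fineD[OF fine xkp] x uv by (auto simp: \<gamma>_def split: if_splits)
        then have "u \<in> ball x (d x)" "v \<in> ball x (d x)" using uv(1,2) by auto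
        then have "\<bar>u - x\<bar> < d x" "\<bar>v - x\<bar> < d x"
          by (simp_all add: dist_real_def abs_minus_commute)
        then have *: "cmod (f u - f x - (u - x) *\<^sub>R f' x) \<le> \<epsilon> * \<bar>u - x\<bar>"
            "cmod (f v - f x - (v - x) *\<^sub>R f' x) \<le> \<epsilon> * \<bar>v - x\<bar>"
          using d'[of x u] d'[of x v] x uv by auto
        \<comment> \<open>The interval contains its tag \<open>x\<close>; splitting the increment at
          \<open>x\<close> lets both errors be measured from the point of differentiability.\<close>
        have "h (x, k) = (f u - f x - (u - x) *\<^sub>R f' x) - (f v - f x - (v - x) *\<^sub>R f' x)"
          using uv x by (simp add: h_def g_def algebra_simps)
        then have "cmod (h (x, k)) \<le> \<epsilon> * \<bar>u - x\<bar> + \<epsilon> * \<bar>v - x\<bar>"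
          using * norm_triangle_ineq4 by (smt (verit))
        also have "\<dots> = \<epsilon> * measure lborel k" using uv by (simp add: algebra_simps)
        finally show "cmod (h (x, k)) \<le> \<epsilon> * measure lborel k" .
      qed
      also have "\<dots> \<le> (\<Sum>(x,k)\<in>p. \<epsilon> * measure lborel k)"
        using fin \<epsilon> by (intro sum_mono2) (auto simp: p1_def)
      also have "\<dots> = \<epsilon> * (b - a)"
        using additive_content_tagged_division[of p a b] p ab
        by (simp add: sum_distrib_left[symmetric] case_prod_unfold)
      also have "\<dots> < e / 2"
        using e ab by (simp add: \<epsilon>_def field_simps)
      finally have 1: "norm (sum h p1) < e / 2" .
      have "norm (sum h p2) \<le> (\<Sum>(x,k)\<in>p2. cmod (f (Sup k) - f (Inf k)))"
        by (rule sum_norm_le) (auto simp: h_def p2_def g_def norm_minus_commute)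
      also have "\<dots> < e / 2"
      proof -
        \<comment> \<open>Absolute continuity is stated for numbered intervals, so the irregular
          part of the division is enumerated.\<close>
        obtain m where m: "bij_betw m {..<card p2} p2"
          using ex_bij_betw_nat_finite[OF fin(3)] by (auto simp: atLeast0LessThan)
        define A where "A i = Inf (snd (m i))" for i
        define B where "B i = Sup (snd (m i))" for i
        have mi: "(fst (m i), snd (m i)) \<in> p2" if "i < card p2" for i
          using m that by (auto simp: bij_betw_def)
        have AB: "snd (m i) = {A i..B i} \<and> A i \<le> B i \<and> a \<le> A i \<and> B i \<le> b" if "i < card p2" for i
          using ivl[of "fst (m i)" "snd (m i)"] mi[OF that] by (force simp: A_def B_def p2_def)
        have reidx: "(\<Sum>(x,k)\<in>p2. F (Sup k) (Inf k)) = (\<Sum>i<card p2. F (B i) (A i))" for F :: "real \<Rightarrow> real \<Rightarrow> real"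
          using sum.reindex_bij_betw[OF m, of "\<lambda>(x,k). F (Sup k) (Inf k)"]
          by (simp add: A_def B_def case_prod_unfold)
        have "(\<Sum>i<card p2. cmod (f (B i) - f (A i))) < e / 2"
        proof (rule ac'[rule_format])
          show "a \<le> A i \<and> A i \<le> B i \<and> B i \<le> b" if "i < card p2" for i
            using AB[OF that] by simp
          show "{A i<..<B i} \<inter> {A j<..<B j} = {}" if "i < card p2" "j < card p2" "i \<noteq> j" for i j
          proof -
            have "m i \<noteq> m j" using m that by (auto simp: bij_betw_def inj_on_def)
            then have "interior (snd (m i)) \<inter> interior (snd (m j)) = {}"
              using tp(5)[of "fst (m i)" "snd (m i)" "fst (m j)" "snd (m j)"] mi that by (auto simp: p2_def)
            then show ?thesis using AB that by simp
          qed
          have p2: "p2 tagged_division_of \<Union>(snd ` p2)"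
            using p by (intro tagged_partial_division_of_Union_self)
              (auto simp: p2_def tagged_division_of_def intro: tagged_partial_division_subset)
          have div: "(snd ` p2) division_of \<Union>(snd ` p2)"
            by (rule division_of_tagged_division[OF p2])
          have "(\<Sum>i<card p2. B i - A i) = (\<Sum>(x,k)\<in>p2. measure lborel k)"
            unfolding reidx[of "\<lambda>u v. u - v", symmetric]
            by (rule sum.cong) (use ivl in \<open>force simp: p2_def\<close>)+
          also have "\<dots> = sum (measure lborel) (snd ` p2)"
            by (rule sum.over_tagged_division_lemma[OF p2]) (simp add: content_eq_0_interior)
          also have "\<dots> = measure lebesgue (\<Union>(snd ` p2))"
            unfolding content_division[OF div, symmetric]
          proof (rule sum.cong[OF refl])
            fix k assume "k \<in> snd ` p2"
            then obtain u v where "k = cbox u v" using division_ofD(4)[OF div] by blast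
            then show "measure lborel k = measure lebesgue k" by simp
          qed
          also have "\<dots> \<le> measure lebesgue G"
          proof (rule measure_mono_fmeasurable)
            show "\<Union>(snd ` p2) \<subseteq> G"
              using fineD[OF fine] by (force simp: p2_def \<gamma>_def)
            show "\<Union>(snd ` p2) \<in> sets lebesgue"
              using lmeasurable_division[OF div] by blast
          qed (rule G)
          finally show "(\<Sum>i<card p2. B i - A i) < \<delta>" using G by simp
        qed
        then show ?thesis using reidx[of "\<lambda>u v. cmod (f u - f v)"] by simp
      qed
      finally have 2: "norm (sum h p2) < e / 2" .
      show ?thesis unfolding eq using 1 2 norm_triangle_ineq[of "sum h p1" "sum h p2"] by linarith
    qed
    show "\<exists>\<gamma>. gauge \<gamma> \<and> (\<forall>\<D>. \<D> tagged_division_of {a..b} \<and> \<gamma> fine \<D> \<longrightarrow>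
        norm (sum (\<lambda>(x,k). measure lborel k *\<^sub>R g x) \<D> - (f b - f a)) < e)"
      by (intro exI[of _ \<gamma>] conjI allI impI gauge) (elim conjE, rule small)
  qed
  then show ?thesis
    by (rule has_integral_spike[OF N', rotated]) (simp add: g_def)
qed

text \<open>Euler's Beta integral under the substitution
  \<open>t = \<tau> - (\<tau> - s) * x\<close>. It provides the constant by which fractional
  integration undoes the Caputo derivative, and also the Caputo derivatives of powers.\<close>

lemma has_bochner_integral_Beta_kernel:
  fixes a b s \<tau> :: real
  assumes ab: "a > 0" "b > 0" and s: "s < \<tau>"
  shows "has_bochner_integral lborel
    (\<lambda>t. indicator {s<..<\<tau>} t * ((\<tau> - t) powr (a - 1) * (t - s) powr (b - 1)))
    ((\<tau> - s) powr (a + b - 1) * Beta a b)"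
proof -
  let ?f = "\<lambda>t. indicator {s<..<\<tau>} t * ((\<tau> - t) powr (a - 1) * (t - s) powr (b - 1))"
  let ?g = "\<lambda>t. indicator {0..1} t *\<^sub>R (t powr (a - 1) * (1 - t) powr (b - 1))"
  have "has_bochner_integral lborel ?g (Beta a b)"
    using integrable_Beta[OF ab] set_borel_integral_eq_integral(2)[OF integrable_Beta[OF ab]]
      integral_unique[OF has_integral_Beta_real[OF ab]]
    by (simp add: has_bochner_integral_iff set_integrable_def set_lebesgue_integral_def)
  then have "has_bochner_integral lborel (\<lambda>x. (\<tau> - s) powr (a + b - 2) * ?g x)
      ((\<tau> - s) powr (a + b - 2) * Beta a b)"
    by (rule has_bochner_integral_mult_right)
  also have "(\<lambda>x. (\<tau> - s) powr (a + b - 2) * ?g x) = (\<lambda>x. ?f (\<tau> + (- (\<tau> - s)) * x))"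
  proof
    fix x
    show "(\<tau> - s) powr (a + b - 2) * ?g x = ?f (\<tau> + (- (\<tau> - s)) * x)"
    proof (cases "0 < x \<and> x < 1")
      case True
      have "(s - \<tau>) * x < 0" "(\<tau> - s) * x < \<tau> - s"
        using s True by (simp_all add: mult_less_0_iff)
      then have "\<tau> + (- (\<tau> - s)) * x \<in> {s<..<\<tau>}" by (auto simp: algebra_simps)
      moreover have "\<tau> - (\<tau> + (- (\<tau> - s)) * x) = (\<tau> - s) * x"
          "\<tau> + (- (\<tau> - s)) * x - s = (\<tau> - s) * (1 - x)" by (simp_all add: algebra_simps)
      moreover have "((\<tau> - s) * x) powr (a - 1) = (\<tau> - s) powr (a - 1) * x powr (a - 1)"
          "((\<tau> - s) * (1 - x)) powr (b - 1) = (\<tau> - s) powr (b - 1) * (1 - x) powr (b - 1)"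
        using s True by (simp_all add: powr_mult)
      moreover have "(\<tau> - s) powr (a + b - 2) = (\<tau> - s) powr (a - 1) * (\<tau> - s) powr (b - 1)"
        using s by (simp flip: powr_add)
      moreover have "x \<in> {0..1}" using True by simp
      ultimately show ?thesis
        by (simp only: indicator_simps mult_1 real_scaleR_def mult_ac)
    next
      case False
      have "\<tau> + (- (\<tau> - s)) * x \<notin> {s<..<\<tau>}"
      proof
        assume "\<tau> + (- (\<tau> - s)) * x \<in> {s<..<\<tau>}"
        then have "(\<tau> - s) * x > 0" "(\<tau> - s) * (1 - x) > 0" by (auto simp: algebra_simps)
        then show False using s False by (simp add: zero_less_mult_iff)
      qed
      \<comment> \<open>At the end points \<open>0 powr y = 0\<close>, which reconciles the closed
        indicator of \<open>?g\<close> with the open one of \<open>?f\<close>.\<close>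
      moreover have "?g x = 0" using False by (cases "x = 0 \<or> x = 1") (auto simp: indicator_def)
      ultimately show ?thesis by (simp del: scaleR_eq_0_iff)
    qed
  qed
  finally have *: "has_bochner_integral lborel (\<lambda>x. ?f (\<tau> + (- (\<tau> - s)) * x))
      ((\<tau> - s) powr (a + b - 2) * Beta a b)" .
  have eq: "(\<tau> - s) powr (a + b - 2) * Beta a b
     = ((\<tau> - s) powr (a + b - 1) * Beta a b) /\<^sub>R \<bar>- (\<tau> - s)\<bar>"
  proof -
    have "(\<tau> - s) powr (a + b - 1) = (\<tau> - s) powr (a + b - 2) * (\<tau> - s)"
      using s powr_add[of "\<tau> - s" "a + b - 2" 1] by simp
    moreover have "\<bar>- (\<tau> - s)\<bar> = \<tau> - s" using s by simp
    ultimately show ?thesis using s by (simp only: real_scaleR_def) (simp add: field_simps)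
  qed
  have "- (\<tau> - s) \<noteq> 0" using s by simp
  from lborel_has_bochner_integral_real_affine_iff[OF this, of ?f _ \<tau>] *[unfolded eq]
  show ?thesis by blast
qed

lemma has_bochner_integral_power_kernel:
  fixes a s \<tau> :: real
  assumes a: "a > 0" and s: "s < \<tau>"
  shows "has_bochner_integral lborel (\<lambda>t. indicator {s<..<\<tau>} t * (\<tau> - t) powr (a - 1)) ((\<tau> - s) powr a / a)"
proof -
  have "(\<lambda>t. indicator {s<..<\<tau>} t * ((\<tau> - t) powr (a - 1) * (t - s) powr (1 - 1)))
    = (\<lambda>t. indicator {s<..<\<tau>} t * (\<tau> - t) powr (a - 1))"
    by (auto simp: indicator_def)
  moreover have "Beta a 1 = 1 / a"
  proof -
    have "Gamma (a + 1) = a * Gamma a"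
    using a by (intro Gamma_plus1) (auto simp: nonpos_Ints_def)
    moreover have "Gamma a \<noteq> 0"
    using Gamma_real_pos[OF a] by linarith
    ultimately show ?thesis
      using a by (simp add: Beta_def)
  qed
  ultimately show ?thesis
    using has_bochner_integral_Beta_kernel[of a 1 s \<tau>] a s by simp
qed

lemma absolutely_continuous_on_imp_continuous_on:
  assumes "absolutely_continuous_on x y f" shows "continuous_on {x..y} f"
  unfolding continuous_on_iff
proof (intro ballI allI impI)
  fix s and e :: real assume s: "s \<in> {x..y}" and e: "0 < e"
  obtain d where d: "0 < d" "\<forall>(n::nat) a b.
        (\<forall>i<n. x \<le> a i \<and> a i \<le> b i \<and> b i \<le> y) \<longrightarrow>
        (\<forall>i<n. \<forall>j<n. i \<noteq> j \<longrightarrow> {a i<..<b i} \<inter> {a j<..<b j} = {}) \<longrightarrow>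
        (\<Sum>i<n. b i - a i) < d \<longrightarrow> (\<Sum>i<n. cmod (f (b i) - f (a i))) < e"
    using assms e unfolding absolutely_continuous_on_def by blast
  have "dist (f r) (f s) < e" if "r \<in> {x..y}" "dist r s < d" for r
  proof -
    have "(\<Sum>i<1::nat. cmod (f (max r s) - f (min r s))) < e"
      by (rule d(2)[THEN spec, THEN spec, THEN spec, THEN mp, THEN mp, THEN mp])
         (use that s in \<open>auto simp: dist_real_def\<close>)
    then show ?thesis
      by (cases "r \<le> s") (simp_all add: dist_norm norm_minus_commute)
  qed
  then show "\<exists>d>0. \<forall>r\<in>{x..y}. dist r s < d \<longrightarrow> dist (f r) (f s) < e"
    using d(1) by blast
qed

lemma absolutely_continuous_on_subset:
  assumes ac: "absolutely_continuous_on x y f" and y: "y' \<le> y"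
  shows "absolutely_continuous_on x y' f"
  unfolding absolutely_continuous_on_def
proof (intro allI impI)
  fix e :: real assume e: "0 < e"
  obtain d where d: "0 < d" "\<forall>(n::nat) a b.
        (\<forall>i<n. x \<le> a i \<and> a i \<le> b i \<and> b i \<le> y) \<longrightarrow>
        (\<forall>i<n. \<forall>j<n. i \<noteq> j \<longrightarrow> {a i<..<b i} \<inter> {a j<..<b j} = {}) \<longrightarrow>
        (\<Sum>i<n. b i - a i) < d \<longrightarrow> (\<Sum>i<n. cmod (f (b i) - f (a i))) < e"
    using ac e unfolding absolutely_continuous_on_def by blast
  show "\<exists>d>0. \<forall>(n::nat) a b.
        (\<forall>i<n. x \<le> a i \<and> a i \<le> b i \<and> b i \<le> y') \<longrightarrow>
        (\<forall>i<n. \<forall>j<n. i \<noteq> j \<longrightarrow> {a i<..<b i} \<inter> {a j<..<b j} = {}) \<longrightarrow>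
        (\<Sum>i<n. b i - a i) < d \<longrightarrow> (\<Sum>i<n. cmod (f (b i) - f (a i))) < e"
  proof (intro exI[of _ d] conjI allI impI d(1))
    fix n :: nat and a b :: "nat \<Rightarrow> real"
    assume "\<forall>i<n. x \<le> a i \<and> a i \<le> b i \<and> b i \<le> y'"
      and *: "\<forall>i<n. \<forall>j<n. i \<noteq> j \<longrightarrow> {a i<..<b i} \<inter> {a j<..<b j} = {}" "(\<Sum>i<n. b i - a i) < d"
    then have "\<forall>i<n. x \<le> a i \<and> a i \<le> b i \<and> b i \<le> y"
      using y by auto
    from d(2)[THEN spec, THEN spec, THEN spec, THEN mp, THEN mp, THEN mp, OF this *]
    show "(\<Sum>i<n. cmod (f (b i) - f (a i))) < e" .
  qed
qed

lemma AE_interval_obtains: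
  fixes a b :: real
  assumes "AE t in lebesgue. t \<in> {a<..<b} \<longrightarrow> P t" "a < b"
  obtains t where "t \<in> {a<..<b}" "P t"
proof -
  have "\<exists>t\<in>{a<..<b}. P t"
  proof (rule ccontr)
    assume "\<not> ?thesis"
    then have "AE t in lebesgue. t \<notin> {a<..<b}" using assms(1) by auto
    then have "negligible {a<..<b}"
      by (simp add: negligible_iff_null_sets AE_iff_null_sets)
    then show False using open_not_negligible[of "{a<..<b}"] assms(2) by auto
  qed
  with that show thesis by blast
qed

text \<open>The Caputo weight is bounded away from zero on \<open>{0<..<t}\<close>; undoing it
  multiplies an integrable function by the bounded factor
  \<open>(t - s) powr \<alpha>\<close>.\<close>

lemma has_caputo_imp_derivative_integrable:
  assumes "has_caputo \<alpha> f d t" "0 < \<alpha>"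
  shows "set_integrable lebesgue {0<..<t} (\<lambda>s. vector_derivative f (at s))"
proof -
  define G where "G = (\<lambda>s. indicat_real {0<..<t} s *\<^sub>R ((t - s) powr (- \<alpha>) *\<^sub>R vector_derivative f (at s)))"
  have G: "integrable lebesgue G"
    using assms(1) by (simp add: has_caputo_def set_integrable_def G_def)
  have eq: "indicat_real {0<..<t} s *\<^sub>R vector_derivative f (at s) = (t - s) powr \<alpha> *\<^sub>R G s" for s
    by (auto simp: G_def indicator_def powr_minus)
  show ?thesis
    unfolding set_integrable_def eq
  proof (rule Bochner_Integration.integrable_bound)
    show "integrable lebesgue (\<lambda>s. t powr \<alpha> *\<^sub>R G s)" using G by simp
    show "(\<lambda>s. (t - s) powr \<alpha> *\<^sub>R G s) \<in> borel_measurable lebesgue"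
      using borel_measurable_integrable[OF G]
      by (intro borel_measurable_scaleR) (auto intro!: measurable_completion)
    show "AE s in lebesgue. norm ((t - s) powr \<alpha> *\<^sub>R G s) \<le> norm (t powr \<alpha> *\<^sub>R G s)"
    proof (rule AE_I2)
      fix s
      show "norm ((t - s) powr \<alpha> *\<^sub>R G s) \<le> norm (t powr \<alpha> *\<^sub>R G s)"
        using assms(2)
        by (cases "s \<in> {0<..<t}") (auto simp: G_def intro!: mult_right_mono powr_mono2)
    qed
  qed
qed

text \<open>The derivative of an absolutely continuous function is met as a Lebesgue measurable
  function, while Fubini's theorem is applied to Borel products; this supplies a Borel
  representative.\<close>

lemma completion_ex_borel_measurable_complex:
  fixes F :: "'a \<Rightarrow> complex"
  assumes F: "F \<in> borel_measurable (completion M)"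
  shows "\<exists>g\<in>borel_measurable M. AE x in M. F x = g x"
proof -
  obtain g1 where g1: "g1 \<in> borel_measurable M" "AE x in M. Re (F x) = g1 x"
    using completion_ex_borel_measurable_real[of "\<lambda>x. Re (F x)" M] F by auto
  obtain g2 where g2: "g2 \<in> borel_measurable M" "AE x in M. Im (F x) = g2 x"
    using completion_ex_borel_measurable_real[of "\<lambda>x. Im (F x)" M] F by auto
  have "(\<lambda>x. Complex (g1 x) (g2 x)) \<in> borel_measurable M"
    using g1 g2 by (simp add: borel_measurable_complex_iff)
  moreover have "AE x in M. F x = Complex (g1 x) (g2 x)"
    using g1(2) g2(2) by eventually_elim (simp add: complex_eq_iff)
  ultimately show ?thesis by (intro bexI[of _ "\<lambda>x. Complex (g1 x) (g2 x)"])
qed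

lemma set_integrable_singular_kernel:
  fixes f :: "real \<Rightarrow> 'b::{banach, second_countable_topology}"
  assumes \<alpha>: "0 < \<alpha>" and f: "continuous_on {0..\<tau>} f" and t: "0 < t" "t \<le> \<tau>"
  shows "set_integrable lborel {0<..<t} (\<lambda>s. (t - s) powr (\<alpha> - 1) *\<^sub>R f s)"
proof -
  obtain B where B: "\<forall>s\<in>{0..\<tau>}. norm (f s) \<le> B"
    using compact_imp_bounded[OF compact_continuous_image[OF f compact_Icc]]
    by (auto simp: bounded_iff)
  have k: "integrable lborel (\<lambda>s. indicat_real {0<..<t} s * (t - s) powr (\<alpha> - 1))"
    using has_bochner_integral_power_kernel[of \<alpha> 0 t] \<alpha> t by (simp add: has_bochner_integral_iff)
  show ?thesis
    unfolding set_integrable_def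
  proof (rule Bochner_Integration.integrable_bound[OF integrable_mult_right[OF k, of B]])
    have "(\<lambda>s. indicator {0<..<t} s *\<^sub>R f s) \<in> borel_measurable borel"
      by (rule borel_measurable_continuous_on_indicator)
         (use t in \<open>auto intro: continuous_on_subset[OF f]\<close>)
    then have m: "(\<lambda>s. indicator {0<..<t} s *\<^sub>R f s) \<in> borel_measurable lborel" by simp
    have "(\<lambda>s. (t - s) powr (\<alpha> - 1) *\<^sub>R (indicator {0<..<t} s *\<^sub>R f s)) \<in> borel_measurable lborel"
      by (rule borel_measurable_scaleR[OF _ m]) simp
    then show "(\<lambda>s. indicat_real {0<..<t} s *\<^sub>R (t - s) powr (\<alpha> - 1) *\<^sub>R f s) \<in> borel_measurable lborel"
      by (simp only: scaleR_scaleR mult.commute)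
    show "AE s in lborel. norm (indicat_real {0<..<t} s *\<^sub>R (t - s) powr (\<alpha> - 1) *\<^sub>R f s)
      \<le> norm (B * (indicat_real {0<..<t} s * (t - s) powr (\<alpha> - 1)))"
    proof (rule AE_I2)
      fix s
      show "norm (indicat_real {0<..<t} s *\<^sub>R (t - s) powr (\<alpha> - 1) *\<^sub>R f s)
        \<le> norm (B * (indicat_real {0<..<t} s * (t - s) powr (\<alpha> - 1)))"
      proof (cases "s \<in> {0<..<t}")
        case True
        then have "norm (f s) \<le> \<bar>B\<bar>" using bspec[OF B, of s] t by simp
        then show ?thesis
          using True by (simp add: abs_mult mult.commute mult_left_mono)
      qed simp
    qed
  qed
qed

section \<open>The scalar Caputo equation\<close>

text \<open>Integrate the equation against \<open>(\<tau> - t) powr (\<alpha> - 1)\<close> and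
  exchange the integrals. The inner integral equals
  \<open>Gamma \<alpha> * Gamma (1 - \<alpha>)\<close> whatever \<open>s\<close>, so the left side
  collapses to a multiple of the integral of the derivative, which is
  \<open>f \<tau> - f 0\<close>.\<close>

lemma caputo_equation_imp_Volterra:
  fixes f :: "real \<Rightarrow> complex"
  assumes \<alpha>: "0 < \<alpha>" "\<alpha> < 1" and ac: "absolutely_continuous_on 0 T f"
    and eq: "AE t in lebesgue. t \<in> {0<..<T} \<longrightarrow> has_caputo \<alpha> f (c * f t) t"
    and \<tau>: "0 < \<tau>" "\<tau> < T"
  shows "of_real (Gamma \<alpha>) * (f \<tau> - f 0) = c * (LINT t:{0<..<\<tau>}|lborel. (\<tau> - t) powr (\<alpha> - 1) *\<^sub>R f t)"
proof -
  \<comment> \<open>One time \<open>t0 > \<tau>\<close> at which the Caputo derivative exists gives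
    differentiability almost everywhere and an integrable derivative on all of
    \<open>{0<..<\<tau>}\<close>. This is why \<open>\<tau> < T\<close> is strict.\<close>
  have "AE t in lebesgue. t \<in> {\<tau><..<T} \<longrightarrow> has_caputo \<alpha> f (c * f t) t"
    using eq \<tau> by (auto elim: eventually_mono)
  from AE_interval_obtains[OF this \<tau>(2)]
  obtain t0 where t0: "t0 \<in> {\<tau><..<T}" "has_caputo \<alpha> f (c * f t0) t0" by blast
  define N where "N = {s \<in> {0<..<t0}. \<not> f differentiable (at s)}"
  have "AE s in lebesgue. s \<notin> N"
    using t0(2) by (auto simp: has_caputo_def N_def elim: eventually_mono)
  then obtain N' where "{s \<in> space lebesgue. \<not> s \<notin> N} \<subseteq> N'" "emeasure lebesgue N' = 0" "N' \<in> sets lebesgue"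
    by (rule AE_E)
  then have N: "negligible N"
    by (intro negligible_subset[of N' N]) (auto simp: negligible_iff_null_sets null_sets_def)
  let ?f' = "\<lambda>s. vector_derivative f (at s)"
  define F where "F = (\<lambda>s. indicat_real {0<..<\<tau>} s *\<^sub>R ?f' s)"
  have F: "integrable lebesgue F"
  proof -
    have "set_integrable lebesgue {0<..<\<tau>} ?f'"
      by (rule set_integrable_subset[OF has_caputo_imp_derivative_integrable[OF t0(2) \<alpha>(1)]])
         (use t0 in auto)
    then show ?thesis by (simp add: set_integrable_def F_def)
  qed
  obtain g0 where g0: "g0 \<in> borel_measurable lborel" "AE s in lborel. F s = g0 s"
    using completion_ex_borel_measurable_complex[OF borel_measurable_integrable[OF F]] by auto
  define g where "g s = indicat_real {0<..<\<tau>} s *\<^sub>R g0 s" for s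
  have g[measurable]: "g \<in> borel_measurable borel"
    unfolding g_def using g0 by auto
  have Fg: "AE s in lborel. F s = g s"
    using g0(2) by eventually_elim (auto simp: g_def F_def indicator_def)
  have gint: "integrable lborel g"
  proof -
    have "integrable lebesgue g"
      using F by (rule integrable_cong_AE_imp)
        (use g Fg in \<open>auto intro: AE_completion measurable_completion elim: eventually_mono\<close>)
    then show ?thesis by (subst (asm) integrable_completion) auto
  qed
  have FTC: "f \<tau> - f 0 = integral\<^sup>L lborel g"
  proof -
    have "((\<lambda>s. ?f' s) has_integral (f \<tau> - f 0)) {0..\<tau>}"
    proof (rule fundamental_theorem_of_calculus_absolutely_continuous)
      show "absolutely_continuous_on 0 \<tau> f"
        by (rule absolutely_continuous_on_subset[OF ac]) (use \<tau> in auto)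
      show "(f has_vector_derivative ?f' s) (at s)" if "s \<in> {0<..<\<tau>} - N" for s
        using that t0 by (auto simp: N_def vector_derivative_works[symmetric])
    qed (use N \<tau> in auto)
    moreover have "(?f' has_integral (LINT s:{0<..<\<tau>}|lebesgue. ?f' s)) {0<..<\<tau>}"
      using F by (intro has_integral_set_lebesgue) (simp add: set_integrable_def F_def)
    ultimately have "f \<tau> - f 0 = integral\<^sup>L lebesgue F"
      by (simp add: has_integral_Icc_iff_Ioo has_integral_unique set_lebesgue_integral_def F_def)
    also have "\<dots> = integral\<^sup>L lebesgue g"
      by (rule integral_cong_AE)
        (use F Fg g in \<open>auto intro: AE_completion measurable_completion\<close>)
    also have "\<dots> = integral\<^sup>L lborel g"
      by (rule integral_completion) simp
    finally show ?thesis .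
  qed
  \<comment> \<open>The product of both kernels, extended by zero outside the triangle
    \<open>0 < s < t < \<tau>\<close> so that Fubini applies on the plane.\<close>
  define k where "k s t = (if 0 < s \<and> s < t \<and> t < \<tau> then (\<tau> - t) powr (\<alpha> - 1) * (t - s) powr (- \<alpha>) else 0)"
    for s t :: real
  have k[measurable]: "(\<lambda>p. k (fst p) (snd p)) \<in> borel_measurable (borel \<Otimes>\<^sub>M borel)"
    unfolding k_def by measurable
  have k0: "k s t \<ge> 0" for s t by (simp add: k_def)
  have G1: "Gamma (1 - \<alpha>) \<noteq> 0"
    using Gamma_real_pos[of "1 - \<alpha>"] \<alpha> by linarith
  let ?B = "Gamma \<alpha> * Gamma (1 - \<alpha>)"
  have kint: "has_bochner_integral lborel (k s) ?B" if "s \<in> {0<..<\<tau>}" for s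
  proof -
    have "k s = (\<lambda>t. indicator {s<..<\<tau>} t * ((\<tau> - t) powr (\<alpha> - 1) * (t - s) powr ((1 - \<alpha>) - 1)))"
      using that by (auto simp: k_def indicator_def)
    then show ?thesis
      using has_bochner_integral_Beta_kernel[of \<alpha> "1 - \<alpha>" s \<tau>] \<alpha> that by (simp add: Beta_def)
  qed
  have gout: "g s = 0" if "s \<notin> {0<..<\<tau>}" for s using that by (simp add: g_def)
  have inner: "has_bochner_integral lborel (\<lambda>t. k s t *\<^sub>R g s) (?B *\<^sub>R g s)" for s
    using has_bochner_integral_scaleR_left[OF kint[of s]] gout[of s] by (cases "s \<in> {0<..<\<tau>}") auto
  have inner_norm: "has_bochner_integral lborel (\<lambda>t. norm (k s t *\<^sub>R g s)) (?B * norm (g s))" for s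
  proof (cases "s \<in> {0<..<\<tau>}")
    case True
    have "(\<lambda>t. norm (k s t *\<^sub>R g s)) = (\<lambda>t. k s t * norm (g s))"
      using k0[of s] by (simp add: fun_eq_iff)
    then show ?thesis
      using has_bochner_integral_mult_left[OF kint[OF True], of "norm (g s)"] by simp
  next
    case False
    then show ?thesis by (simp add: gout has_bochner_integral_zero)
  qed
  have prod: "integrable (lborel \<Otimes>\<^sub>M lborel) (\<lambda>(s, t). k s t *\<^sub>R g s)"
  proof (rule lborel_pair.Fubini_integrable)
    have "(\<lambda>p. k (fst p) (snd p) *\<^sub>R g (fst p)) \<in> borel_measurable (borel \<Otimes>\<^sub>M borel)"
      by measurable
    then show "(\<lambda>(s, t). k s t *\<^sub>R g s) \<in> borel_measurable (lborel \<Otimes>\<^sub>M lborel)"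
      by (simp add: case_prod_unfold cong: measurable_cong_sets)
    show "integrable lborel (\<lambda>s. LINT t|lborel. norm (case (s, t) of (s, t) \<Rightarrow> k s t *\<^sub>R g s))"
      unfolding prod.case has_bochner_integral_integral_eq[OF inner_norm] using gint by simp
    show "AE s in lborel. integrable lborel (\<lambda>t. case (s, t) of (s, t) \<Rightarrow> k s t *\<^sub>R g s)"
      using inner by (auto simp: has_bochner_integral_iff)
  qed
  have "?B *\<^sub>R (f \<tau> - f 0) = (LINT s|lborel. LINT t|lborel. k s t *\<^sub>R g s)"
    using has_bochner_integral_integral_eq[OF inner] by (simp add: FTC)
  also have "\<dots> = (LINT t|lborel. LINT s|lborel. k s t *\<^sub>R g s)"
    by (rule lborel_pair.Fubini_integral[OF prod, symmetric])
  \<comment> \<open>For almost every \<open>t\<close> the inner integral carries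
    \<open>Gamma (1 - \<alpha>)\<close> times the Caputo derivative, which the equation replaces by
    \<open>c * f t\<close>.\<close>
  also have "\<dots> = (LINT t|lborel. indicat_real {0<..<\<tau>} t *\<^sub>R (Gamma (1 - \<alpha>) * c) * ((\<tau> - t) powr (\<alpha> - 1) *\<^sub>R f t))"
  proof (rule integral_cong_AE)
    have [measurable]: "(\<lambda>p. k (snd p) (fst p)) \<in> borel_measurable (borel \<Otimes>\<^sub>M borel)"
      unfolding k_def by measurable
    have "(\<lambda>p. k (snd p) (fst p) *\<^sub>R g (snd p)) \<in> borel_measurable (borel \<Otimes>\<^sub>M borel)"
      by measurable
    then have "(\<lambda>p. k (snd p) (fst p) *\<^sub>R g (snd p)) \<in> borel_measurable (borel \<Otimes>\<^sub>M lborel)"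
      by (subst measurable_cong_sets[OF sets_pair_measure_cong[OF refl sets_lborel] refl])
    then have "(\<lambda>t. LINT s|lborel. k s t *\<^sub>R g s) \<in> borel_measurable borel"
      by (intro lborel.borel_measurable_lebesgue_integral) (simp add: case_prod_unfold)
    then show "(\<lambda>t. LINT s|lborel. k s t *\<^sub>R g s) \<in> borel_measurable lborel" by simp
    have "set_integrable lborel {0<..<\<tau>} (\<lambda>s. (\<tau> - s) powr (\<alpha> - 1) *\<^sub>R f s)"
      using absolutely_continuous_on_imp_continuous_on[OF ac] \<alpha> \<tau>
      by (intro set_integrable_singular_kernel[where \<tau> = T]) auto
    then have "(\<lambda>t. (Gamma (1 - \<alpha>) * c) * (indicat_real {0<..<\<tau>} t *\<^sub>R ((\<tau> - t) powr (\<alpha> - 1) *\<^sub>R f t))) \<in> borel_measurable lborel"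
      unfolding set_integrable_def by (intro borel_measurable_integrable integrable_mult_right)
    then show "(\<lambda>t. indicat_real {0<..<\<tau>} t *\<^sub>R (Gamma (1 - \<alpha>) * c) * ((\<tau> - t) powr (\<alpha> - 1) *\<^sub>R f t)) \<in> borel_measurable lborel"
      by (simp add: mult_ac)
    have "AE t in lborel. t \<in> {0<..<T} \<longrightarrow> has_caputo \<alpha> f (c * f t) t"
      using eq by (simp add: AE_completion_iff)
    then show "AE t in lborel. (LINT s|lborel. k s t *\<^sub>R g s) =
        indicat_real {0<..<\<tau>} t *\<^sub>R (Gamma (1 - \<alpha>) * c) * ((\<tau> - t) powr (\<alpha> - 1) *\<^sub>R f t)"
    proof eventually_elim
      case (elim t)
      show ?case
      proof (cases "t \<in> {0<..<\<tau>}")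
        case True
        with elim \<tau> have hc: "has_caputo \<alpha> f (c * f t) t" by auto
        let ?K = "\<lambda>h s. indicat_real {0<..<t} s *\<^sub>R (t - s) powr (- \<alpha>) *\<^sub>R h s"
        have "Gamma (1 - \<alpha>) * (c * f t) = (LINT s|lebesgue. ?K ?f' s)"
          using hc G1
          by (simp add: has_caputo_def set_lebesgue_integral_def scaleR_conv_of_real)
        also have "\<dots> = (LINT s|lebesgue. ?K g s)"
        proof (rule integral_cong_AE)
          show "?K ?f' \<in> borel_measurable lebesgue"
            using hc by (auto simp: has_caputo_def set_integrable_def)
          show "?K g \<in> borel_measurable lebesgue"
            by (intro measurable_completion) measurable
          show "AE s in lebesgue. ?K ?f' s = ?K g s"
            using AE_completion[OF Fg]
            by eventually_elim (use True in \<open>auto simp: F_def indicator_def split: if_splits\<close>)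
        qed
        also have "\<dots> = (LINT s|lborel. ?K g s)"
          by (rule integral_completion) measurable
        finally have I: "Gamma (1 - \<alpha>) * (c * f t) = (LINT s|lborel. ?K g s)" .
        have "(LINT s|lborel. k s t *\<^sub>R g s) = (LINT s|lborel. (\<tau> - t) powr (\<alpha> - 1) *\<^sub>R ?K g s)"
          using True by (intro Bochner_Integration.integral_cong) (auto simp: k_def indicator_def)
        also have "\<dots> = (\<tau> - t) powr (\<alpha> - 1) *\<^sub>R (Gamma (1 - \<alpha>) * (c * f t))"
          unfolding I by (rule integral_scaleR_right)
        finally show ?thesis
          using True by (simp add: scaleR_conv_of_real mult_ac)
      next
        case False
        then have "k s t = 0" for s by (auto simp: k_def)
        with False show ?thesis by simp
      qed
    qed
  qed
  also have "\<dots> = Gamma (1 - \<alpha>) * (c * (LINT t:{0<..<\<tau>}|lborel. (\<tau> - t) powr (\<alpha> - 1) *\<^sub>R f t))"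
    unfolding set_lebesgue_integral_def integral_mult_right_zero[symmetric]
    by (rule Bochner_Integration.integral_cong) (auto simp: indicator_def)
  finally show ?thesis
    using G1 by (simp add: scaleR_conv_of_real)
qed

text \<open>The interval is exhausted in steps of length \<open>\<eta>\<close>. On one step the
  kernel has mass at most \<open>\<eta> powr \<alpha> / \<alpha>\<close>, so where
  \<open>cmod (h s)\<close> is largest the inequality bounds it by a proper fraction of
  itself.\<close>

lemma Volterra_inequality_imp_zero:
  fixes h :: "real \<Rightarrow> complex"
  assumes \<alpha>: "0 < \<alpha>" and h: "continuous_on {0..T} h" and K: "0 \<le> K" and h0: "h 0 = 0"
    and ineq: "\<And>t. t \<in> {0<..<T} \<Longrightarrow> cmod (h t) \<le> K * (LINT s:{0<..<t}|lborel. (t - s) powr (\<alpha> - 1) * cmod (h s))"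
    and t: "t \<in> {0..<T}"
  shows "h t = 0"
proof -
  obtain \<eta> where \<eta>: "\<eta> > 0" "K * (\<eta> powr \<alpha> / \<alpha>) < 1"
  proof
    let ?\<eta> = "(\<alpha> / (2 * (K + 1))) powr (1 / \<alpha>)"
    show "?\<eta> > 0" using \<alpha> K by simp
    have "?\<eta> powr \<alpha> / \<alpha> = 1 / (2 * (K + 1))"
      using \<alpha> K by (simp add: powr_powr)
    then show "K * (?\<eta> powr \<alpha> / \<alpha>) < 1"
      using K by simp
  qed
  have "\<forall>t. 0 \<le> t \<and> t < T \<and> t \<le> real n * \<eta> \<longrightarrow> h t = 0" for n
  proof (induction n)
    case 0 then show ?case using h0 by auto
  next
    case (Suc n)
    show ?case
    proof (intro allI impI)
      fix t assume t: "0 \<le> t \<and> t < T \<and> t \<le> real (Suc n) * \<eta>"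
      have "continuous_on {0..t} (\<lambda>s. cmod (h s))"
        using t by (intro continuous_on_norm continuous_on_subset[OF h]) auto
      then obtain r where r: "r \<in> {0..t}" and max: "\<And>s. s \<in> {0..t} \<Longrightarrow> cmod (h s) \<le> cmod (h r)"
        using continuous_attains_sup[of "{0..t}" "\<lambda>s. cmod (h s)"] t by auto
      have "h r = 0"
      proof (cases "r \<le> real n * \<eta>")
        case True then show ?thesis using Suc r t by auto
      next
        case False
        define a where "a = real n * \<eta>"
        have a: "0 \<le> a" "a < r" "r - a \<le> \<eta>"
          using False \<eta> r t by (auto simp: a_def algebra_simps)
        have k: "has_bochner_integral lborel (\<lambda>s. indicat_real {a<..<r} s * (r - s) powr (\<alpha> - 1))
            ((r - a) powr \<alpha> / \<alpha>)"
          using has_bochner_integral_power_kernel[of \<alpha> a r] \<alpha> a by simp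
        have "(LINT s:{0<..<r}|lborel. (r - s) powr (\<alpha> - 1) * cmod (h s))
            \<le> (LINT s|lborel. cmod (h r) * (indicat_real {a<..<r} s * (r - s) powr (\<alpha> - 1)))"
          unfolding set_lebesgue_integral_def
        proof (rule integral_mono)
          show "integrable lborel (\<lambda>s. indicat_real {0<..<r} s *\<^sub>R ((r - s) powr (\<alpha> - 1) * cmod (h s)))"
            using set_integrable_singular_kernel[OF \<alpha>, of T "\<lambda>s. cmod (h s)" r] h a r t
            by (auto simp: set_integrable_def intro: continuous_intros)
          show "integrable lborel (\<lambda>s. cmod (h r) * (indicat_real {a<..<r} s * (r - s) powr (\<alpha> - 1)))"
            using k by (auto simp: has_bochner_integral_iff)
          fix s
          show "indicat_real {0<..<r} s *\<^sub>R ((r - s) powr (\<alpha> - 1) * cmod (h s))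
            \<le> cmod (h r) * (indicat_real {a<..<r} s * (r - s) powr (\<alpha> - 1))"
          proof (cases "s \<in> {0<..<r}")
            case s: True
            show ?thesis
            proof (cases "s \<le> a")
              case True
              then have "h s = 0" using Suc s r t by (auto simp: a_def)
              then show ?thesis by (simp add: indicator_def)
            next
              case False
              then show ?thesis
                using s max[of s] r by (simp add: mult.commute mult_left_mono)
            qed
          qed simp
        qed
        also have "\<dots> = cmod (h r) * ((r - a) powr \<alpha> / \<alpha>)"
          using has_bochner_integral_integral_eq[OF k] by simp
        finally have le: "K * (LINT s:{0<..<r}|lborel. (r - s) powr (\<alpha> - 1) * cmod (h s))
            \<le> K * (cmod (h r) * ((r - a) powr \<alpha> / \<alpha>))"
          using K by (rule mult_left_mono)
        have "(r - a) powr \<alpha> / \<alpha> \<le> \<eta> powr \<alpha> / \<alpha>"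
          using a \<alpha> by (intro divide_right_mono powr_mono2) auto
        then have "K * ((r - a) powr \<alpha> / \<alpha>) < 1"
          using \<eta> K by (meson le_less_trans mult_left_mono)
        moreover have "cmod (h r) \<le> cmod (h r) * (K * ((r - a) powr \<alpha> / \<alpha>))"
          using ineq[of r] le a r t by (simp add: mult_ac)
        ultimately show ?thesis
          by (smt (verit) mult_le_cancel_left1 norm_ge_zero zero_less_norm_iff)
      qed
      then show "h t = 0" using max[of t] t by simp
    qed
  qed
  moreover obtain n where "t / \<eta> \<le> real n" using real_arch_simple by blast
  ultimately show ?thesis using t \<eta> by (auto simp: field_simps)
qed

lemma caputo_equation_unique:
  fixes f g :: "real \<Rightarrow> complex"
  assumes \<alpha>: "0 < \<alpha>" "\<alpha> < 1"
    and f: "absolutely_continuous_on 0 T f" "AE t in lebesgue. t \<in> {0<..<T} \<longrightarrow> has_caputo \<alpha> f (c * f t) t"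
    and g: "absolutely_continuous_on 0 T g" "AE t in lebesgue. t \<in> {0<..<T} \<longrightarrow> has_caputo \<alpha> g (c * g t) t"
    and init: "f 0 = g 0" and t: "t \<in> {0..T}"
  shows "f t = g t"
proof -
  define h where "h s = f s - g s" for s
  have cf: "continuous_on {0..T} f" and cg: "continuous_on {0..T} g"
    using f g by (auto intro: absolutely_continuous_on_imp_continuous_on)
  have ch: "continuous_on {0..T} h"
    unfolding h_def by (intro continuous_intros cf cg)
  have G: "Gamma \<alpha> > 0" using \<alpha> by (simp add: Gamma_real_pos)
  have zero: "h s = 0" if s: "s \<in> {0..<T}" for s
  proof (rule Volterra_inequality_imp_zero[OF \<alpha>(1) ch])
    show "0 \<le> cmod c / Gamma \<alpha>" using G by simp
    show "cmod (h t) \<le> cmod c / Gamma \<alpha> * (LINT s:{0<..<t}|lborel. (t - s) powr (\<alpha> - 1) * cmod (h s))"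
      if t: "t \<in> {0<..<T}" for t
    proof -
      have i: "set_integrable lborel {0<..<t} (\<lambda>s. (t - s) powr (\<alpha> - 1) *\<^sub>R f s)"
          "set_integrable lborel {0<..<t} (\<lambda>s. (t - s) powr (\<alpha> - 1) *\<^sub>R g s)"
        using t \<alpha> cf cg by (auto intro!: set_integrable_singular_kernel[where \<tau> = T])
      have "of_real (Gamma \<alpha>) * h t = of_real (Gamma \<alpha>) * (f t - f 0) - of_real (Gamma \<alpha>) * (g t - g 0)"
        by (simp add: h_def init algebra_simps)
      also have "\<dots> = c * (LINT s:{0<..<t}|lborel. (t - s) powr (\<alpha> - 1) *\<^sub>R h s)"
        using caputo_equation_imp_Volterra[OF \<alpha> f, of t] caputo_equation_imp_Volterra[OF \<alpha> g, of t] t i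
        by (simp add: h_def scaleR_diff_right set_integral_diff algebra_simps)
      finally have "Gamma \<alpha> * cmod (h t) = cmod c * cmod (LINT s:{0<..<t}|lborel. (t - s) powr (\<alpha> - 1) *\<^sub>R h s)"
        using G by (metis norm_mult norm_of_real abs_of_pos)
      also have "\<dots> \<le> cmod c * (LINT s:{0<..<t}|lborel. (t - s) powr (\<alpha> - 1) * cmod (h s))"
        unfolding set_lebesgue_integral_def
        by (rule mult_left_mono[OF order_trans[OF integral_norm_bound eq_refl]])
           (auto intro: Bochner_Integration.integral_cong)
      finally have "Gamma \<alpha> * cmod (h t) \<le> cmod c * (LINT s:{0<..<t}|lborel. (t - s) powr (\<alpha> - 1) * cmod (h s))" .
      then have "cmod (h t) \<le> (cmod c * (LINT s:{0<..<t}|lborel. (t - s) powr (\<alpha> - 1) * cmod (h s))) / Gamma \<alpha>"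
        by (simp only: pos_le_divide_eq[OF G] mult.commute[of _ "Gamma \<alpha>"])
      then show ?thesis by simp
    qed
  qed (use s init in \<open>auto simp: h_def\<close>)
  \<comment> \<open>The Volterra equation is available for \<open>t < T\<close> only; the end point
    follows by continuity.\<close>
  show ?thesis
  proof (cases "t = T \<and> T \<noteq> 0")
    case True
    then have "T > 0" using t by auto
    have "closed {s \<in> {0..T}. h s = 0}"
      by (rule continuous_closed_preimage_constant[OF ch]) simp
    then have "closure {0..<T} \<subseteq> {s \<in> {0..T}. h s = 0}"
      using zero by (intro closure_minimal) auto
    then have "T \<in> {s \<in> {0..T}. h s = 0}"
      by (rule subsetD) (use \<open>T > 0\<close> in \<open>simp add: closure_atLeastLessThan\<close>)
    then have "h T = 0" by simp
    then show ?thesis using True by (simp add: h_def)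
  next
    case False
    then show ?thesis using zero[of t] t init by (cases "T = 0") (auto simp: h_def)
  qed
qed

section \<open>The Mittag-Leffler function\<close>

text \<open>Only the part of Euler's integral over \<open>{M..M+1}\<close> is kept. As
  \<open>M\<close> is arbitrary, Gamma outgrows every exponential.\<close>

lemma Gamma_ge_powr:
  fixes x M :: real
  assumes "0 \<le> x" "0 < M"
  shows "M powr x / exp (M + 1) \<le> Gamma (x + 1)"
proof -
  have G: "((\<lambda>t. t powr x / exp t) has_integral Gamma (x + 1)) {0..}"
    using Gamma_integral_real[of "x + 1"] assms by simp
  have "(\<lambda>t. t powr x / exp t) integrable_on {M..M+1}"
    using assms by (intro integrable_continuous_real continuous_intros) auto
  then obtain j where j: "((\<lambda>t. t powr x / exp t) has_integral j) {M..M+1}"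
    by (auto simp: integrable_on_def)
  have c: "((\<lambda>t. M powr x / exp (M + 1)) has_integral (M powr x / exp (M + 1))) {M..M+1}"
    using has_integral_const_real[of "M powr x / exp (M + 1)" M "M + 1"] by simp
  have "M powr x / exp (M + 1) \<le> j"
    using assms by (intro has_integral_le[OF c j] frac_le powr_mono2) auto
  also have "j \<le> Gamma (x + 1)"
    using assms by (intro has_integral_subset_le[OF _ j G]) auto
  finally show ?thesis .
qed

section \<open>The Mittag-Leffler series\<close>

definition ml_coeff :: "real \<Rightarrow> nat \<Rightarrow> real" where
  "ml_coeff \<alpha> k = 1 / Gamma (\<alpha> * real k + 1)"

definition mittag_leffler :: "real \<Rightarrow> complex \<Rightarrow> complex" where
  "mittag_leffler \<alpha> z = (\<Sum>k. of_real (ml_coeff \<alpha> k) * z ^ k)"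

lemma ml_coeff_pos: "0 < \<alpha> \<Longrightarrow> 0 < ml_coeff \<alpha> k"
  by (simp add: ml_coeff_def Gamma_real_pos add_nonneg_pos)

lemma ml_coeff_le:
  assumes "0 < \<alpha>" "0 < M"
  shows "ml_coeff \<alpha> k \<le> exp (M + 1) * (M powr (- \<alpha>)) ^ k"
proof -
  have e: "(M powr (- \<alpha>)) ^ k = 1 / M powr (\<alpha> * real k)"
    using assms by (simp add: powr_powr powr_minus field_simps flip: powr_realpow)
  have "0 < Gamma (\<alpha> * real k + 1)"
    using assms by (simp add: Gamma_real_pos add_nonneg_pos)
  then show ?thesis
    using Gamma_ge_powr[of "\<alpha> * real k" M] assms
    unfolding e ml_coeff_def by (simp add: field_simps)
qed

lemma summable_ml_coeff:
  fixes x :: real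
  assumes \<alpha>: "0 < \<alpha>" shows "summable (\<lambda>k. ml_coeff \<alpha> k * x ^ k)"
proof -
  \<comment> \<open>Chosen so that the geometric ratio
    \<open>\<bar>x\<bar> * M powr (- \<alpha>)\<close> stays below 1/2.\<close>
  define M where "M = (2 * \<bar>x\<bar> + 1) powr (1 / \<alpha>)"
  have M: "M > 0" "M powr (- \<alpha>) = 1 / (2 * \<bar>x\<bar> + 1)"
    using \<alpha> by (simp_all add: M_def powr_powr powr_minus field_simps)
  show ?thesis
  proof (rule summable_comparison_test')
    show "summable (\<lambda>k. exp (M + 1) * (1/2) ^ k :: real)"
      by (intro summable_mult summable_geometric) simp
    fix k :: nat
    have "norm (ml_coeff \<alpha> k * x ^ k) \<le> exp (M + 1) * (M powr (- \<alpha>)) ^ k * \<bar>x\<bar> ^ k"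
      using ml_coeff_le[OF \<alpha> M(1), of k] ml_coeff_pos[OF \<alpha>, of k]
      by (simp add: abs_mult power_abs mult_right_mono)
    also have "\<dots> = exp (M + 1) * (\<bar>x\<bar> / (2 * \<bar>x\<bar> + 1)) ^ k"
      by (simp add: M power_divide power_one_over)
    also have "\<dots> \<le> exp (M + 1) * (1/2) ^ k"
      by (intro mult_left_mono power_mono) (auto simp: field_simps)
    finally show "norm (ml_coeff \<alpha> k * x ^ k) \<le> exp (M + 1) * (1/2) ^ k" .
  qed
qed

lemma summable_norm_ml_coeff:
  assumes \<alpha>: "0 < \<alpha>"
  shows "summable (\<lambda>k. norm (of_real (ml_coeff \<alpha> k) * z ^ k :: complex))"
  using summable_ml_coeff[OF \<alpha>, of "cmod z"] ml_coeff_pos[OF \<alpha>]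
  by (simp add: norm_mult norm_power abs_of_pos)

lemma mittag_leffler_sums:
  "0 < \<alpha> \<Longrightarrow> (\<lambda>k. of_real (ml_coeff \<alpha> k) * z ^ k) sums mittag_leffler \<alpha> z"
  unfolding mittag_leffler_def by (rule summable_sums[OF summable_norm_cancel[OF summable_norm_ml_coeff]])

lemma mittag_leffler_0 [simp]: "mittag_leffler \<alpha> 0 = 1"
proof -
  have "(\<lambda>k. of_real (ml_coeff \<alpha> k) * 0 ^ k) sums (of_real (ml_coeff \<alpha> 0) :: complex)"
    using powser_sums_zero[of "\<lambda>k. of_real (ml_coeff \<alpha> k)"] by simp
  then show ?thesis
    unfolding mittag_leffler_def by (simp add: sums_iff ml_coeff_def)
qed

definition mittag_leffler' :: "real \<Rightarrow> complex \<Rightarrow> complex" where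
  "mittag_leffler' \<alpha> z = (\<Sum>k. diffs (\<lambda>k. of_real (ml_coeff \<alpha> k)) k * z ^ k)"

lemma mittag_leffler_has_derivative:
  assumes "0 < \<alpha>"
  shows "(mittag_leffler \<alpha> has_field_derivative mittag_leffler' \<alpha> z) (at z within S)"
proof -
  have "summable (\<lambda>k. of_real (ml_coeff \<alpha> k) * y ^ k)" for y :: complex
    by (rule summable_norm_cancel[OF summable_norm_ml_coeff[OF assms]])
  from termdiffs_strong_converges_everywhere[OF this]
  show ?thesis
    unfolding mittag_leffler_def [abs_def] mittag_leffler'_def
    by (rule has_field_derivative_at_within)
qed

lemma continuous_on_mittag_leffler:
  assumes "0 < \<alpha>" shows "continuous_on S (mittag_leffler \<alpha>)"
  by (rule DERIV_continuous_on[OF mittag_leffler_has_derivative[OF assms]])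

lemma mittag_leffler'_bounded:
  assumes "0 < \<alpha>" shows "bounded (mittag_leffler' \<alpha> ` cball 0 R)"
proof -
  have "summable (\<lambda>k. of_real (ml_coeff \<alpha> k) * z ^ k)" for z :: complex
    by (rule summable_norm_cancel[OF summable_norm_ml_coeff[OF assms]])
  then have "summable (\<lambda>k. diffs (\<lambda>k. of_real (ml_coeff \<alpha> k)) k * z ^ k)" for z :: complex
    by (rule termdiff_converges_all)
  then have "isCont (mittag_leffler' \<alpha>) z" for z
    unfolding mittag_leffler'_def [abs_def] by (rule isCont_powser_converges_everywhere)
  then show ?thesis
    by (intro compact_imp_bounded compact_continuous_image continuous_at_imp_continuous_on) auto
qed

lemma Gamma_plus1_pos: "Gamma (x + 1) = x * Gamma x" if "0 < x" for x :: real
  using that by (intro Gamma_plus1) (auto simp: nonpos_Ints_def)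

text \<open>The functional equation of Gamma at \<open>\<alpha> * (real k + 1)\<close>. In this form
  the coefficients of the derivative cancel against Beta integrals.\<close>

lemma diffs_ml_coeff:
  assumes "0 < \<alpha>"
  shows "\<alpha> * diffs (ml_coeff \<alpha>) k = 1 / Gamma (\<alpha> * (real k + 1))"
proof -
  define a where "a = \<alpha> * (real k + 1)"
  have a: "a > 0" using assms by (simp add: a_def)
  have "real (Suc k) = real k + 1" by simp
  then have "\<alpha> * diffs (ml_coeff \<alpha>) k = a / Gamma (a + 1)"
    unfolding diffs_def ml_coeff_def a_def by (simp only: times_divide_eq_right mult_1_right mult.assoc)
  also have "\<dots> = 1 / Gamma a"
    using a Gamma_real_pos[OF a] by (simp only: Gamma_plus1_pos[OF a]) simp
  finally show ?thesis by (simp add: a_def)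
qed

text \<open>The function with value 1 at \<open>t = 0\<close> whose Caputo derivative of order
  \<open>\<alpha>\<close> is \<open>\<mu>\<close> times itself; see
  \<open>has_caputo_relaxation\<close>.\<close>

definition relaxation :: "real \<Rightarrow> complex \<Rightarrow> real \<Rightarrow> complex" where
  "relaxation \<alpha> \<mu> t = mittag_leffler \<alpha> (\<mu> * of_real (t powr \<alpha>))"

lemma relaxation_0 [simp]: "relaxation \<alpha> \<mu> 0 = 1"
  by (simp add: relaxation_def)

lemma continuous_on_relaxation:
  assumes "0 < \<alpha>" shows "continuous_on {0..} (relaxation \<alpha> \<mu>)"
  unfolding relaxation_def
  by (rule continuous_on_compose2[OF continuous_on_mittag_leffler[OF assms, of UNIV]])
     (use assms in \<open>auto intro!: continuous_on_mult continuous_on_const continuous_on_of_real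
       continuous_on_powr' continuous_on_id\<close>)

lemma relaxation_has_vector_derivative:
  assumes \<alpha>: "0 < \<alpha>" and t: "0 < t"
  shows "(relaxation \<alpha> \<mu> has_vector_derivative
     (of_real (\<alpha> * t powr (\<alpha> - 1)) * \<mu> * mittag_leffler' \<alpha> (\<mu> * of_real (t powr \<alpha>)))) (at t)"
proof -
  have "((\<lambda>s. s powr \<alpha>) has_real_derivative \<alpha> * t powr (\<alpha> - 1)) (at t)"
    using t by (auto intro!: derivative_eq_intros)
  then have "((\<lambda>s. \<mu> * complex_of_real (s powr \<alpha>)) has_vector_derivative
      (\<mu> * of_real (\<alpha> * t powr (\<alpha> - 1)))) (at t)"
    by (intro has_vector_derivative_mult_right has_vector_derivative_of_real)
       (simp add: has_real_derivative_iff_has_vector_derivative)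
  from field_vector_diff_chain_at[OF this mittag_leffler_has_derivative[OF \<alpha>]]
  show ?thesis by (simp add: relaxation_def [abs_def] o_def mult_ac)
qed

lemma relaxation_derivative_sums:
  assumes \<alpha>: "0 < \<alpha>" and s: "0 < s"
  shows "(\<lambda>k. of_real (s powr (\<alpha> * (real k + 1) - 1) / Gamma (\<alpha> * (real k + 1))) * \<mu> ^ Suc k)
     sums vector_derivative (relaxation \<alpha> \<mu>) (at s)" (is ?sums)
    and "summable (\<lambda>k. norm (of_real (s powr (\<alpha> * (real k + 1) - 1) / Gamma (\<alpha> * (real k + 1))) * \<mu> ^ Suc k))"
      (is ?norm)
proof -
  let ?c = "\<lambda>k. complex_of_real (ml_coeff \<alpha> k)"
  have d: "diffs ?c k = of_real (diffs (ml_coeff \<alpha>) k)" for k by (simp add: diffs_def)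
  have trm: "of_real (\<alpha> * s powr (\<alpha> - 1)) * \<mu> * (diffs ?c k * (\<mu> * of_real (s powr \<alpha>)) ^ k)
    = of_real (s powr (\<alpha> * (real k + 1) - 1) / Gamma (\<alpha> * (real k + 1))) * \<mu> ^ Suc k" for k
  proof -
    have "s powr (\<alpha> * (real k + 1) - 1) = s powr (\<alpha> - 1) * (s powr \<alpha>) ^ k"
      using s by (simp add: powr_powr algebra_simps flip: powr_realpow powr_add)
    moreover have "1 / Gamma (\<alpha> * (real k + 1)) = \<alpha> * diffs (ml_coeff \<alpha>) k"
      using diffs_ml_coeff[OF \<alpha>] by simp
    ultimately have "s powr (\<alpha> * (real k + 1) - 1) / Gamma (\<alpha> * (real k + 1))
      = s powr (\<alpha> - 1) * (s powr \<alpha>) ^ k * (\<alpha> * diffs (ml_coeff \<alpha>) k)"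
      by (metis times_divide_eq_right mult.right_neutral)
    then show ?thesis unfolding d by (simp add: power_mult_distrib)
  qed
  have sm: "summable (\<lambda>k. norm (diffs ?c k * z ^ k))" for z
  proof -
    have "summable (\<lambda>k. diffs ?c k * y ^ k)" for y
      by (rule termdiff_converges_all[OF summable_norm_cancel[OF summable_norm_ml_coeff[OF \<alpha>]]])
    from powser_insidea[OF this[of "of_real (cmod z + 1)"]] show ?thesis by simp
  qed
  have "(\<lambda>k. diffs ?c k * z ^ k) sums mittag_leffler' \<alpha> z" for z
    unfolding mittag_leffler'_def by (rule summable_sums[OF summable_norm_cancel[OF sm]])
  from sums_mult[OF this] show ?sums
    unfolding vector_derivative_at[OF relaxation_has_vector_derivative[OF \<alpha> s]] trm[symmetric] .
  show ?norm
    unfolding trm[symmetric] norm_mult[of "_ * \<mu>"] by (intro summable_mult sm)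
qed

text \<open>Termwise: the Beta integral turns \<open>s powr (\<alpha> * (real k + 1) - 1)\<close>
  into a multiple of \<open>t powr (\<alpha> * real k)\<close>, which restores the original series.
  Sum and integral may be exchanged because the integrated norms form a Mittag-Leffler series at
  \<open>cmod \<mu> * t powr \<alpha>\<close>.\<close>

lemma has_caputo_relaxation:
  assumes \<alpha>: "0 < \<alpha>" "\<alpha> < 1" and t: "0 < t"
  shows "has_caputo \<alpha> (relaxation \<alpha> \<mu>) (\<mu> * relaxation \<alpha> \<mu> t) t"
proof -
  let ?f' = "\<lambda>s. vector_derivative (relaxation \<alpha> \<mu>) (at s)"
  let ?b = "\<lambda>k. \<alpha> * (real k + 1)"
  \<comment> \<open>The exponents and the lower limit 0 are written as in
    \<open>has_bochner_integral_Beta_kernel\<close>.\<close>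
  define q where "q k s = indicat_real {0<..<t} s * ((t - s) powr ((1 - \<alpha>) - 1) * (s - 0) powr (?b k - 1))" for k s
  define w where "w k = of_real (1 / Gamma (?b k)) * \<mu> ^ Suc k" for k
  have b: "?b k > 0" for k using \<alpha> by simp
  have Gb: "Gamma (?b k) > 0" for k using b by (rule Gamma_real_pos)
  have q: "has_bochner_integral lborel (q k) (t powr (\<alpha> * real k) * Beta (1 - \<alpha>) (?b k))" for k
    using has_bochner_integral_Beta_kernel[of "1 - \<alpha>" "?b k" 0 t] \<alpha> b t
    unfolding q_def by (simp add: algebra_simps)
  \<comment> \<open>The arguments of Beta add up to \<open>(1 - \<alpha>) + \<alpha> * (real k + 1)
    = \<alpha> * real k + 1\<close>.\<close>
  have val: "Beta (1 - \<alpha>) (?b k) / Gamma (?b k) = Gamma (1 - \<alpha>) * ml_coeff \<alpha> k" for k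
    using Gb[of k] by (simp add: Beta_def ml_coeff_def algebra_simps)
  have q0: "q k s \<ge> 0" for k s by (simp add: q_def)
  have wn: "norm (w k) = cmod \<mu> ^ Suc k / Gamma (?b k)" for k
    using Gb[of k] by (simp add: w_def norm_mult norm_power norm_divide)
  have tp: "t powr (\<alpha> * real k) = (t powr \<alpha>) ^ k" for k
    using t by (simp add: powr_powr flip: powr_realpow)
  have I: "has_bochner_integral lborel (\<lambda>s. q k s *\<^sub>R w k)
     (of_real (Gamma (1 - \<alpha>)) * \<mu> * (of_real (ml_coeff \<alpha> k) * (\<mu> * of_real (t powr \<alpha>)) ^ k))" for k
  proof -
    have "(t powr (\<alpha> * real k) * Beta (1 - \<alpha>) (?b k)) *\<^sub>R w k
      = of_real ((t powr \<alpha>) ^ k * (Beta (1 - \<alpha>) (?b k) / Gamma (?b k))) * \<mu> ^ Suc k"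
      by (simp add: w_def tp scaleR_conv_of_real)
    also have "\<dots> = of_real (Gamma (1 - \<alpha>)) * \<mu> * (of_real (ml_coeff \<alpha> k) * (\<mu> * of_real (t powr \<alpha>)) ^ k)"
      unfolding val by (simp add: power_mult_distrib mult_ac)
    finally show ?thesis using has_bochner_integral_scaleR_left[OF q[of k], of "w k"] by simp
  qed
  have In: "(LINT s|lborel. norm (q k s *\<^sub>R w k)) = Gamma (1 - \<alpha>) * cmod \<mu> * (ml_coeff \<alpha> k * (cmod \<mu> * t powr \<alpha>) ^ k)" for k
  proof -
    have "(LINT s|lborel. norm (q k s *\<^sub>R w k)) = t powr (\<alpha> * real k) * Beta (1 - \<alpha>) (?b k) * norm (w k)"
      using has_bochner_integral_integral_eq[OF has_bochner_integral_mult_left[OF q[of k], of "norm (w k)"]] q0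
      by simp
    also have "\<dots> = (t powr \<alpha>) ^ k * cmod \<mu> ^ Suc k * (Beta (1 - \<alpha>) (?b k) / Gamma (?b k))"
      by (simp add: tp wn)
    finally show ?thesis unfolding val by (simp add: power_mult_distrib mult_ac)
  qed
  have trm: "q k s *\<^sub>R w k = (indicat_real {0<..<t} s * (t - s) powr (- \<alpha>)) *\<^sub>R
      (of_real (s powr (?b k - 1) / Gamma (?b k)) * \<mu> ^ Suc k)" for k s
    by (simp add: q_def w_def scaleR_conv_of_real)
  have pt: "(\<lambda>k. q k s *\<^sub>R w k) sums (indicat_real {0<..<t} s *\<^sub>R (t - s) powr (- \<alpha>) *\<^sub>R ?f' s)"
    and ptn: "summable (\<lambda>k. norm (q k s *\<^sub>R w k))" for s
  proof -
    show "(\<lambda>k. q k s *\<^sub>R w k) sums (indicat_real {0<..<t} s *\<^sub>R (t - s) powr (- \<alpha>) *\<^sub>R ?f' s)"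
    proof (cases "s \<in> {0<..<t}")
      case True
      then show ?thesis
        using sums_scaleR_right[OF relaxation_derivative_sums(1)[OF \<alpha>(1), of s \<mu>], of "(t - s) powr (- \<alpha>)"]
        unfolding trm by simp
    qed (simp add: trm)
    show "summable (\<lambda>k. norm (q k s *\<^sub>R w k))"
    proof (cases "s \<in> {0<..<t}")
      case True
      then show ?thesis
        using summable_mult[OF relaxation_derivative_sums(2)[OF \<alpha>(1), of s \<mu>], of "(t - s) powr (- \<alpha>)"]
        unfolding trm by simp
    qed (simp add: trm)
  qed
  have Iint: "integrable lborel (\<lambda>s. q k s *\<^sub>R w k)" for k
    using I[of k] by (auto simp: has_bochner_integral_iff)
  have S: "summable (\<lambda>k. LINT s|lborel. norm (q k s *\<^sub>R w k))"
    unfolding In by (intro summable_mult summable_ml_coeff \<alpha>)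
  let ?g = "\<lambda>s. indicat_real {0<..<t} s *\<^sub>R (t - s) powr (- \<alpha>) *\<^sub>R ?f' s"
  have eq: "(\<lambda>s. \<Sum>k. q k s *\<^sub>R w k) = ?g"
    using pt by (auto simp: sums_iff)
  have gi: "integrable lborel ?g"
    using integrable_suminf[OF Iint AE_I2[OF ptn] S] unfolding eq .
  have "(\<lambda>k. integral\<^sup>L lborel (\<lambda>s. q k s *\<^sub>R w k)) sums integral\<^sup>L lborel ?g"
    using sums_integral[OF Iint AE_I2[OF ptn] S] unfolding eq .
  moreover have "(\<lambda>k. integral\<^sup>L lborel (\<lambda>s. q k s *\<^sub>R w k)) sums
      (of_real (Gamma (1 - \<alpha>)) * \<mu> * relaxation \<alpha> \<mu> t)"
    unfolding has_bochner_integral_integral_eq[OF I] relaxation_def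
    by (intro sums_mult mittag_leffler_sums \<alpha>)
  ultimately have gv: "integral\<^sup>L lborel ?g = of_real (Gamma (1 - \<alpha>)) * \<mu> * relaxation \<alpha> \<mu> t"
    by (rule sums_unique2)
  have "Gamma (1 - \<alpha>) \<noteq> 0" using Gamma_real_pos[of "1 - \<alpha>"] \<alpha> by linarith
  moreover have "AE s in lebesgue. s \<in> {0<..<t} \<longrightarrow> relaxation \<alpha> \<mu> differentiable (at s)"
    using relaxation_has_vector_derivative[OF \<alpha>(1)] by (auto intro!: AE_I2 differentiableI_vector)
  ultimately show ?thesis
    using gi gv borel_measurable_integrable[OF gi]
    by (simp add: has_caputo_def set_integrable_def set_lebesgue_integral_def integrable_completion
        integral_completion scaleR_conv_of_real)
qed

section \<open>Absolute continuity of the relaxation function\<close>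

lemma sum_disjoint_intervals_le:
  fixes u v :: "nat \<Rightarrow> real"
  assumes uv: "\<And>i. i < n \<Longrightarrow> 0 \<le> u i \<and> u i \<le> v i \<and> v i \<le> H"
    and disj: "\<And>i j. i < n \<Longrightarrow> j < n \<Longrightarrow> i \<noteq> j \<Longrightarrow> {u i<..<v i} \<inter> {u j<..<v j} = {}"
    and H: "0 \<le> H"
  shows "(\<Sum>i<n. v i - u i) \<le> H"
proof -
  have "(\<Sum>i<n. v i - u i) = (\<Sum>i<n. measure lborel {u i<..<v i})"
    using uv by (intro sum.cong) auto
  also have "\<dots> = measure lborel (\<Union>i\<in>{..<n}. {u i<..<v i})"
  proof (rule measure_finite_Union[symmetric])
    show "disjoint_family_on (\<lambda>i. {u i<..<v i}) {..<n}"
      using disj unfolding disjoint_family_on_def by (metis lessThan_iff)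
    show "emeasure lborel {u i<..<v i} \<noteq> \<infinity>" for i
      using emeasure_bounded_finite[of "{u i<..<v i}"] by (simp add: less_top)
  qed auto
  also have "\<dots> \<le> measure lborel {0..H}"
  proof (rule measure_mono_fmeasurable)
    show "(\<Union>i\<in>{..<n}. {u i<..<v i}) \<subseteq> {0..H}"
      using uv by fastforce
    show "{0..H} \<in> fmeasurable lborel"
      by (rule fmeasurableI[OF _ emeasure_bounded_finite]) simp_all
  qed auto
  finally show ?thesis using H by simp
qed

lemma powr_diff_le:
  fixes x y \<eta> \<alpha> :: real
  assumes "0 < \<alpha>" "\<alpha> < 1" "0 < \<eta>" "\<eta> \<le> x" "x \<le> y"
  shows "y powr \<alpha> - x powr \<alpha> \<le> \<alpha> * \<eta> powr (\<alpha> - 1) * (y - x)"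
proof (cases "x = y")
  case False
  then have "x < y" using assms by simp
  obtain z where z: "x < z" "z < y" "y powr \<alpha> - x powr \<alpha> = (y - x) * (\<alpha> * z powr (\<alpha> - 1))"
  proof -
    have "\<exists>z>x. z < y \<and> y powr \<alpha> - x powr \<alpha> = (y - x) * (\<alpha> * z powr (\<alpha> - 1))"
      using assms by (intro MVT2[OF \<open>x < y\<close>]) (auto intro!: derivative_eq_intros)
    then show thesis using that by blast
  qed
  have "z powr (\<alpha> - 1) \<le> \<eta> powr (\<alpha> - 1)"
    using z assms by (intro powr_mono2') auto
  then show ?thesis
    using z assms \<open>x < y\<close> by (simp add: mult.commute mult_left_mono)
qed simp

text \<open>The derivative of \<open>t powr \<alpha>\<close> is unbounded at 0. Cut at
  \<open>\<eta>\<close>, the part below has total variation at most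
  \<open>\<eta> powr \<alpha>\<close> and the part above is Lipschitz; the constants make each
  contribute less than \<open>\<epsilon> / 2\<close>.\<close>

lemma absolutely_continuous_on_of_powr_bound:
  fixes f :: "real \<Rightarrow> complex"
  assumes \<alpha>: "0 < \<alpha>" "\<alpha> < 1" and L: "0 \<le> L"
    and f: "\<And>a b. 0 \<le> a \<Longrightarrow> a \<le> b \<Longrightarrow> b \<le> T \<Longrightarrow> cmod (f b - f a) \<le> L * (b powr \<alpha> - a powr \<alpha>)"
  shows "absolutely_continuous_on 0 T f"
  unfolding absolutely_continuous_on_def
proof (intro allI impI)
  fix \<epsilon> :: real assume \<epsilon>: "0 < \<epsilon>"
  define \<eta> where "\<eta> = (\<epsilon> / (2 * (L + 1))) powr (1 / \<alpha>)"
  have \<eta>: "\<eta> > 0" "\<eta> powr \<alpha> = \<epsilon> / (2 * (L + 1))"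
    using \<epsilon> \<alpha> L by (simp_all add: \<eta>_def powr_powr)
  define Q where "Q = \<alpha> * \<eta> powr (\<alpha> - 1)"
  have Q: "Q > 0" using \<alpha> \<eta> by (simp add: Q_def)
  define \<delta> where "\<delta> = \<epsilon> / (2 * (L * Q + 1))"
  have \<delta>: "\<delta> > 0" using \<epsilon> L Q by (simp add: \<delta>_def add_nonneg_pos)
  show "\<exists>\<delta>>0. \<forall>(n::nat) a b.
        (\<forall>i<n. 0 \<le> a i \<and> a i \<le> b i \<and> b i \<le> T) \<longrightarrow>
        (\<forall>i<n. \<forall>j<n. i \<noteq> j \<longrightarrow> {a i<..<b i} \<inter> {a j<..<b j} = {}) \<longrightarrow>
        (\<Sum>i<n. b i - a i) < \<delta> \<longrightarrow> (\<Sum>i<n. cmod (f (b i) - f (a i))) < \<epsilon>"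
  proof (intro exI[of _ \<delta>] conjI allI impI \<delta>)
    fix n :: nat and a b :: "nat \<Rightarrow> real"
    assume ab: "\<forall>i<n. 0 \<le> a i \<and> a i \<le> b i \<and> b i \<le> T"
      and disj: "\<forall>i<n. \<forall>j<n. i \<noteq> j \<longrightarrow> {a i<..<b i} \<inter> {a j<..<b j} = {}"
      and small: "(\<Sum>i<n. b i - a i) < \<delta>"
    define m where "m s = (min s \<eta>) powr \<alpha>" for s
    have m_mono: "m s \<le> m r" if "0 \<le> s" "s \<le> r" for s r
      unfolding m_def using that \<alpha> \<eta> by (intro powr_mono2) auto
    have step: "b i powr \<alpha> - a i powr \<alpha> \<le> (m (b i) - m (a i)) + Q * (b i - a i)" if i: "i < n" for i
    proof -
      have "(max (b i) \<eta>) powr \<alpha> - (max (a i) \<eta>) powr \<alpha> \<le> Q * (max (b i) \<eta> - max (a i) \<eta>)"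
        unfolding Q_def using ab i \<alpha> \<eta> by (intro powr_diff_le) auto
      also have "\<dots> \<le> Q * (b i - a i)"
        using Q ab i by (intro mult_left_mono) auto
      finally show ?thesis by (auto simp: m_def min_def max_def split: if_splits)
    qed
    have "(\<Sum>i<n. m (b i) - m (a i)) \<le> \<eta> powr \<alpha>"
    proof (rule sum_disjoint_intervals_le)
      show "0 \<le> m (a i) \<and> m (a i) \<le> m (b i) \<and> m (b i) \<le> \<eta> powr \<alpha>" if "i < n" for i
        using ab that m_mono[of "a i" "b i"] \<alpha> \<eta>(1) by (auto simp: m_def intro!: powr_mono2)
      \<comment> \<open>A monotone function carries disjoint intervals to disjoint
        intervals.\<close>
      show "{m (a i)<..<m (b i)} \<inter> {m (a j)<..<m (b j)} = {}" if ij: "i < n" "j < n" "i \<noteq> j" for i j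
      proof -
        have "min (b i) (b j) \<le> max (a i) (a j)"
          using disj ij by simp
        then have "m (min (b i) (b j)) \<le> m (max (a i) (a j))"
          using ab ij by (intro m_mono) (auto simp: min_def intro: order_trans)
        then show ?thesis by (auto simp: min_def max_def split: if_splits)
      qed
    qed simp
    moreover have "(\<Sum>i<n. b i powr \<alpha> - a i powr \<alpha>) \<le> (\<Sum>i<n. (m (b i) - m (a i)) + Q * (b i - a i))"
      by (rule sum_mono) (use step in auto)
    moreover have "\<dots> = (\<Sum>i<n. m (b i) - m (a i)) + Q * (\<Sum>i<n. b i - a i)"
      by (simp only: sum.distrib sum_distrib_left)
    ultimately have "(\<Sum>i<n. b i powr \<alpha> - a i powr \<alpha>) \<le> \<eta> powr \<alpha> + Q * (\<Sum>i<n. b i - a i)"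
      by linarith
    also have "\<dots> \<le> \<eta> powr \<alpha> + Q * \<delta>" using small Q by simp
    finally have "L * (\<Sum>i<n. b i powr \<alpha> - a i powr \<alpha>) \<le> L * (\<eta> powr \<alpha> + Q * \<delta>)"
      using L by (rule mult_left_mono)
    moreover have "(\<Sum>i<n. cmod (f (b i) - f (a i))) \<le> L * (\<Sum>i<n. b i powr \<alpha> - a i powr \<alpha>)"
      unfolding sum_distrib_left using ab by (intro sum_mono f) auto
    moreover have "L * \<eta> powr \<alpha> < \<epsilon> / 2" "L * (Q * \<delta>) < \<epsilon> / 2"
    proof -
      show "L * \<eta> powr \<alpha> < \<epsilon> / 2" using L \<epsilon> by (simp add: \<eta> field_simps)
      have "L * Q + 1 > 0" using L Q by (simp add: add_nonneg_pos)
      then show "L * (Q * \<delta>) < \<epsilon> / 2" using \<epsilon> by (simp add: \<delta>_def field_simps)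
    qed
    ultimately show "(\<Sum>i<n. cmod (f (b i) - f (a i))) < \<epsilon>"
      by (simp add: distrib_left)
  qed
qed

text \<open>A function with bounded derivative on a disc is composed with
  \<open>t powr \<alpha>\<close>.\<close>

lemma absolutely_continuous_on_relaxation:
  assumes \<alpha>: "0 < \<alpha>" "\<alpha> < 1"
  shows "absolutely_continuous_on 0 T (relaxation \<alpha> \<mu>)"
proof -
  define R where "R = cmod \<mu> * T powr \<alpha>"
  obtain B where B: "\<forall>z\<in>cball 0 R. cmod (mittag_leffler' \<alpha> z) \<le> B"
    using mittag_leffler'_bounded[OF \<alpha>(1), of R] by (auto simp: bounded_iff)
  show ?thesis
  proof (rule absolutely_continuous_on_of_powr_bound[OF \<alpha>, of "\<bar>B\<bar> * cmod \<mu>"])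
    fix a b :: real assume ab: "0 \<le> a" "a \<le> b" "b \<le> T"
    have mono: "a powr \<alpha> \<le> b powr \<alpha>" "b powr \<alpha> \<le> T powr \<alpha>"
      using ab \<alpha> by (auto intro: powr_mono2)
    have "cmod (relaxation \<alpha> \<mu> b - relaxation \<alpha> \<mu> a)
      \<le> \<bar>B\<bar> * cmod (\<mu> * of_real (b powr \<alpha>) - \<mu> * of_real (a powr \<alpha>))"
      unfolding relaxation_def
    proof (rule field_differentiable_bound[of "cball 0 R"])
      show "(mittag_leffler \<alpha> has_field_derivative mittag_leffler' \<alpha> z) (at z within cball 0 R)" for z
        by (rule mittag_leffler_has_derivative[OF \<alpha>(1)])
      show "cmod (mittag_leffler' \<alpha> z) \<le> \<bar>B\<bar>" if "z \<in> cball 0 R" for z using bspec[OF B that] by simp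
    qed (use mono in \<open>auto simp: R_def norm_mult intro!: mult_left_mono\<close>)
    also have "\<mu> * of_real (b powr \<alpha>) - \<mu> * of_real (a powr \<alpha>) = \<mu> * of_real (b powr \<alpha> - a powr \<alpha>)"
      by (simp add: algebra_simps)
    also have "\<bar>B\<bar> * cmod (\<mu> * of_real (b powr \<alpha> - a powr \<alpha>)) = \<bar>B\<bar> * cmod \<mu> * (b powr \<alpha> - a powr \<alpha>)"
      using mono by (simp add: norm_mult del: of_real_diff)
    finally show "cmod (relaxation \<alpha> \<mu> b - relaxation \<alpha> \<mu> a) \<le> \<bar>B\<bar> * cmod \<mu> * (b powr \<alpha> - a powr \<alpha>)" .
  qed simp
qed

section \<open>Laplace transforms\<close>

lemma has_bochner_integral_Laplace_powr:
  fixes x p :: real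
  assumes x: "0 \<le> x" and p: "0 < p"
  shows "has_bochner_integral lborel (\<lambda>t. indicator {0<..} t * (t powr x * exp (- (p * t)))) (Gamma (x + 1) / p powr (x + 1))"
proof -
  let ?f = "\<lambda>t. indicat_real {0<..} t * (t powr x * exp (- t))"
  have eq: "indicat_real {0..} t * t powr (x + 1 - 1) / exp t = ?f t" for t
    by (auto simp: indicator_def exp_minus field_simps)
  have "(\<integral>\<^sup>+ t. ennreal (?f t) \<partial>lborel) = ennreal (Gamma (x + 1))"
    using Gamma_conv_nn_integral_real[of "x + 1"] x unfolding eq by simp
  then have "has_bochner_integral lborel ?f (Gamma (x + 1))"
    using x by (intro has_bochner_integral_nn_integral) (auto intro!: Gamma_real_nonneg)
  then have "has_bochner_integral lborel (\<lambda>t. ?f (0 + p * t)) (Gamma (x + 1) /\<^sub>R \<bar>p\<bar>)"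
    using p lborel_has_bochner_integral_real_affine_iff[of p ?f "Gamma (x + 1)" 0] by simp
  from has_bochner_integral_mult_right[OF this, of "1 / p powr x"]
  have "has_bochner_integral lborel (\<lambda>t. 1 / p powr x * ?f (0 + p * t)) (1 / p powr x * (Gamma (x + 1) /\<^sub>R \<bar>p\<bar>))" .
  moreover have "1 / p powr x * ?f (0 + p * t) = indicator {0<..} t * (t powr x * exp (- (p * t)))" for t
    using p by (auto simp: indicator_def powr_mult zero_less_mult_iff)
  moreover have "1 / p powr x * (Gamma (x + 1) /\<^sub>R \<bar>p\<bar>) = Gamma (x + 1) / p powr (x + 1)"
    using p by (simp add: powr_add divide_simps)
  ultimately show ?thesis by simp
qed

lemma has_bochner_integral_exp_neg:
  fixes p :: real
  assumes p: "0 < p"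
  shows "has_bochner_integral lborel (\<lambda>t. indicator {0<..} t * exp (- (p * t))) (1 / p)"
proof -
  have "indicat_real {0<..} t * (t powr 0 * exp (- (p * t))) = indicator {0<..} t * exp (- (p * t))" for t
    by (auto simp: indicator_def)
  moreover have "Gamma (0 + 1) / p powr (0 + 1) = 1 / p" using p by simp
  ultimately show ?thesis
    using has_bochner_integral_Laplace_powr[OF order_refl p] by (simp only:)
qed

text \<open>Lerch's theorem by Weierstrass approximation. In the variable
  \<open>x = exp (- t)\<close> the hypothesis at \<open>p = M + i\<close> says that the weighted
  function \<open>E\<close> is orthogonal to every power of \<open>x\<close>, hence to every
  polynomial. As \<open>E\<close> is itself a continuous function \<open>\<psi>\<close> of
  \<open>x\<close>, polynomials approximate it and the integral of its square vanishes.\<close>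

lemma Laplace_transform_zero_real:
  fixes h :: "real \<Rightarrow> real"
  assumes h: "continuous_on {0..} h"
    and bound: "\<And>t. 0 \<le> t \<Longrightarrow> \<bar>h t\<bar> \<le> B * exp (a * t)"
    and zero: "\<And>p. p > a' \<Longrightarrow> (LINT t|lborel. indicator {0<..} t * (exp (- (p * t)) * h t)) = 0"
    and t0: "0 < t0"
  shows "h t0 = 0"
proof -
  \<comment> \<open>\<open>M \<ge> a + 1\<close> makes \<open>E\<close> decay like
    \<open>exp (- t)\<close> and \<open>\<psi>\<close> tend to 0 at 0; \<open>M > a'\<close> lets
    \<open>zero\<close> apply at every \<open>M + i\<close>; an integer \<open>M\<close> turns the
    weight into the monomial \<open>x ^ m\<close>.\<close>
  obtain m :: nat where "max a a' + 1 \<le> real m" using real_arch_simple by blast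
  define M where "M = real m"
  with \<open>max a a' + 1 \<le> real m\<close> have m: "a + 1 \<le> M" "a' < M" by auto
  define E where "E t = indicat_real {0<..} t * (exp (- (M * t)) * h t)" for t :: real
  have B0: "B \<ge> 0"
    using bound[of 1] by (smt (verit) abs_ge_zero exp_gt_zero zero_le_mult_iff)
  have Eb: "\<bar>E t\<bar> \<le> B * (indicat_real {0<..} t * exp (- (1 * t)))" for t
  proof (cases "0 < t")
    case True
    have "\<bar>E t\<bar> \<le> exp (- (M * t)) * (B * exp (a * t))"
      using True bound[of t] by (simp add: E_def abs_mult)
    also have "\<dots> = B * exp ((a - M) * t)"
      by (simp add: exp_diff exp_minus left_diff_distrib divide_inverse)
    also have "\<dots> \<le> B * exp (- (1 * t))"
      using mult_right_mono[OF m(1), of t] True B0 by (intro mult_left_mono) (auto simp: algebra_simps)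
    finally show ?thesis using True by simp
  qed (simp add: E_def)
  have hm: "(\<lambda>t. indicator {0<..} t *\<^sub>R h t) \<in> borel_measurable borel"
    by (rule borel_measurable_continuous_on_indicator) (auto intro: continuous_on_subset[OF h])
  have Em[measurable]: "E \<in> borel_measurable borel"
  proof -
    have "E = (\<lambda>t. exp (- (M * t)) * (indicator {0<..} t *\<^sub>R h t))"
      by (auto simp: E_def)
    also have "\<dots> \<in> borel_measurable borel"
      by (intro borel_measurable_times hm) simp
    finally show ?thesis .
  qed
  have Ei: "integrable lborel E"
  proof (rule Bochner_Integration.integrable_bound)
    show "integrable lborel (\<lambda>t. B * (indicat_real {0<..} t * exp (- (1 * t))))"
      using has_bochner_integral_exp_neg[of 1] by (intro integrable_mult_right) (simp add: has_bochner_integral_iff)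
    show "AE t in lborel. norm (E t) \<le> norm (B * (indicat_real {0<..} t * exp (- (1 * t))))"
      using Eb by (intro AE_I2) (smt (verit) real_norm_def)
  qed simp
  \<comment> \<open>For \<open>t \<le> 0\<close>, where \<open>E\<close> vanishes, the value 1 keeps
    \<open>e\<close> inside \<open>{0..1}\<close>, the interval of approximation.\<close>
  define e where "e t = (if 0 < t then exp (- t) else 1 :: real)" for t
  have em[measurable]: "e \<in> borel_measurable borel" unfolding e_def by measurable
  have e01: "e t \<in> {0..1}" for t by (simp add: e_def)
  have bi: "integrable lborel (\<lambda>t. E t * g (e t))"
    if g: "g \<in> borel_measurable borel" and gb: "\<And>x. x \<in> {0..1} \<Longrightarrow> \<bar>g x\<bar> \<le> C" for g :: "real \<Rightarrow> real" and C
  proof (rule Bochner_Integration.integrable_bound[OF integrable_mult_right[OF Ei, of C]])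
    show "(\<lambda>t. E t * g (e t)) \<in> borel_measurable lborel" using g by measurable
    show "AE t in lborel. norm (E t * g (e t)) \<le> norm (C * E t)"
    proof (rule AE_I2)
      fix t
      have "\<bar>g (e t)\<bar> \<le> \<bar>C\<bar>" using gb[OF e01[of t]] by simp
      then have "\<bar>E t\<bar> * \<bar>g (e t)\<bar> \<le> \<bar>E t\<bar> * \<bar>C\<bar>"
        by (rule mult_left_mono) simp
      then show "norm (E t * g (e t)) \<le> norm (C * E t)"
        by (simp only: real_norm_def abs_mult mult.commute[of "\<bar>C\<bar>"])
    qed
  qed
  have mono: "(LINT t|lborel. E t * e t ^ i) = 0" for i
  proof -
    have "E t * e t ^ i = indicator {0<..} t * (exp (- ((M + real i) * t)) * h t)" for t
      by (auto simp: E_def e_def indicator_def exp_add[symmetric] exp_of_nat_mult[symmetric] algebra_simps M_def)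
    then show ?thesis using zero[of "M + real i"] m by simp
  qed
  have poly: "(LINT t|lborel. E t * g (e t)) = 0" if gp: "real_polynomial_function g" for g
  proof -
    obtain c n where g: "g = (\<lambda>x. \<Sum>i\<le>n. c i * x ^ i)"
      using gp unfolding real_polynomial_function_iff_sum by blast
    have i: "integrable lborel (\<lambda>t. E t * (c i * e t ^ i))" for i :: nat
    proof (rule bi[of "\<lambda>x. c i * x ^ i" "\<bar>c i\<bar>"])
      show "\<bar>c i * x ^ i\<bar> \<le> \<bar>c i\<bar>" if "x \<in> {0..1}" for x
        using that power_le_one[of x i] by (simp add: abs_mult mult_left_le)
    qed simp
    have "(LINT t|lborel. E t * g (e t)) = (\<Sum>i\<le>n. LINT t|lborel. E t * (c i * e t ^ i))"
      unfolding g sum_distrib_left by (rule Bochner_Integration.integral_sum[OF i])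
    also have "\<dots> = (\<Sum>i\<le>n. c i * (LINT t|lborel. E t * e t ^ i))"
      unfolding integral_mult_right_zero[symmetric] by (simp add: mult_ac)
    finally show ?thesis by (simp add: mono)
  qed
  define \<psi> where "\<psi> x = (if x \<le> 0 then 0 else x ^ m * h (- ln x))" for x
  have \<psi>e: "E t * \<psi> (e t) = (E t)\<^sup>2" for t
    by (cases "0 < t") (auto simp: E_def e_def \<psi>_def power2_eq_square M_def exp_of_nat_mult[symmetric])
  have \<psi>b: "\<bar>\<psi> x\<bar> \<le> B * x" if "0 < x" "x < 1" for x
  proof -
    have "\<bar>\<psi> x\<bar> \<le> x ^ m * (B * exp (a * (- ln x)))"
      using that bound[of "- ln x"] by (simp add: \<psi>_def abs_mult mult_left_mono)
    also have "\<dots> = B * x powr (M - a)"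
    proof -
      have "x ^ m = exp (M * ln x)" using that by (simp add: M_def powr_def flip: powr_realpow)
      then show ?thesis using that by (simp add: powr_def left_diff_distrib exp_diff exp_minus divide_inverse)
    qed
    also have "x powr (M - a) \<le> x powr 1"
      using that m by (intro powr_mono') auto
    finally show ?thesis using B0 that by (simp add: mult_left_mono)
  qed
  have \<psi>c: "continuous_on {0..1} \<psi>"
    unfolding continuous_on_eq_continuous_within
  proof
    fix x :: real assume x: "x \<in> {0..1}"
    show "continuous (at x within {0..1}) \<psi>"
    proof (cases "x = 0")
      case True
      have "\<forall>\<^sub>F y in at 0 within {0..1}. norm (\<psi> y) \<le> B * y"
        using \<psi>b by (auto simp: eventually_at intro!: exI[of _ 1])
      moreover have "((\<lambda>y. B * y) \<longlongrightarrow> 0) (at 0 within {0..1})"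
        by (auto intro!: tendsto_eq_intros)
      ultimately have "(\<psi> \<longlongrightarrow> 0) (at 0 within {0..1})"
        by (rule Lim_null_comparison)
      then show ?thesis using True by (simp add: continuous_within \<psi>_def)
    next
      case False
      have "continuous_on {0<..1} (\<lambda>x. x ^ m * h (- ln x))"
        by (intro continuous_intros continuous_on_compose2[OF h]) auto
      then have "continuous (at x within {0<..1}) (\<lambda>x. x ^ m * h (- ln x))"
        using x False by (auto simp: continuous_on_eq_continuous_within)
      moreover have "at x within {0<..1} = at x within {0..1}"
        using x False by (intro at_within_nhd[of _ "{0<..}"]) auto
      ultimately have "((\<lambda>x. x ^ m * h (- ln x)) \<longlongrightarrow> x ^ m * h (- ln x)) (at x within {0..1})"
        by (simp add: continuous_within)
      moreover have "\<forall>\<^sub>F y in at x within {0..1}. y ^ m * h (- ln y) = \<psi> y"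
        using x False eventually_at_topological[of _ x "{0..1}"]
        by (auto simp: \<psi>_def intro!: exI[of _ "{0<..}"])
      ultimately have "(\<psi> \<longlongrightarrow> x ^ m * h (- ln x)) (at x within {0..1})"
        by (rule Lim_transform_eventually)
      then show ?thesis using x False by (simp add: continuous_within \<psi>_def)
    qed
  qed
  have EB: "\<bar>E t\<bar> \<le> B" for t
    using Eb[of t] mult_left_mono[of "exp (- t)" 1 B] B0 by (cases "0 < t") auto
  have E2: "integrable lborel (\<lambda>t. (E t)\<^sup>2)"
  proof (rule Bochner_Integration.integrable_bound[OF integrable_mult_right[OF Ei, of B]])
    show "AE t in lborel. norm ((E t)\<^sup>2) \<le> norm (B * E t)"
    proof (rule AE_I2)
      fix t
      have "\<bar>E t\<bar> * \<bar>E t\<bar> \<le> B * \<bar>E t\<bar>"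
        by (rule mult_right_mono[OF EB]) simp
      then show "norm ((E t)\<^sup>2) \<le> norm (B * E t)"
        using B0 by (simp add: power2_eq_square abs_mult)
    qed
  qed simp
  have small: "(LINT t|lborel. (E t)\<^sup>2) \<le> \<epsilon> * (LINT t|lborel. \<bar>E t\<bar>)" if \<epsilon>: "0 < \<epsilon>" for \<epsilon>
  proof -
    obtain g where g: "real_polynomial_function g" "\<And>x. x \<in> {0..1} \<Longrightarrow> \<bar>\<psi> x - g x\<bar> < \<epsilon>"
      using Stone_Weierstrass_real_polynomial_function[OF compact_Icc \<psi>c \<epsilon>] by blast
    have gm: "g \<in> borel_measurable borel"
      using continuous_on_polymonial_function[of g UNIV] g(1)
      by (intro borel_measurable_continuous_onI) (simp add: real_polynomial_function_eq)
    have "compact (g ` {0..1})"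
      using continuous_on_polymonial_function[of g "{0..1}"] g(1)
      by (intro compact_continuous_image) (simp_all add: real_polynomial_function_eq)
    then obtain C where C: "\<forall>x\<in>{0..1}. \<bar>g x\<bar> \<le> C"
      using compact_imp_bounded[of "g ` {0..1}"] by (auto simp: bounded_iff)
    have gi: "integrable lborel (\<lambda>t. E t * g (e t))"
      by (rule bi[OF gm]) (use C in blast)
    have "(LINT t|lborel. (E t)\<^sup>2) = (LINT t|lborel. (E t)\<^sup>2 - E t * g (e t))"
      using poly[OF g(1)] by (simp add: Bochner_Integration.integral_diff[OF E2 gi])
    also have "\<dots> \<le> (LINT t|lborel. \<epsilon> * \<bar>E t\<bar>)"
    proof (rule integral_mono)
      fix t
      have "(E t)\<^sup>2 - E t * g (e t) = E t * (\<psi> (e t) - g (e t))"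
        by (simp add: \<psi>e right_diff_distrib)
      also have "\<dots> \<le> \<bar>E t\<bar> * \<bar>\<psi> (e t) - g (e t)\<bar>"
        by (metis abs_ge_self abs_mult)
      also have "\<dots> \<le> \<bar>E t\<bar> * \<epsilon>"
        using g(2)[OF e01[of t]] by (intro mult_left_mono) auto
      finally show "(E t)\<^sup>2 - E t * g (e t) \<le> \<epsilon> * \<bar>E t\<bar>" by (simp add: mult.commute)
    qed (use E2 gi Ei in auto)
    finally show ?thesis by simp
  qed
  have "(LINT t|lborel. (E t)\<^sup>2) \<le> 0"
  proof (rule field_le_epsilon)
    fix d :: real assume d: "0 < d"
    let ?I = "LINT t|lborel. \<bar>E t\<bar>"
    have "?I \<ge> 0" by simp
    have "d / (I + 1) * I \<le> d" if "0 \<le> I" for I :: real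
      using d that by (simp add: divide_le_eq distrib_left)
    from this[OF \<open>?I \<ge> 0\<close>] have "d / (?I + 1) * ?I \<le> d" .
    moreover have "(LINT t|lborel. (E t)\<^sup>2) \<le> d / (?I + 1) * ?I"
      using small[of "d / (?I + 1)"] d \<open>?I \<ge> 0\<close> by simp
    ultimately show "(LINT t|lborel. (E t)\<^sup>2) \<le> 0 + d" by linarith
  qed
  moreover have "(LINT t|lborel. (E t)\<^sup>2) \<ge> 0" by simp
  ultimately have "(LINT t|lborel. (E t)\<^sup>2) = 0" by linarith
  then have "AE t in lborel. (E t)\<^sup>2 = 0"
    using integral_nonneg_eq_0_iff_AE[OF E2] by simp
  then have AE0: "AE t in lebesgue. E t = 0"
    using AE_completion by force
  show ?thesis
  proof (rule ccontr)
    assume nz: "h t0 \<noteq> 0"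
    obtain d where d: "d > 0" "\<And>t. t \<in> {0..} \<Longrightarrow> dist t t0 < d \<Longrightarrow> dist (h t) (h t0) < \<bar>h t0\<bar>"
      using h nz t0 unfolding continuous_on_iff
      by (metis atLeast_iff less_imp_le zero_less_abs_iff)
    have "AE t in lebesgue. t \<in> {t0<..<t0 + d} \<longrightarrow> E t = 0"
      using AE0 by eventually_elim simp
    then obtain t where t: "t \<in> {t0<..<t0 + d}" "E t = 0"
      by (rule AE_interval_obtains) (use d in simp)
    then have "h t = 0" using t0 by (simp add: E_def)
    moreover have "dist (h t) (h t0) < \<bar>h t0\<bar>"
      using t t0 by (intro d) (auto simp: dist_real_def)
    ultimately show False by (simp add: dist_real_def)
  qed
qed

lemma Laplace_transform_zero:
  fixes h :: "real \<Rightarrow> complex"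
  assumes h: "continuous_on {0..} h"
    and bound: "\<And>t. 0 \<le> t \<Longrightarrow> cmod (h t) \<le> B * exp (a * t)"
    and zero: "\<And>p. p > a' \<Longrightarrow> has_bochner_integral lborel (\<lambda>t. indicat_real {0<..} t *\<^sub>R (exp (- (p * t)) *\<^sub>R h t)) 0"
    and t0: "0 < t0"
  shows "h t0 = 0"
proof -
  have "Re (h t0) = 0"
  proof (rule Laplace_transform_zero_real[OF _ _ _ t0])
    show "continuous_on {0..} (\<lambda>t. Re (h t))" by (intro continuous_intros h)
    show "\<bar>Re (h t)\<bar> \<le> B * exp (a * t)" if "0 \<le> t" for t
      using bound[OF that] abs_Re_le_cmod order_trans by blast
    show "(LINT t|lborel. indicator {0<..} t * (exp (- (p * t)) * Re (h t))) = 0" if "p > a'" for p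
      using has_bochner_integral_integral_eq[OF has_bochner_integral_bounded_linear[OF bounded_linear_Re zero[OF that]]]
      by (simp add: mult.assoc)
  qed
  moreover have "Im (h t0) = 0"
  proof (rule Laplace_transform_zero_real[OF _ _ _ t0])
    show "continuous_on {0..} (\<lambda>t. Im (h t))" by (intro continuous_intros h)
    show "\<bar>Im (h t)\<bar> \<le> B * exp (a * t)" if "0 \<le> t" for t
      using bound[OF that] abs_Im_le_cmod order_trans by blast
    show "(LINT t|lborel. indicator {0<..} t * (exp (- (p * t)) * Im (h t))) = 0" if "p > a'" for p
      using has_bochner_integral_integral_eq[OF has_bochner_integral_bounded_linear[OF bounded_linear_Im zero[OF that]]]
      by (simp add: mult.assoc)
  qed
  ultimately show ?thesis by (simp add: complex_eq_iff)
qed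

section \<open>A contour integral for the relaxation function\<close>

text \<open>Multiplication by \<open>- \<i>\<close> carries the vertical segment with real part
  \<open>- c\<close> onto this one, which reduces the claim to the vertical case.\<close>

lemma contour_integral_linepath_same_Im:
  assumes "a < b"
  shows "contour_integral (linepath (Complex a c) (Complex b c)) f = integral {a..b} (\<lambda>x. f (Complex x c))"
proof -
  let ?g = "\<lambda>w. f (- \<i> * w)"
  have "contour_integral (linepath (Complex a c) (Complex b c)) f
      = (Complex b c - Complex a c) * integral {0..1} (\<lambda>x. f (linepath (Complex a c) (Complex b c) x))"
    by (simp add: contour_integral_integral)
  also have "(\<lambda>x. f (linepath (Complex a c) (Complex b c) x)) = (\<lambda>x. ?g (linepath (Complex (-c) a) (Complex (-c) b) x))"
    by (auto simp: linepath_def complex_eq_iff intro!: arg_cong[of _ _ f])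
  also have "(Complex b c - Complex a c) * integral {0..1} \<dots>
      = - \<i> * ((Complex (-c) b - Complex (-c) a) * integral {0..1} (\<lambda>x. ?g (linepath (Complex (-c) a) (Complex (-c) b) x)))"
    unfolding mult.assoc[symmetric] by (rule arg_cong2[of _ _ _ _ "(*)"]) (simp_all add: complex_eq_iff)
  also have "\<dots> = - \<i> * contour_integral (linepath (Complex (-c) a) (Complex (-c) b)) ?g"
    by (simp add: contour_integral_integral)
  also have "\<dots> = - \<i> * (\<i> * integral {a..b} (\<lambda>x. ?g (Complex (-c) x)))"
    using assms by (subst contour_integral_linepath_same_Re[of _ "-c" _ a b]) simp_all
  also have "(\<lambda>x. ?g (Complex (-c) x)) = (\<lambda>x. f (Complex x c))"
    by (auto simp: complex_eq_iff intro!: arg_cong[of _ _ f])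
  finally show ?thesis by simp
qed

lemma exp_eq_imp_strip:
  assumes "exp z = exp w" "\<bar>Im z - Im w\<bar> < 2 * pi"
  shows "z = w"
proof -
  obtain n :: int where n: "z = w + of_int (2 * n) * pi * \<i>"
    using assms(1) unfolding exp_eq by auto
  then have "\<bar>of_int n\<bar> * (2 * pi) < 1 * (2 * pi)"
    using assms(2) by (simp add: abs_mult)
  then have "\<bar>real_of_int n\<bar> < 1" using pi_gt_zero by (subst (asm) mult_less_cancel_right) simp
  then have "n = 0" by linarith
  with n show ?thesis by simp
qed

section \<open>The transform in logarithmic coordinates and its poles\<close>

locale relaxation_contour =
  fixes \<alpha> :: real
  assumes \<alpha>: "0 < \<alpha>" "\<alpha> < 1" "\<alpha> \<noteq> 1/2"
begin

definition \<theta> :: real where "\<theta> = pi / (2 * \<alpha>)"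
definition p0 :: complex where "p0 = exp (- \<i> * of_real \<theta>)"
text \<open>With \<open>p = exp w\<close> this is
  \<open>p powr \<alpha> / (p powr \<alpha> + \<i>)\<close>: for real \<open>p > 1\<close>,
  \<open>H (ln p) / p\<close> is the Laplace transform of the relaxation function with
  \<open>\<mu> = - \<i>\<close>.\<close>

definition H :: "complex \<Rightarrow> complex" where "H w = exp (of_real \<alpha> * w) / (exp (of_real \<alpha> * w) + \<i>)"
text \<open>An open neighbourhood of the closed strip \<open>\<bar>Im w\<bar> \<le> pi\<close>. Up
  to \<open>3 * pi / 2\<close> the denominator of \<open>H\<close> can vanish only at
  \<open>- \<i> * \<theta>\<close>; for \<open>\<alpha> < 1/2\<close> the bound
  \<open>\<theta> > pi\<close> excludes that point.\<close>

definition strip :: "complex set" where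
  "strip = {w. \<bar>Im w\<bar> < (if \<alpha> < 1/2 then min (3 * pi / 2) \<theta> else 3 * pi / 2)}"

text \<open>The strength of the pole of \<^term>\<open>H\<close>, which for \<open>\<alpha> < 1/2\<close> lies outside of the strip
  \<open>\<bar>Im w\<bar> \<le> pi\<close>, that is, on another sheet of the logarithm.\<close>

definition pole :: real where "pole = (if \<alpha> < 1/2 then 0 else 1 / \<alpha>)"

lemma \<alpha>\<theta>: "\<alpha> * \<theta> = pi / 2" using \<alpha> by (simp add: \<theta>_def)

lemma \<theta>_pos: "0 < \<theta>" using \<alpha> by (simp add: \<theta>_def)

lemma \<theta>_gt: "\<alpha> < 1/2 \<Longrightarrow> pi < \<theta>" and \<theta>_less: "1/2 < \<alpha> \<Longrightarrow> \<theta> < pi" and \<theta>_gt2: "pi / 2 < \<theta>"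
  using \<alpha> by (simp_all add: \<theta>_def field_simps)

lemma exp_w0: "exp (of_real \<alpha> * (- \<i> * of_real \<theta>)) = - \<i>"
proof -
  have "complex_of_real \<alpha> * (- \<i> * of_real \<theta>) = \<i> * of_real (- (\<alpha> * \<theta>))" by simp
  also have "exp \<dots> = cis (- (pi / 2))" unfolding \<alpha>\<theta> by (simp add: cis_conv_exp)
  finally show ?thesis by (simp add: complex_eq_iff)
qed

text \<open>As \<open>\<alpha> * \<theta> = pi / 2\<close>, the two exponents differ in imaginary
  part by less than \<open>3 * pi / 2 + pi / 2 = 2 * pi\<close>, a range in which \<open>exp\<close>
  is injective.\<close>

lemma denom_zero_iff:
  assumes "\<bar>Im w\<bar> < 3 * pi / 2"
  shows "exp (of_real \<alpha> * w) + \<i> = 0 \<longleftrightarrow> w = - \<i> * of_real \<theta>"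
proof
  assume "exp (of_real \<alpha> * w) + \<i> = 0"
  then have "exp (of_real \<alpha> * w) = exp (of_real \<alpha> * (- \<i> * of_real \<theta>))"
    unfolding exp_w0 by (simp add: eq_neg_iff_add_eq_0)
  moreover have "\<bar>Im (of_real \<alpha> * w) - Im (of_real \<alpha> * (- \<i> * of_real \<theta>))\<bar> < 2 * pi"
  proof -
    have "\<bar>\<alpha> * Im w\<bar> < 3 * pi / 2"
      using assms \<alpha> by (simp add: abs_mult) (smt (verit) mult_left_le_one_le abs_ge_zero)
    moreover have "Im (of_real \<alpha> * (- \<i> * of_real \<theta>)) = - (pi / 2)" using \<alpha>\<theta> by simp
    ultimately show ?thesis by simp
  qed
  ultimately have "of_real \<alpha> * w = of_real \<alpha> * (- \<i> * of_real \<theta>)" by (rule exp_eq_imp_strip)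
  then show "w = - \<i> * of_real \<theta>"
    by (subst (asm) mult_left_cancel) (use \<alpha> in simp_all)
next
  assume "w = - \<i> * of_real \<theta>"
  then show "exp (of_real \<alpha> * w) + \<i> = 0" using exp_w0 by simp
qed

lemma exp_eq_real_iff:
  assumes "\<bar>Im w\<bar> < 2 * pi" "0 < p"
  shows "exp w = of_real p \<longleftrightarrow> w = of_real (ln p)"
proof
  assume "exp w = of_real p"
  then have "exp w = exp (of_real (ln p))" using assms(2) by (simp add: exp_of_real)
  then show "w = of_real (ln p)" by (rule exp_eq_imp_strip) (use assms(1) in simp)
qed (use assms in \<open>simp add: exp_of_real\<close>)

lemma open_strip: "open strip" and convex_strip: "convex strip"
proof -
  define b where "b = (if \<alpha> < 1/2 then min (3 * pi / 2) \<theta> else 3 * pi / 2)"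
  have strip: "strip = {w. Im w < b} \<inter> {w. Im w > - b}"
    unfolding strip_def b_def by (auto simp only: abs_less_iff)
  show "open strip"
    unfolding strip by (intro open_Int open_halfspace_Im_lt open_halfspace_Im_gt)
  show "convex strip"
    unfolding strip by (intro convex_Int convex_halfspace_Im_lt convex_halfspace_Im_gt)
qed

lemma strip_bound: "w \<in> strip \<Longrightarrow> \<bar>Im w\<bar> < 3 * pi / 2"
  by (auto simp: strip_def split: if_splits)

lemma in_strip: "\<bar>Im w\<bar> \<le> pi \<Longrightarrow> w \<in> strip"
proof -
  assume w: "\<bar>Im w\<bar> \<le> pi"
  then have "\<bar>Im w\<bar> < 3 * pi / 2" using pi_gt_zero by linarith
  moreover have "\<alpha> < 1/2 \<Longrightarrow> \<bar>Im w\<bar> < \<theta>" using \<theta>_gt w by linarith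
  ultimately show "w \<in> strip" by (simp add: strip_def)
qed

text \<open>The integrand that produces the Stieltjes transform: on the sides
  \<open>Im w = pi\<close> and \<open>Im w = - pi\<close> its denominator is
  \<open>- (exp x + p)\<close>, and its residue at \<open>ln p\<close> is the Laplace transform to
  be matched.\<close>

definition G :: "real \<Rightarrow> complex \<Rightarrow> complex" where "G p w = H w / (exp w - of_real p)"

definition poles :: "real \<Rightarrow> complex set" where
  "poles p = insert (of_real (ln p)) (if \<alpha> < 1/2 then {} else {- \<i> * of_real \<theta>})"

lemma H_denom_nz: "w \<in> strip - poles p \<Longrightarrow> exp (of_real \<alpha> * w) + \<i> \<noteq> 0"
  using denom_zero_iff[OF strip_bound, of w] \<theta>_pos
  by (auto simp: poles_def strip_def split: if_splits)

lemma G_denom_nz: "0 < p \<Longrightarrow> w \<in> strip - poles p \<Longrightarrow> exp w - of_real p \<noteq> 0"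
  using exp_eq_real_iff[of w p] strip_bound[of w] pi_gt_zero
  by (auto simp: poles_def)

lemma G_holomorphic: "0 < p \<Longrightarrow> G p holomorphic_on (strip - poles p)"
  unfolding G_def H_def using H_denom_nz G_denom_nz
  by (intro holomorphic_intros) auto

lemma residue_G_ln:
  assumes p: "0 < p"
  shows "residue (G p) (of_real (ln p)) = H (of_real (ln p)) / of_real p"
  unfolding G_def
proof (rule residue_simple_pole_deriv)
  \<comment> \<open>A strip around the real axis that stays above the zero
    \<open>- \<i> * \<theta>\<close> of the denominator of \<open>H\<close>.\<close>
  let ?s = "{w. Im w > - min \<theta> pi} \<inter> {w. Im w < pi}"
  show "open ?s" by (intro open_Int open_halfspace_Im_gt open_halfspace_Im_lt)
  show "connected ?s" by (intro convex_connected convex_Int convex_halfspace_Im_gt convex_halfspace_Im_lt)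
  show "of_real (ln p) \<in> ?s" using \<theta>_pos by simp
  have "exp (of_real \<alpha> * w) + \<i> \<noteq> 0" if "w \<in> ?s" for w
  proof
    assume *: "exp (of_real \<alpha> * w) + \<i> = 0"
    have w: "Im w > - \<theta>" "Im w > - pi" "Im w < pi"
      using that by (auto simp: min_def split: if_splits)
    then have "\<bar>Im w\<bar> < 3 * pi / 2" using pi_gt_zero by (simp only: abs_less_iff) linarith
    then have "w = - \<i> * of_real \<theta>" using * denom_zero_iff by blast
    then show False using w by simp
  qed
  then show "H holomorphic_on ?s"
    unfolding H_def by (intro holomorphic_intros) auto
  show "(\<lambda>w. exp w - of_real p) holomorphic_on ?s" by (intro holomorphic_intros)
  show "((\<lambda>w. exp w - of_real p) has_field_derivative of_real p) (at (of_real (ln p)))"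
    using p by (auto intro!: derivative_eq_intros simp: exp_of_real)
  have "exp (complex_of_real \<alpha> * of_real (ln p)) + \<i> \<noteq> 0"
    using denom_zero_iff[of "of_real (ln p)"] \<theta>_pos by (auto simp: complex_eq_iff)
  then show "H (of_real (ln p)) \<noteq> 0" by (simp add: H_def)
  show "exp (complex_of_real (ln p)) - of_real p = 0" using p by (simp add: exp_of_real)
  show "complex_of_real p \<noteq> 0" using p by simp
qed

lemma residue_G_w0:
  assumes p: "0 < p" and a: "\<not> \<alpha> < 1/2"
  shows "residue (G p) (- \<i> * of_real \<theta>) = 1 / (of_real \<alpha> * (p0 - of_real p))"
proof -
  let ?w0 = "- \<i> * complex_of_real \<theta>"
  have Geq: "G p = (\<lambda>w. (exp (of_real \<alpha> * w) / (exp w - of_real p)) / (exp (of_real \<alpha> * w) + \<i>))"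
    by (auto simp: G_def H_def)
  have \<theta>pi: "\<theta> < pi" using a \<alpha> \<theta>_less by simp
  have "residue (G p) ?w0 = (exp (of_real \<alpha> * ?w0) / (exp ?w0 - of_real p)) / (of_real \<alpha> * exp (of_real \<alpha> * ?w0))"
    unfolding Geq
  proof (rule residue_simple_pole_deriv)
    \<comment> \<open>Strictly below the real axis and above \<open>- pi\<close> the factor
      \<open>exp w - p\<close> has no zero, and \<open>\<theta> < pi\<close> places
      \<open>?w0\<close> there.\<close>
    let ?s = "{w. Im w > - pi} \<inter> {w. Im w < 0}"
    show "open ?s" by (intro open_Int open_halfspace_Im_gt open_halfspace_Im_lt)
    show "connected ?s" by (intro convex_connected convex_Int convex_halfspace_Im_gt convex_halfspace_Im_lt)
    show "?w0 \<in> ?s" using \<theta>_pos \<theta>pi by simp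
    have nz: "exp w - of_real p \<noteq> 0" if "w \<in> ?s" for w
      using that exp_eq_real_iff[of w p] p by auto
    then show "(\<lambda>w. exp (of_real \<alpha> * w) / (exp w - of_real p)) holomorphic_on ?s"
      by (intro holomorphic_intros) auto
    show "(\<lambda>w. exp (of_real \<alpha> * w) + \<i>) holomorphic_on ?s" by (intro holomorphic_intros)
    show "((\<lambda>w. exp (of_real \<alpha> * w) + \<i>) has_field_derivative (of_real \<alpha> * exp (of_real \<alpha> * ?w0))) (at ?w0)"
      by (auto intro!: derivative_eq_intros)
    show "exp (of_real \<alpha> * ?w0) / (exp ?w0 - of_real p) \<noteq> 0" using nz[OF \<open>?w0 \<in> ?s\<close>] by simp
    show "exp (of_real \<alpha> * ?w0) + \<i> = 0" using exp_w0 by simp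
    show "of_real \<alpha> * exp (of_real \<alpha> * ?w0) \<noteq> 0" using \<alpha> by simp
  qed
  then show ?thesis by (simp add: p0_def mult.commute)
qed

text \<open>The rectangle encloses both poles for \<open>\<alpha> > 1/2\<close> and only
  \<open>ln p\<close> for \<open>\<alpha> < 1/2\<close>; the constant \<open>pole\<close> merges the
  two cases.\<close>

lemma contour_integral_G_rect:
  assumes p: "0 < p" and M: "\<bar>ln p\<bar> < M"
  shows "contour_integral (rectpath (Complex (-M) (-pi)) (Complex M pi)) (G p)
     = 2 * pi * \<i> * (H (of_real (ln p)) / of_real p - of_real pole / (of_real p - p0))"
proof -
  let ?g = "rectpath (Complex (-M) (-pi)) (Complex M pi)"
  have M0: "M > 0" using M by simp
  have inside: "w \<in> box (Complex (-M) (-pi)) (Complex M pi)" if "w \<in> poles p" for w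
    using that M M0 \<alpha> \<theta>_less \<theta>_pos by (auto simp: poles_def in_box_complex_iff split: if_splits)
  have sub: "path_image ?g \<subseteq> strip"
    using path_image_rectpath_subset_cbox[of "Complex (-M) (-pi)" "Complex M pi"] M0
    by (auto simp: in_cbox_complex_iff subset_iff intro!: in_strip)
  have "contour_integral ?g (G p) = 2 * pi * \<i> * (\<Sum>w\<in>poles p. winding_number ?g w * residue (G p) w)"
  proof (rule Residue_theorem[OF open_strip convex_connected[OF convex_strip]])
    show "finite (poles p)" by (simp add: poles_def)
    show "G p holomorphic_on strip - poles p" by (rule G_holomorphic[OF p])
    show "path_image ?g \<subseteq> strip - poles p"
      using sub inside path_image_rectpath_inter_box[of "Complex (-M) (-pi)" "Complex M pi"] M0 by auto
    show "\<forall>z. z \<notin> strip \<longrightarrow> winding_number ?g z = 0"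
      using M0 by (auto intro!: winding_number_rectpath_outside in_strip simp: in_cbox_complex_iff)
  qed auto
  also have "(\<Sum>w\<in>poles p. winding_number ?g w * residue (G p) w) = (\<Sum>w\<in>poles p. residue (G p) w)"
    using inside by (intro sum.cong) (auto simp: winding_number_rectpath)
  also have "\<dots> = H (of_real (ln p)) / of_real p - of_real pole / (of_real p - p0)"
  proof (cases "\<alpha> < 1/2")
    case True
    then show ?thesis by (simp add: poles_def pole_def residue_G_ln[OF p])
  next
    case False
    have ne: "complex_of_real (ln p) \<noteq> - \<i> * of_real \<theta>"
      using \<theta>_pos by (auto simp: complex_eq_iff)
    have "1 / (of_real \<alpha> * (p0 - of_real p)) = - (of_real (1 / \<alpha>) / (of_real p - p0))"
    proof -
      have "of_real \<alpha> * (p0 - of_real p) = - (of_real \<alpha> * (of_real p - p0))"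
        by (simp add: right_diff_distrib)
      then have "1 / (of_real \<alpha> * (p0 - of_real p)) = - (1 / (of_real \<alpha> * (of_real p - p0)))"
        by (simp only: minus_divide_right)
      then show ?thesis by simp
    qed
    then show ?thesis
      using False ne residue_G_ln[OF p] residue_G_w0[OF p False] by (simp add: poles_def pole_def)
  qed
  finally show ?thesis .
qed

lemma G_contour_integrable:
  assumes "0 < p" "path_image (linepath a b) \<subseteq> strip - poles p"
  shows "G p contour_integrable_on linepath a b"
proof (rule contour_integrable_continuous_linepath)
  show "continuous_on (closed_segment a b) (G p)"
    using holomorphic_on_imp_continuous_on[OF G_holomorphic[OF assms(1)]] assms(2)
    by (auto intro: continuous_on_subset)
qed

lemma segments_subset:
  assumes M: "\<bar>ln p\<bar> < M"
  shows "\<bar>Re w\<bar> = M \<and> \<bar>Im w\<bar> \<le> pi \<or> \<bar>Im w\<bar> = pi \<Longrightarrow> w \<in> strip - poles p"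
  using M \<theta>_less \<theta>_pos \<alpha> by (auto simp: poles_def intro!: in_strip split: if_splits)

text \<open>The horizontal sides are traversed in opposite directions, so they combine to the
  difference of the boundary values.\<close>

lemma contour_integral_rect_split:
  assumes p: "0 < p" and M: "\<bar>ln p\<bar> < M"
  shows "contour_integral (rectpath (Complex (-M) (-pi)) (Complex M pi)) (G p)
    = integral {-M..M} (\<lambda>x. G p (Complex x (-pi)) - G p (Complex x pi))
      + contour_integral (linepath (Complex M (-pi)) (Complex M pi)) (G p)
      - contour_integral (linepath (Complex (-M) (-pi)) (Complex (-M) pi)) (G p)"
proof -
  have M0: "M > 0" using M by simp
  have seg: "closed_segment (Complex a c) (Complex b c) \<subseteq> strip - poles p" if "\<bar>c\<bar> = pi" for a b c
    by (rule subsetI, rule segments_subset[OF M])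
       (use that in \<open>auto simp: closed_segment_same_Im\<close>)
  have seg2: "closed_segment (Complex c a) (Complex c b) \<subseteq> strip - poles p"
    if "\<bar>c\<bar> = M" "\<bar>a\<bar> \<le> pi" "\<bar>b\<bar> \<le> pi" for a b c
  proof (rule subsetI, rule segments_subset[OF M])
    fix w assume "w \<in> closed_segment (Complex c a) (Complex c b)"
    then have "Re w = c" "Im w \<in> closed_segment a b"
      by (auto simp: closed_segment_same_Re)
    moreover have "closed_segment a b \<subseteq> {-pi..pi}"
      using that by (auto simp: closed_segment_eq_real_ivl split: if_splits)
    ultimately have "Im w \<in> {-pi..pi}" by (auto dest: subsetD)
    then have "\<bar>Im w\<bar> \<le> pi" by (simp add: abs_le_iff)
    then show "\<bar>Re w\<bar> = M \<and> \<bar>Im w\<bar> \<le> pi \<or> \<bar>Im w\<bar> = pi" using \<open>Re w = c\<close> that by simp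
  qed
  have ci: "G p contour_integrable_on linepath (Complex a c) (Complex b c)" if "\<bar>c\<bar> = pi" for a b c
    using G_contour_integrable[OF p] seg[OF that] by simp
  have ci2: "G p contour_integrable_on linepath (Complex c a) (Complex c b)"
    if "\<bar>c\<bar> = M" "\<bar>a\<bar> \<le> pi" "\<bar>b\<bar> \<le> pi" for a b c
    using G_contour_integrable[OF p] seg2[OF that] by simp
  have cont: "continuous_on {-M..M} (\<lambda>x. G p (Complex x c))" if "\<bar>c\<bar> = pi" for c
  proof (rule continuous_on_compose2[OF holomorphic_on_imp_continuous_on[OF G_holomorphic[OF p]]])
    show "continuous_on {-M..M} (\<lambda>x. Complex x c)" unfolding Complex_eq by (intro continuous_intros)
    show "(\<lambda>x. Complex x c) ` {-M..M} \<subseteq> strip - poles p"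
      using segments_subset[OF M] that by auto
  qed
  have "contour_integral (rectpath (Complex (-M) (-pi)) (Complex M pi)) (G p)
    = contour_integral (linepath (Complex (-M) (-pi)) (Complex M (-pi))) (G p)
      + (contour_integral (linepath (Complex M (-pi)) (Complex M pi)) (G p)
      + (contour_integral (linepath (Complex M pi) (Complex (-M) pi)) (G p)
      + contour_integral (linepath (Complex (-M) pi) (Complex (-M) (-pi))) (G p)))"
    using M0 pi_ge_zero by (simp add: rectpath_def Let_def ci ci2)
  also have "contour_integral (linepath (Complex M pi) (Complex (-M) pi)) (G p)
      = - contour_integral (linepath (Complex (-M) pi) (Complex M pi)) (G p)"
    using seg[of pi M "-M"]
    by (subst contour_integral_reverse_linepath)
       (auto intro: continuous_on_subset[OF holomorphic_on_imp_continuous_on[OF G_holomorphic[OF p]]])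
  also have "contour_integral (linepath (Complex (-M) pi) (Complex (-M) (-pi))) (G p)
      = - contour_integral (linepath (Complex (-M) (-pi)) (Complex (-M) pi)) (G p)"
    using seg2[of "-M" pi "-pi"] M0
    by (subst contour_integral_reverse_linepath)
       (auto intro: continuous_on_subset[OF holomorphic_on_imp_continuous_on[OF G_holomorphic[OF p]]])
  also have "contour_integral (linepath (Complex (-M) (-pi)) (Complex M (-pi))) (G p)
      = integral {-M..M} (\<lambda>x. G p (Complex x (-pi)))"
    using M0 by (intro contour_integral_linepath_same_Im) simp
  also have "contour_integral (linepath (Complex (-M) pi) (Complex M pi)) (G p)
      = integral {-M..M} (\<lambda>x. G p (Complex x pi))"
    using M0 by (intro contour_integral_linepath_same_Im) simp
  finally show ?thesis
    using cont[of pi] cont[of "-pi"]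
    by (simp add: Henstock_Kurzweil_Integration.integral_diff integrable_continuous_real)
qed

end

lemma integrable_exp_neg_abs:
  fixes \<alpha> :: real assumes \<alpha>: "0 < \<alpha>"
  shows "integrable lborel (\<lambda>x. exp (- (\<alpha> * \<bar>x\<bar>)))"
proof -
  let ?f = "\<lambda>x. indicat_real {0<..} x * exp (- (\<alpha> * x))"
  have f: "integrable lborel ?f"
    using has_bochner_integral_exp_neg[OF \<alpha>] by (simp add: has_bochner_integral_iff)
  have "integrable lborel (\<lambda>x. ?f (0 + (-1) * x))"
    by (rule lborel_integrable_real_affine[OF f]) simp
  then have "integrable lborel (\<lambda>x. ?f x + ?f (0 + (-1) * x))"
    using f by (rule Bochner_Integration.integrable_add[rotated])
  then show ?thesis
  proof (rule integrable_cong_AE_imp)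
    show "AE x in lborel. ?f x + ?f (0 + (-1) * x) = exp (- (\<alpha> * \<bar>x\<bar>))"
      using AE_lborel_singleton[of 0] by eventually_elim (auto simp: indicator_def)
  qed simp
qed

section \<open>The kernel as a jump across the cut\<close>

context relaxation_contour
begin

definition s :: real where "s = sin (pi * \<alpha>)"
definition c :: real where "c = cos (pi * \<alpha>)"
definition X :: "real \<Rightarrow> real" where "X x = exp (\<alpha> * x)"
text \<open>The product of the denominators of \<open>H\<close> at the boundary points
  \<open>Complex x pi\<close> and \<open>Complex x (- pi)\<close>.\<close>

definition den :: "real \<Rightarrow> complex" where
  "den x = of_real ((X x)\<^sup>2 - 1) + 2 * \<i> * of_real (X x * c)"
text \<open>\<open>2 * pi * \<i> * kern x\<close> is the jump
  \<open>H (Complex x pi) - H (Complex x (- pi))\<close>.\<close>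

definition kern :: "real \<Rightarrow> complex" where
  "kern x = \<i> * of_real (s / pi * X x) / den x"

lemma s_pos: "0 < s"
  unfolding s_def using \<alpha> by (intro sin_gt_zero) auto

text \<open>For \<open>0 < \<alpha> < 1\<close> the cosine vanishes at \<open>\<alpha> = 1/2\<close>
  only; excluding that order keeps \<open>den\<close> away from 0.\<close>

lemma c_nz: "c \<noteq> 0"
proof
  assume "c = 0"
  then obtain n :: int where n: "odd n" "pi * \<alpha> = of_int n * (pi / 2)"
    unfolding c_def cos_zero_iff_int by auto
  then have "2 * \<alpha> = of_int n" by (simp add: field_simps)
  then have "0 < n" "n < 2" using \<alpha> by linarith+
  then have "n = 1" by simp
  with \<open>2 * \<alpha> = of_int n\<close> \<alpha> show False by simp
qed

lemma sc: "s\<^sup>2 + c\<^sup>2 = 1" by (simp add: s_def c_def)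

lemma X_pos: "0 < X x" by (simp add: X_def)

lemma norm_den: "(cmod (den x))\<^sup>2 = ((X x)\<^sup>2 - 1)\<^sup>2 + 4 * (X x)\<^sup>2 * c\<^sup>2"
  by (simp add: den_def cmod_power2 power_mult_distrib)

text \<open>This bound and \<open>den_le\<close> compare \<open>norm_den\<close> with
  \<open>(X\<^sup>2 + 1)\<^sup>2 = (X\<^sup>2 - 1)\<^sup>2 + 4 * X\<^sup>2\<close>, using
  \<open>c\<^sup>2 \<le> 1\<close>.\<close>

lemma den_ge: "\<bar>c\<bar> * ((X x)\<^sup>2 + 1) \<le> cmod (den x)"
proof (rule power2_le_imp_le)
  have "c\<^sup>2 \<le> 1" using sc zero_le_power2[of s] by linarith
  then have "c\<^sup>2 * ((X x)\<^sup>2 - 1)\<^sup>2 \<le> 1 * ((X x)\<^sup>2 - 1)\<^sup>2" by (intro mult_right_mono) auto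
  moreover have "(\<bar>c\<bar> * ((X x)\<^sup>2 + 1))\<^sup>2 = c\<^sup>2 * ((X x)\<^sup>2 - 1)\<^sup>2 + 4 * (X x)\<^sup>2 * c\<^sup>2"
    by (simp add: power_mult_distrib) (simp add: power2_eq_square algebra_simps)
  ultimately show "(\<bar>c\<bar> * ((X x)\<^sup>2 + 1))\<^sup>2 \<le> (cmod (den x))\<^sup>2"
    unfolding norm_den by simp
qed simp

lemma den_le: "cmod (den x) \<le> (X x)\<^sup>2 + 1"
proof (rule power2_le_imp_le)
  have "c\<^sup>2 \<le> 1" using sc zero_le_power2[of s] by linarith
  then have "4 * (X x)\<^sup>2 * c\<^sup>2 \<le> 4 * (X x)\<^sup>2 * 1" by (intro mult_left_mono) auto
  moreover have "((X x)\<^sup>2 + 1)\<^sup>2 = ((X x)\<^sup>2 - 1)\<^sup>2 + 4 * (X x)\<^sup>2 * 1"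
    by (simp add: power2_eq_square algebra_simps)
  ultimately show "(cmod (den x))\<^sup>2 \<le> ((X x)\<^sup>2 + 1)\<^sup>2"
    unfolding norm_den by linarith
qed simp

lemma den_nz: "den x \<noteq> 0"
proof -
  have "0 < \<bar>c\<bar> * ((X x)\<^sup>2 + 1)" using c_nz by (simp add: add_nonneg_pos)
  then show ?thesis using den_ge[of x] by auto
qed

definition K0 :: real where "K0 = s / (pi * \<bar>c\<bar>)"

lemma K0_pos: "0 < K0" using s_pos c_nz by (simp add: K0_def)

lemma kern_le: "cmod (kern x) \<le> K0 * (X x / ((X x)\<^sup>2 + 1))"
proof -
  have "cmod (kern x) = s / pi * X x / cmod (den x)"
    using s_pos X_pos[of x] by (simp add: kern_def norm_divide norm_mult)
  also have "\<dots> \<le> s / pi * X x / (\<bar>c\<bar> * ((X x)\<^sup>2 + 1))"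
    using s_pos X_pos[of x] den_ge[of x] den_nz[of x] c_nz
    by (intro divide_left_mono mult_pos_pos) (auto simp: add_nonneg_pos)
  finally show ?thesis by (simp add: K0_def)
qed

lemma kern_le_X: "cmod (kern x) \<le> K0 * X x"
proof -
  have "X x / ((X x)\<^sup>2 + 1) \<le> X x / 1"
    using X_pos[of x] by (intro divide_left_mono) (auto simp: add_nonneg_pos)
  then show ?thesis using kern_le[of x] K0_pos by (smt (verit) div_by_1 mult_left_mono)
qed

text \<open>\<open>X / (X\<^sup>2 + 1)\<close> is at most \<open>X\<close>, which is small on the
  left, and at most \<open>1 / X\<close>, which is small on the right.\<close>

lemma kern_le_exp: "cmod (kern x) \<le> K0 * exp (- (\<alpha> * \<bar>x\<bar>))"
proof (cases "0 \<le> x")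
  case True
  have "X x / ((X x)\<^sup>2 + 1) \<le> X x / (X x)\<^sup>2"
    using X_pos[of x] by (intro divide_left_mono) (auto simp: add_nonneg_pos)
  also have "\<dots> = exp (- (\<alpha> * x))"
    by (simp add: X_def power2_eq_square exp_minus field_simps)
  finally show ?thesis
    using kern_le[of x] K0_pos True by (smt (verit) abs_of_nonneg mult_left_mono)
next
  case False
  then show ?thesis using kern_le_X[of x] by (simp add: X_def)
qed

lemma continuous_on_kern: "continuous_on UNIV kern"
  unfolding kern_def [abs_def] using den_nz
  by (intro continuous_intros) (auto simp: den_def X_def intro!: continuous_intros)

lemma kern_measurable [measurable]: "kern \<in> borel_measurable borel"
  by (rule borel_measurable_continuous_onI[OF continuous_on_kern])

lemma kern_integrable: "integrable lborel kern"
proof (rule Bochner_Integration.integrable_bound)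
  show "integrable lborel (\<lambda>x. K0 * exp (- (\<alpha> * \<bar>x\<bar>)))"
    by (intro integrable_mult_right integrable_exp_neg_abs \<alpha>)
  show "AE x in lborel. norm (kern x) \<le> norm (K0 * exp (- (\<alpha> * \<bar>x\<bar>)))"
    using kern_le_exp K0_pos by (intro AE_I2) (simp add: abs_mult)
qed simp

lemma H_boundary:
  assumes "\<epsilon> = 1 \<or> \<epsilon> = -1"
  shows "H (Complex x (\<epsilon> * pi)) = of_real (X x) * Complex c (\<epsilon> * s) / (of_real (X x) * Complex c (\<epsilon> * s) + \<i>)"
proof -
  have "exp (of_real \<alpha> * Complex x (\<epsilon> * pi)) = of_real (X x) * cis (\<alpha> * (\<epsilon> * pi))"
    by (simp add: exp_eq_polar X_def)
  also have "cis (\<alpha> * (\<epsilon> * pi)) = Complex c (\<epsilon> * s)"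
    using assms by (auto simp: complex_eq_iff c_def s_def mult.commute)
  finally show ?thesis by (simp add: H_def)
qed

text \<open>On both sides \<open>exp w = - exp x\<close>, so the factor
  \<open>1 / (exp w - p)\<close> is common and only \<open>H\<close> jumps.\<close>

lemma G_jump:
  assumes p: "0 < p"
  shows "G p (Complex x (-pi)) - G p (Complex x pi) = 2 * pi * \<i> * (kern x / of_real (exp x + p))"
proof -
  have e: "exp (Complex x (\<epsilon> * pi)) = - of_real (exp x)" if "\<epsilon> = 1 \<or> \<epsilon> = -1" for \<epsilon>
    using that by (auto simp: exp_eq_polar complex_eq_iff)
  define a where "a = of_real (X x) * Complex c s"
  define b where "b = of_real (X x) * Complex c (- s)"
  have ab: "a * b = of_real ((X x)\<^sup>2)"
    using sc by (simp add: a_def b_def complex_eq_iff power2_eq_square algebra_simps)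
  have "(a + \<i>) * (b + \<i>) = a * b + \<i> * (a + b) - 1" by (simp add: algebra_simps)
  also have "a + b = 2 * of_real (X x * c)" by (simp add: a_def b_def complex_eq_iff)
  finally have d: "(a + \<i>) * (b + \<i>) = den x" unfolding ab by (simp add: den_def algebra_simps)
  then have nz: "a + \<i> \<noteq> 0" "b + \<i> \<noteq> 0" using den_nz[of x] by auto
  have "a / (a + \<i>) - b / (b + \<i>) = (a * (b + \<i>) - b * (a + \<i>)) / ((a + \<i>) * (b + \<i>))"
    using nz by (simp add: diff_frac_eq)
  also have "a * (b + \<i>) - b * (a + \<i>) = \<i> * (a - b)" by (simp add: algebra_simps)
  also have "a - b = 2 * \<i> * of_real (X x * s)" by (simp add: a_def b_def complex_eq_iff)
  also have "\<i> * (2 * \<i> * of_real (X x * s)) = 2 * pi * \<i> * (\<i> * of_real (s / pi * X x))"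
    by (simp add: complex_eq_iff)
  also have "2 * pi * \<i> * (\<i> * of_real (s / pi * X x)) / ((a + \<i>) * (b + \<i>)) = 2 * pi * \<i> * kern x"
    unfolding d kern_def by (simp only: times_divide_eq_right)
  finally have HH: "a / (a + \<i>) - b / (b + \<i>) = 2 * pi * \<i> * kern x" .
  have H1: "H (Complex x pi) = a / (a + \<i>)" and H2: "H (Complex x (- pi)) = b / (b + \<i>)"
    using H_boundary[of 1 x] H_boundary[of "-1" x] by (simp_all add: a_def b_def)
  have E1: "exp (Complex x pi) = - of_real (exp x)" and E2: "exp (Complex x (- pi)) = - of_real (exp x)"
    using e[of 1] e[of "-1"] by simp_all
  have m: "- complex_of_real (exp x) - of_real p = - of_real (exp x + p)" by simp
  have "G p (Complex x (-pi)) - G p (Complex x pi) = (a / (a + \<i>) - b / (b + \<i>)) / of_real (exp x + p)"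
    unfolding G_def H1 H2 E1 E2 m by (simp only: divide_minus_right diff_minus_eq_add diff_divide_distrib) simp
  then show ?thesis unfolding HH by simp
qed

section \<open>Vanishing of the vertical sides and the Stieltjes transform\<close>

lemma norm_H_right:
  assumes "2 \<le> X (Re w)" shows "cmod (H w) \<le> 2"
proof -
  have "X (Re w) - 1 \<le> cmod (exp (of_real \<alpha> * w) + \<i>)"
    using norm_triangle_ineq4[of "exp (of_real \<alpha> * w) + \<i>" \<i>] by (simp add: X_def)
  then have "X (Re w) / cmod (exp (of_real \<alpha> * w) + \<i>) \<le> X (Re w) / (X (Re w) - 1)"
    using assms by (intro divide_left_mono mult_pos_pos) auto
  also have "\<dots> \<le> 2" using assms by (simp add: divide_le_eq)
  finally show ?thesis by (simp add: H_def norm_divide X_def)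
qed

lemma norm_H_left:
  assumes "X (Re w) \<le> 1/2" shows "cmod (H w) \<le> 2 * X (Re w)"
proof -
  have "1/2 \<le> cmod (exp (of_real \<alpha> * w) + \<i>)"
    using norm_triangle_ineq4[of "exp (of_real \<alpha> * w) + \<i>" "exp (of_real \<alpha> * w)"] assms by (simp add: X_def)
  then have "X (Re w) / cmod (exp (of_real \<alpha> * w) + \<i>) \<le> X (Re w) / (1/2)"
    using X_pos[of "Re w"] by (intro divide_left_mono mult_pos_pos) auto
  then show ?thesis by (simp add: H_def norm_divide X_def)
qed

lemma vertical_segment_bound:
  assumes p: "0 < p" and M: "\<bar>ln p\<bar> < \<bar>M\<bar>" and B: "0 \<le> B"
    and b: "\<And>w. Re w = M \<Longrightarrow> cmod (G p w) \<le> B"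
  shows "cmod (contour_integral (linepath (Complex M (-pi)) (Complex M pi)) (G p)) \<le> B * (2 * pi)"
proof -
  have "cmod (contour_integral (linepath (Complex M (-pi)) (Complex M pi)) (G p))
      \<le> B * norm (Complex M pi - Complex M (-pi))"
  proof (rule contour_integral_bound_linepath[OF _ B])
    show "G p contour_integrable_on linepath (Complex M (-pi)) (Complex M pi)"
    proof (rule G_contour_integrable[OF p], rule subsetI, rule segments_subset[OF M])
      fix w assume "w \<in> path_image (linepath (Complex M (-pi)) (Complex M pi))"
      then have "Re w = M" "Im w \<in> closed_segment (-pi) pi"
        by (auto simp: closed_segment_same_Re)
      then show "\<bar>Re w\<bar> = \<bar>M\<bar> \<and> \<bar>Im w\<bar> \<le> pi \<or> \<bar>Im w\<bar> = pi"
        by (auto simp: closed_segment_eq_real_ivl abs_le_iff)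
    qed
    show "cmod (G p w) \<le> B" if "w \<in> closed_segment (Complex M (-pi)) (Complex M pi)" for w
      using that by (intro b) (auto simp: closed_segment_same_Re)
  qed
  also have "Complex M pi - Complex M (-pi) = 2 * pi * \<i>" by (simp add: complex_eq_iff)
  finally show ?thesis by (simp add: norm_mult)
qed

text \<open>To the right \<open>H\<close> stays bounded while \<open>exp w - p\<close> grows; to the
  left, in \<open>vertical_left_tendsto\<close>, \<open>exp w - p\<close> stays away from 0 while
  \<open>H\<close> tends to 0 like \<open>X\<close>.\<close>

lemma vertical_right_tendsto:
  assumes p: "0 < p"
  shows "(\<lambda>n::nat. contour_integral (linepath (Complex (real n) (-pi)) (Complex (real n) pi)) (G p)) \<longlonglongrightarrow> 0"
proof (rule Lim_null_comparison)
  have "filterlim (\<lambda>n. X (real n)) at_top sequentially"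
    unfolding X_def using \<alpha>
    by (intro filterlim_compose[OF exp_at_top] filterlim_tendsto_pos_mult_at_top[OF tendsto_const]
        filterlim_real_sequentially) auto
  then have ev1: "\<forall>\<^sub>F n in sequentially. 2 \<le> X (real n)" unfolding filterlim_at_top by blast
  have ex: "filterlim (\<lambda>n. exp (real n) - p) at_top sequentially"
    using filterlim_tendsto_add_at_top[OF tendsto_const[of "- p"]
        filterlim_compose[OF exp_at_top filterlim_real_sequentially]] by simp
  then have ev2: "\<forall>\<^sub>F n in sequentially. 1 \<le> exp (real n) - p" unfolding filterlim_at_top by blast
  have ev3: "\<forall>\<^sub>F n in sequentially. \<bar>ln p\<bar> + 1 \<le> real n"
    using filterlim_real_sequentially unfolding filterlim_at_top by blast
  show "\<forall>\<^sub>F n in sequentially. norm (contour_integral (linepath (Complex (real n) (-pi)) (Complex (real n) pi)) (G p))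
      \<le> 2 / (exp (real n) - p) * (2 * pi)"
    using ev1 ev2 ev3
  proof eventually_elim
    case (elim n)
    show ?case
    proof (rule vertical_segment_bound[OF p])
      fix w :: complex assume w: "Re w = real n"
      have "cmod (exp w) - p \<le> cmod (exp w - of_real p)"
        using norm_triangle_ineq2[of "exp w" "of_real p"] p by simp
      then have "exp (real n) - p \<le> cmod (exp w - of_real p)" by (simp add: w)
      then show "cmod (G p w) \<le> 2 / (exp (real n) - p)"
        unfolding G_def norm_divide using norm_H_right[of w] elim w by (intro frac_le) auto
    qed (use elim in auto)
  qed
  show "(\<lambda>n. 2 / (exp (real n) - p) * (2 * pi)) \<longlonglongrightarrow> 0"
    by (intro tendsto_mult_left_zero tendsto_divide_0[OF tendsto_const] filterlim_at_top_imp_at_infinity ex)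
qed

lemma vertical_left_tendsto:
  assumes p: "0 < p"
  shows "(\<lambda>n::nat. contour_integral (linepath (Complex (- real n) (-pi)) (Complex (- real n) pi)) (G p)) \<longlonglongrightarrow> 0"
proof (rule Lim_null_comparison)
  have lim: "(\<lambda>n. exp (a * - real n)) \<longlonglongrightarrow> 0" if "0 < a" for a
    using that
    by (intro filterlim_compose[OF exp_at_bot])
       (auto simp: filterlim_uminus_at_bot intro!: filterlim_tendsto_pos_mult_at_top[OF tendsto_const] filterlim_real_sequentially)
  have limX: "(\<lambda>n. X (- real n)) \<longlonglongrightarrow> 0" unfolding X_def by (rule lim[OF \<alpha>(1)])
  then have ev1: "\<forall>\<^sub>F n in sequentially. X (- real n) < 1/2" by (rule order_tendstoD) simp
  have ev2: "\<forall>\<^sub>F n in sequentially. exp (1 * - real n) < p / 2"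
    by (rule order_tendstoD(2)[OF lim]) (use p in auto)
  have ev3: "\<forall>\<^sub>F n in sequentially. \<bar>ln p\<bar> + 1 \<le> real n"
    using filterlim_real_sequentially unfolding filterlim_at_top by blast
  show "\<forall>\<^sub>F n in sequentially. norm (contour_integral (linepath (Complex (- real n) (-pi)) (Complex (- real n) pi)) (G p))
      \<le> (2 * X (- real n)) / (p / 2) * (2 * pi)"
    using ev1 ev2 ev3
  proof eventually_elim
    case (elim n)
    show ?case
    proof (rule vertical_segment_bound[OF p])
      fix w :: complex assume w: "Re w = - real n"
      have "p - cmod (exp w) \<le> cmod (exp w - of_real p)"
        using norm_triangle_ineq2[of "of_real p" "exp w"] p by (simp add: norm_minus_commute)
      then have "p / 2 \<le> cmod (exp w - of_real p)" using elim(2) by (simp add: w)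
      then show "cmod (G p w) \<le> (2 * X (- real n)) / (p / 2)"
        unfolding G_def norm_divide using norm_H_left[of w] elim w p X_pos[of "- real n"]
        by (intro frac_le) auto
    qed (use elim p X_pos[of "- real n"] in auto)
  qed
  have "(\<lambda>n. (2 * X (- real n)) / (p / 2) * (2 * pi)) \<longlonglongrightarrow> (2 * 0) / (p / 2) * (2 * pi)"
    using p by (intro tendsto_intros limX) auto
  then show "(\<lambda>n. (2 * X (- real n)) / (p / 2) * (2 * pi)) \<longlonglongrightarrow> 0" by simp
qed

lemma Stieltjes_kern_integrable:
  assumes p: "0 < p" shows "integrable lborel (\<lambda>x. kern x / of_real (exp x + p))"
proof (rule Bochner_Integration.integrable_bound)
  show "integrable lborel (\<lambda>x. kern x / of_real p)" using kern_integrable by simp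
  show "AE x in lborel. norm (kern x / of_real (exp x + p)) \<le> norm (kern x / of_real p)"
  proof (rule AE_I2)
    fix x
    have "p \<le> exp x + p" by simp
    then show "norm (kern x / of_real (exp x + p)) \<le> norm (kern x / of_real p)"
      unfolding norm_divide norm_of_real using p by (intro divide_left_mono) (auto simp: add_pos_pos)
  qed
qed simp

text \<open>The rectangles grow to the whole strip: their vertical sides vanish, and dominated
  convergence gives the limit of the horizontal ones.\<close>

lemma Stieltjes_kern:
  assumes p: "0 < p"
  shows "(LINT x|lborel. kern x / of_real (exp x + p)) = H (of_real (ln p)) / of_real p - of_real pole / (of_real p - p0)"
    (is "?L = ?R")
proof -
  let ?f = "\<lambda>x. kern x / of_real (exp x + p)"
  let ?I = "\<lambda>n::nat. LINT x|lborel. indicator {- real n..real n} x *\<^sub>R ?f x"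
  have fi: "integrable lborel ?f" by (rule Stieltjes_kern_integrable[OF p])
  have "?I \<longlonglongrightarrow> ?L"
  proof (rule integral_dominated_convergence[where w = "\<lambda>x. norm (?f x)"])
    show "AE x in lborel. (\<lambda>n. indicator {- real n..real n} x *\<^sub>R ?f x) \<longlonglongrightarrow> ?f x"
    proof (rule AE_I2)
      fix x :: real
      obtain N :: nat where N: "\<bar>x\<bar> \<le> real N" using real_arch_simple by blast
      have "\<forall>\<^sub>F n in sequentially. ?f x = indicator {- real n..real n} x *\<^sub>R ?f x"
        using eventually_ge_at_top[of N] by eventually_elim (use N in \<open>auto simp: indicator_def\<close>)
      then show "(\<lambda>n. indicator {- real n..real n} x *\<^sub>R ?f x) \<longlonglongrightarrow> ?f x"
        by (rule Lim_transform_eventually[OF tendsto_const])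
    qed
    show "AE x in lborel. norm (indicator {- real n..real n} x *\<^sub>R ?f x) \<le> norm (?f x)" for n
      by (intro AE_I2) (auto simp: indicator_def)
  qed (use fi in auto)
  then have L1: "(\<lambda>n. 2 * pi * \<i> * ?I n) \<longlonglongrightarrow> 2 * pi * \<i> * ?L"
    by (intro tendsto_intros)
  have ev: "\<forall>\<^sub>F n in sequentially. \<bar>ln p\<bar> + 1 \<le> real n"
    using filterlim_real_sequentially unfolding filterlim_at_top by blast
  let ?V1 = "\<lambda>n::nat. contour_integral (linepath (Complex (real n) (-pi)) (Complex (real n) pi)) (G p)"
  let ?V2 = "\<lambda>n::nat. contour_integral (linepath (Complex (- real n) (-pi)) (Complex (- real n) pi)) (G p)"
  have L2: "(\<lambda>n. 2 * pi * \<i> * ?R - ?V1 n + ?V2 n) \<longlonglongrightarrow> 2 * pi * \<i> * ?R - 0 + 0"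
    by (intro tendsto_intros vertical_left_tendsto vertical_right_tendsto p)
  have "\<forall>\<^sub>F n in sequentially. 2 * pi * \<i> * ?R - ?V1 n + ?V2 n = 2 * pi * \<i> * ?I n"
    using ev
  proof eventually_elim
    case (elim n)
    then have n: "\<bar>ln p\<bar> < real n" by simp
    have "set_integrable lborel {- real n..real n} ?f"
      using fi by (rule integrable_mult_indicator[of "{- real n..real n}" lborel, folded set_integrable_def, rotated]) simp
    then have "?I n = integral {- real n..real n} ?f"
      using set_borel_integral_eq_integral(2)[of "{- real n..real n}" ?f] by (simp add: set_lebesgue_integral_def)
    then have "2 * pi * \<i> * ?I n = integral {- real n..real n} (\<lambda>x. G p (Complex x (-pi)) - G p (Complex x pi))"
      unfolding G_jump[OF p] by (simp only: integral_mult_right)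
    then have I: "2 * pi * \<i> * ?I n = integral {- real n..real n} (\<lambda>x. G p (Complex x (-pi)) - G p (Complex x pi))" .
    have A: "integral {- real n..real n} (\<lambda>x. G p (Complex x (-pi)) - G p (Complex x pi)) + ?V1 n - ?V2 n = 2 * pi * \<i> * ?R"
      unfolding contour_integral_rect_split[OF p n, symmetric] by (rule contour_integral_G_rect[OF p n])
    show ?case unfolding A[symmetric] I by simp
  qed
  with L2 have "(\<lambda>n. 2 * pi * \<i> * ?I n) \<longlonglongrightarrow> 2 * pi * \<i> * ?R - 0 + 0"
    by (rule Lim_transform_eventually)
  from LIMSEQ_unique[OF L1 this] show ?thesis by simp
qed

end

text \<open>Termwise: the Gamma factor from \<open>t powr (\<alpha> * real k)\<close> cancels the
  Mittag-Leffler coefficient and leaves a geometric series in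
  \<open>\<mu> / p powr \<alpha>\<close>.\<close>

lemma Laplace_relaxation:
  assumes \<alpha>: "0 < \<alpha>" and p: "0 < p" and \<mu>: "cmod \<mu> < p powr \<alpha>"
  shows "has_bochner_integral lborel (\<lambda>t. indicat_real {0<..} t *\<^sub>R (exp (- (p * t)) *\<^sub>R relaxation \<alpha> \<mu> t))
     (of_real (p powr (\<alpha> - 1)) / (of_real (p powr \<alpha>) - \<mu>))"
proof -
  define q where "q k t = indicat_real {0<..} t * (t powr (\<alpha> * real k) * exp (- (p * t)))" for k t
  define w where "w k = of_real (ml_coeff \<alpha> k) * \<mu> ^ k" for k
  have q: "has_bochner_integral lborel (q k) (Gamma (\<alpha> * real k + 1) / p powr (\<alpha> * real k + 1))" for k
    unfolding q_def using has_bochner_integral_Laplace_powr[of "\<alpha> * real k" p] \<alpha> p by simp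
  have q0: "q k t \<ge> 0" for k t by (simp add: q_def)
  have c: "Gamma (\<alpha> * real k + 1) * ml_coeff \<alpha> k = 1" for k
    using ml_coeff_pos[OF \<alpha>, of k] by (auto simp: ml_coeff_def)
  have pk: "p powr (\<alpha> * real k + 1) = p * (p powr \<alpha>) ^ k" for k
    using p by (simp add: powr_add powr_powr flip: powr_realpow)
  have I: "has_bochner_integral lborel (\<lambda>t. q k t *\<^sub>R w k) (of_real (1 / p) * (\<mu> / of_real (p powr \<alpha>)) ^ k)" for k
  proof -
    have "(Gamma (\<alpha> * real k + 1) / p powr (\<alpha> * real k + 1)) *\<^sub>R w k
      = of_real (Gamma (\<alpha> * real k + 1) * ml_coeff \<alpha> k) * (of_real (1 / p) * (\<mu> / of_real (p powr \<alpha>)) ^ k)"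
      by (simp add: w_def pk scaleR_conv_of_real power_divide)
    then show ?thesis using has_bochner_integral_scaleR_left[OF q[of k], of "w k"] by (simp add: c)
  qed
  have In: "(LINT t|lborel. norm (q k t *\<^sub>R w k)) = 1 / p * (cmod \<mu> / p powr \<alpha>) ^ k" for k
  proof -
    have "norm (w k) = ml_coeff \<alpha> k * cmod \<mu> ^ k"
      using ml_coeff_pos[OF \<alpha>, of k] by (simp add: w_def norm_mult norm_power)
    then have "(LINT t|lborel. norm (q k t *\<^sub>R w k))
        = Gamma (\<alpha> * real k + 1) / p powr (\<alpha> * real k + 1) * (ml_coeff \<alpha> k * cmod \<mu> ^ k)"
      using has_bochner_integral_integral_eq[OF has_bochner_integral_mult_left[OF q[of k], of "norm (w k)"]] q0
      by simp
    also have "\<dots> = (Gamma (\<alpha> * real k + 1) * ml_coeff \<alpha> k) * (1 / p * (cmod \<mu> / p powr \<alpha>) ^ k)"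
      by (simp add: pk power_divide)
    finally show ?thesis by (simp add: c)
  qed
  have trm: "q k t *\<^sub>R w k = indicat_real {0<..} t *\<^sub>R (exp (- (p * t)) *\<^sub>R
      (of_real (ml_coeff \<alpha> k) * (\<mu> * of_real (t powr \<alpha>)) ^ k))" for k t
  proof (cases "0 < t")
    case True
    then have "t powr (\<alpha> * real k) = (t powr \<alpha>) ^ k" by (simp add: powr_powr flip: powr_realpow)
    then show ?thesis by (simp add: q_def w_def scaleR_conv_of_real power_mult_distrib mult_ac)
  qed (simp add: q_def)
  have pt: "(\<lambda>k. q k t *\<^sub>R w k) sums (indicat_real {0<..} t *\<^sub>R (exp (- (p * t)) *\<^sub>R relaxation \<alpha> \<mu> t))"
    and ptn: "summable (\<lambda>k. norm (q k t *\<^sub>R w k))" for t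
  proof -
    show "(\<lambda>k. q k t *\<^sub>R w k) sums (indicat_real {0<..} t *\<^sub>R (exp (- (p * t)) *\<^sub>R relaxation \<alpha> \<mu> t))"
      unfolding trm relaxation_def by (rule sums_scaleR_right[OF sums_scaleR_right[OF mittag_leffler_sums[OF \<alpha>]]])
    show "summable (\<lambda>k. norm (q k t *\<^sub>R w k))"
      unfolding trm norm_scaleR by (rule summable_mult[OF summable_mult[OF summable_norm_ml_coeff[OF \<alpha>]]])
  qed
  have Iint: "integrable lborel (\<lambda>t. q k t *\<^sub>R w k)" for k
    using I[of k] by (auto simp: has_bochner_integral_iff)
  have r: "cmod \<mu> / p powr \<alpha> < 1" using \<mu> p by simp
  have S: "summable (\<lambda>k. LINT t|lborel. norm (q k t *\<^sub>R w k))"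
    unfolding In by (rule summable_mult[OF summable_geometric]) (use r in simp)
  let ?g = "\<lambda>t. indicat_real {0<..} t *\<^sub>R (exp (- (p * t)) *\<^sub>R relaxation \<alpha> \<mu> t)"
  have eq: "(\<lambda>t. \<Sum>k. q k t *\<^sub>R w k) = ?g" using pt by (auto simp: sums_iff)
  have gi: "integrable lborel ?g"
    using integrable_suminf[OF Iint AE_I2[OF ptn] S] unfolding eq .
  have "(\<lambda>k. integral\<^sup>L lborel (\<lambda>t. q k t *\<^sub>R w k)) sums integral\<^sup>L lborel ?g"
    using sums_integral[OF Iint AE_I2[OF ptn] S] unfolding eq .
  moreover have "(\<lambda>k. integral\<^sup>L lborel (\<lambda>t. q k t *\<^sub>R w k)) sums (of_real (1 / p) * (1 / (1 - \<mu> / of_real (p powr \<alpha>))))"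
    unfolding has_bochner_integral_integral_eq[OF I]
    by (intro sums_mult geometric_sums) (use r p in \<open>simp add: norm_divide\<close>)
  ultimately have "integral\<^sup>L lborel ?g = of_real (1 / p) * (1 / (1 - \<mu> / of_real (p powr \<alpha>)))"
    by (rule sums_unique2)
  also have "\<dots> = of_real (p powr (\<alpha> - 1)) / (of_real (p powr \<alpha>) - \<mu>)"
  proof -
    have "complex_of_real (p powr \<alpha>) \<noteq> 0" using p by simp
    then have "1 - \<mu> / of_real (p powr \<alpha>) = (of_real (p powr \<alpha>) - \<mu>) / of_real (p powr \<alpha>)"
      by (simp add: diff_divide_distrib)
    then show ?thesis using p by (simp add: powr_diff)
  qed
  finally show ?thesis using gi by (simp add: has_bochner_integral_iff)
qed

text \<open>Writing the exponential as the case of order 1 lets it inherit its Laplace transform and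
  its growth bound from the general lemmas.\<close>

lemma relaxation_1: "0 \<le> t \<Longrightarrow> relaxation 1 \<mu> t = exp (of_real t * \<mu>)"
proof -
  have "ml_coeff 1 k = inverse (fact k)" for k
    using Gamma_fact[of k, where 'a = real] by (simp add: ml_coeff_def add.commute inverse_eq_divide)
  then have "mittag_leffler 1 z = exp z" for z
    by (simp add: mittag_leffler_def exp_def scaleR_conv_of_real)
  then show "0 \<le> t \<Longrightarrow> relaxation 1 \<mu> t = exp (of_real t * \<mu>)"
    by (simp add: relaxation_def mult.commute)
qed

lemma relaxation_exp_bound:
  assumes \<alpha>: "0 < \<alpha>" and \<mu>: "cmod \<mu> \<le> 1" and t: "0 \<le> t"
  shows "cmod (relaxation \<alpha> \<mu> t) \<le> 2 * exp 1 * exp (2 powr (1 / \<alpha>) * t)"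
proof (cases "t = 0")
  case True
  have "(1::real) \<le> 2 * exp 1" using exp_ge_add_one_self[of 1] by linarith
  then show ?thesis using True by simp
next
  case False
  then have t: "0 < t" using assms by simp
  \<comment> \<open>Chosen so that
    \<open>M powr (- \<alpha>) * t powr \<alpha> = 1/2\<close>.\<close>
  define M where "M = 2 powr (1 / \<alpha>) * t"
  have M: "0 < M" "M powr (- \<alpha>) = 1 / (2 * t powr \<alpha>)"
    using t \<alpha> by (simp_all add: M_def powr_mult powr_powr powr_minus field_simps)
  have "cmod (relaxation \<alpha> \<mu> t) \<le> (\<Sum>k. exp (M + 1) * (1/2) ^ k)"
    unfolding relaxation_def mittag_leffler_def
  proof (rule norm_suminf_le)
    show "summable (\<lambda>k. exp (M + 1) * (1/2::real) ^ k)" by (intro summable_mult summable_geometric) simp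
    fix k
    have "cmod (of_real (ml_coeff \<alpha> k) * (\<mu> * of_real (t powr \<alpha>)) ^ k) = ml_coeff \<alpha> k * (cmod \<mu> * t powr \<alpha>) ^ k"
      using ml_coeff_pos[OF \<alpha>, of k] by (simp add: norm_mult norm_power)
    also have "\<dots> \<le> (exp (M + 1) * (M powr (- \<alpha>)) ^ k) * (1 * t powr \<alpha>) ^ k"
      using ml_coeff_le[OF \<alpha> M(1), of k] \<mu> ml_coeff_pos[OF \<alpha>, of k]
      by (intro mult_mono power_mono mult_right_mono) auto
    also have "\<dots> = exp (M + 1) * (M powr (- \<alpha>) * t powr \<alpha>) ^ k"
      by (simp add: power_mult_distrib)
    also have "M powr (- \<alpha>) * t powr \<alpha> = 1/2" using t by (simp add: M)
    finally show "cmod (of_real (ml_coeff \<alpha> k) * (\<mu> * of_real (t powr \<alpha>)) ^ k) \<le> exp (M + 1) * (1/2) ^ k" .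
  qed
  also have "\<dots> = exp (M + 1) * 2"
    by (subst suminf_mult) (simp_all add: suminf_geometric)
  finally show ?thesis by (simp add: M_def exp_add mult_ac)
qed

section \<open>The representation as exponential plus integral\<close>

context relaxation_contour
begin

definition J :: "real \<Rightarrow> complex" where
  "J t = (LINT x|lborel. exp (- (t * exp x)) *\<^sub>R kern x)"

lemma J_integrable:
  assumes "0 \<le> t" shows "integrable lborel (\<lambda>x. exp (- (t * exp x)) *\<^sub>R kern x)"
  by (rule Bochner_Integration.integrable_bound[OF kern_integrable])
     (use assms in \<open>auto intro!: AE_I2 mult_left_le_one_le\<close>)

lemma norm_J_le:
  assumes "0 \<le> t" shows "cmod (J t) \<le> (LINT x|lborel. cmod (kern x))"
proof -
  have "cmod (J t) \<le> (LINT x|lborel. cmod (exp (- (t * exp x)) *\<^sub>R kern x))"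
    unfolding J_def by (rule integral_norm_bound)
  also have "\<dots> \<le> (LINT x|lborel. cmod (kern x))"
    using J_integrable[OF assms] kern_integrable assms
    by (intro integral_mono integrable_norm) (auto intro!: mult_left_le_one_le)
  finally show ?thesis .
qed

lemma continuous_on_J: "continuous_on {0..} J"
proof (rule continuous_on_sequentiallyI)
  fix u :: "nat \<Rightarrow> real" and a assume u: "\<forall>n. u n \<in> {0..}" and lim: "u \<longlonglongrightarrow> a"
  show "(\<lambda>n. J (u n)) \<longlonglongrightarrow> J a"
    unfolding J_def
  proof (rule integral_dominated_convergence[where w = "\<lambda>x. norm (kern x)"])
    show "AE x in lborel. (\<lambda>n. exp (- (u n * exp x)) *\<^sub>R kern x) \<longlonglongrightarrow> exp (- (a * exp x)) *\<^sub>R kern x"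
      by (intro AE_I2 tendsto_intros lim)
    show "AE x in lborel. norm (exp (- (u n * exp x)) *\<^sub>R kern x) \<le> norm (kern x)" for n
      using u by (intro AE_I2) (auto intro!: mult_left_le_one_le)
  qed (use kern_integrable in auto)
qed

text \<open>By Fubini: integrating \<open>exp (- ((exp x + p) * t))\<close> over
  \<open>t > 0\<close> gives \<open>1 / (exp x + p)\<close>, so the result is the Stieltjes
  transform evaluated in \<open>Stieltjes_kern\<close>.\<close>

lemma Laplace_J:
  assumes p: "0 < p"
  shows "has_bochner_integral lborel (\<lambda>t. indicat_real {0<..} t *\<^sub>R (exp (- (p * t)) *\<^sub>R J t))
    (LINT x|lborel. kern x / of_real (exp x + p))"
proof -
  define F where "F x t = (indicat_real {0<..} t * exp (- ((exp x + p) * t))) *\<^sub>R kern x" for x t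
  have px: "0 < exp x + p" for x :: real using p by (simp add: add_pos_pos)
  have inner: "has_bochner_integral lborel (F x) ((1 / (exp x + p)) *\<^sub>R kern x)" for x
    unfolding F_def by (rule has_bochner_integral_scaleR_left[OF has_bochner_integral_exp_neg[OF px]])
  have inner_norm: "(LINT t|lborel. norm (F x t)) = norm (kern x / of_real (exp x + p))" for x
  proof -
    have "(LINT t|lborel. norm (F x t)) = (1 / (exp x + p)) * norm (kern x)"
      using has_bochner_integral_integral_eq[OF has_bochner_integral_mult_left[OF has_bochner_integral_exp_neg[OF px[of x]], of "norm (kern x)"]]
      by (simp add: F_def abs_mult)
    also have "\<dots> = norm (kern x / of_real (exp x + p))"
      unfolding norm_divide norm_of_real using px[of x] by simp
    finally show ?thesis .
  qed
  have prod: "integrable (lborel \<Otimes>\<^sub>M lborel) (\<lambda>(x, t). F x t)"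
  proof (rule lborel_pair.Fubini_integrable)
    have "(\<lambda>q. F (fst q) (snd q)) \<in> borel_measurable (borel \<Otimes>\<^sub>M borel)"
      unfolding F_def by measurable
    then show "(\<lambda>(x, t). F x t) \<in> borel_measurable (lborel \<Otimes>\<^sub>M lborel)"
      by (simp add: case_prod_unfold cong: measurable_cong_sets)
    show "integrable lborel (\<lambda>x. LINT t|lborel. norm (case (x, t) of (x, t) \<Rightarrow> F x t))"
      unfolding prod.case inner_norm by (intro integrable_norm Stieltjes_kern_integrable p)
    show "AE x in lborel. integrable lborel (\<lambda>t. case (x, t) of (x, t) \<Rightarrow> F x t)"
      using inner by (auto simp: has_bochner_integral_iff)
  qed
  have out: "(LINT x|lborel. F x t) = indicat_real {0<..} t *\<^sub>R (exp (- (p * t)) *\<^sub>R J t)" for t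
  proof -
    have "exp (- ((exp x + p) * t)) = exp (- (p * t)) * exp (- (t * exp x))" for x
      by (simp add: exp_add[symmetric] algebra_simps)
    then have "(\<lambda>x. F x t) = (\<lambda>x. (indicat_real {0<..} t * exp (- (p * t))) *\<^sub>R (exp (- (t * exp x)) *\<^sub>R kern x))"
      by (simp add: F_def fun_eq_iff)
    then show ?thesis unfolding J_def by (simp only: integral_scaleR_right) simp
  qed
  have "integrable lborel (\<lambda>t. LINT x|lborel. F x t)"
    by (rule lborel_pair.integrable_snd[OF prod])
  moreover have "(LINT t|lborel. LINT x|lborel. F x t) = (LINT x|lborel. LINT t|lborel. F x t)"
    by (rule lborel_pair.Fubini_integral[OF prod])
  moreover have "(LINT t|lborel. F x t) = kern x / of_real (exp x + p)" for x
    using has_bochner_integral_integral_eq[OF inner[of x]] by (simp add: scaleR_conv_of_real)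
  ultimately show ?thesis unfolding out by (simp add: has_bochner_integral_iff)
qed

lemma norm_p0: "cmod p0 = 1" by (simp add: p0_def norm_exp_eq_Re)

lemma relaxation_eq:
  assumes t: "0 < t"
  shows "relaxation \<alpha> (- \<i>) t = of_real pole * exp (of_real t * p0) + J t"
proof -
  define h where "h t = relaxation \<alpha> (- \<i>) t - (of_real pole * relaxation 1 p0 t + J t)" for t
  define Kn where "Kn = (LINT x|lborel. cmod (kern x))"
  \<comment> \<open>A common growth rate: \<open>2 powr (1 / \<alpha>)\<close> serves the order
    \<open>\<alpha>\<close>, and 2 the order 1.\<close>
  define a where "a = max (2 powr (1 / \<alpha>)) 2"
  have Kn: "0 \<le> Kn" by (simp add: Kn_def)
  have a: "2 powr (1 / \<alpha>) \<le> a" "2 \<le> a" by (simp_all add: a_def)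
  have "h t = 0"
  proof (rule Laplace_transform_zero[OF _ _ _ t])
    show "continuous_on {0..} h"
      unfolding h_def using \<alpha> by (intro continuous_intros continuous_on_relaxation continuous_on_J) auto
    show "cmod (h t) \<le> (2 * exp 1 + \<bar>pole\<bar> * (2 * exp 1) + Kn) * exp (a * t)" if t: "0 \<le> t" for t
    proof -
      have at: "exp (2 powr (1 / \<alpha>) * t) \<le> exp (a * t)" "exp (2 * t) \<le> exp (a * t)" "1 \<le> exp (a * t)"
        using a t by (auto intro: mult_right_mono)
      have 1: "cmod (relaxation \<alpha> (- \<i>) t) \<le> 2 * exp 1 * exp (a * t)"
      proof (rule order_trans)
        show "cmod (relaxation \<alpha> (- \<i>) t) \<le> 2 * exp 1 * exp (2 powr (1 / \<alpha>) * t)"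
          using relaxation_exp_bound[OF \<alpha>(1), of "- \<i>" t] t by simp
        show "2 * exp 1 * exp (2 powr (1 / \<alpha>) * t) \<le> 2 * exp 1 * exp (a * t)"
          by (rule mult_left_mono[OF at(1)]) simp
      qed
      have "cmod (relaxation 1 p0 t) \<le> 2 * exp 1 * exp (a * t)"
      proof (rule order_trans)
        show "cmod (relaxation 1 p0 t) \<le> 2 * exp 1 * exp (2 * t)"
          using relaxation_exp_bound[of 1 p0 t] t norm_p0 by simp
        show "2 * exp 1 * exp (2 * t) \<le> 2 * exp 1 * exp (a * t)"
          by (rule mult_left_mono[OF at(2)]) simp
      qed
      then have 2: "cmod (of_real pole * relaxation 1 p0 t) \<le> \<bar>pole\<bar> * (2 * exp 1 * exp (a * t))"
        unfolding norm_mult norm_of_real by (rule mult_left_mono) simp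
      have 3: "cmod (J t) \<le> Kn * exp (a * t)"
        using norm_J_le[OF t] mult_left_mono[OF at(3) Kn] unfolding Kn_def[symmetric] by simp
      have "cmod (h t) \<le> cmod (relaxation \<alpha> (- \<i>) t) + (cmod (of_real pole * relaxation 1 p0 t) + cmod (J t))"
        unfolding h_def by (intro norm_triangle_le_diff add_left_mono norm_triangle_ineq)
      also have "\<dots> \<le> 2 * exp 1 * exp (a * t) + (\<bar>pole\<bar> * (2 * exp 1 * exp (a * t)) + Kn * exp (a * t))"
        using 1 2 3 by (intro add_mono)
      finally show ?thesis by (simp add: algebra_simps)
    qed
    show "has_bochner_integral lborel (\<lambda>t. indicat_real {0<..} t *\<^sub>R (exp (- (p * t)) *\<^sub>R h t)) 0" if p: "1 < p" for p
    proof -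
      have p0: "0 < p" using p by simp
      have pa: "1 < p powr \<alpha>" using p \<alpha> by (simp add: gr_one_powr)
      have L1: "has_bochner_integral lborel (\<lambda>t. indicat_real {0<..} t *\<^sub>R (exp (- (p * t)) *\<^sub>R relaxation \<alpha> (- \<i>) t))
          (H (of_real (ln p)) / of_real p)"
      proof -
        have "exp (complex_of_real \<alpha> * of_real (ln p)) = of_real (p powr \<alpha>)"
          using p0 by (simp add: powr_def exp_of_real[symmetric])
        then have "H (of_real (ln p)) / of_real p = of_real (p powr (\<alpha> - 1)) / (of_real (p powr \<alpha>) - (- \<i>))"
          using p0 by (simp add: H_def powr_diff)
        then show ?thesis using Laplace_relaxation[OF \<alpha>(1) p0, of "- \<i>"] pa by simp
      qed
      have L2: "has_bochner_integral lborel (\<lambda>t. indicat_real {0<..} t *\<^sub>R (exp (- (p * t)) *\<^sub>R relaxation 1 p0 t))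
          (1 / (of_real p - p0))"
        using Laplace_relaxation[of 1 p p0] p p0 norm_p0 by simp
      from has_bochner_integral_mult_right[OF L2, of "of_real pole"]
      have "has_bochner_integral lborel (\<lambda>t. indicat_real {0<..} t *\<^sub>R (exp (- (p * t)) *\<^sub>R relaxation \<alpha> (- \<i>) t)
         - (of_real pole * (indicat_real {0<..} t *\<^sub>R (exp (- (p * t)) *\<^sub>R relaxation 1 p0 t))
            + indicat_real {0<..} t *\<^sub>R (exp (- (p * t)) *\<^sub>R J t)))
         (H (of_real (ln p)) / of_real p - (of_real pole * (1 / (of_real p - p0)) +
            (LINT x|lborel. kern x / of_real (exp x + p))))"
        by (intro has_bochner_integral_diff has_bochner_integral_add L1 Laplace_J p0)
      then show ?thesis
        unfolding Stieltjes_kern[OF p0] h_def by (simp add: scaleR_conv_of_real algebra_simps)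
    qed
  qed
  then show ?thesis using t relaxation_1[of t p0] by (simp add: h_def)
qed

end

section \<open>Bounds on the imaginary axis\<close>

text \<open>\<open>sin x \<le> x\<close> at \<open>x = pi / 6\<close>, where the sine is
  1/2.\<close>

lemma pi_ge_3: "3 \<le> pi"
  using sin_x_le_x[of "pi / 6"] by (simp add: sin_30)

text \<open>The integrand of Euler's integral for \<open>Gamma \<alpha>\<close> in the logarithmic
  variable. For \<open>v \<ge> 0\<close> the quadratic term of the exponential series yields
  \<open>exp (- exp v) \<le> 2 * exp (- (2 * v))\<close>.\<close>

lemma integrable_Gompertz:
  fixes \<alpha> :: real assumes \<alpha>: "0 < \<alpha>" "\<alpha> < 1"
  shows "integrable lborel (\<lambda>v. exp (\<alpha> * v) * exp (- exp v))"
proof (rule Bochner_Integration.integrable_bound)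
  show "integrable lborel (\<lambda>v. 2 * exp (- (\<alpha> * \<bar>v\<bar>)))"
    by (intro integrable_mult_right integrable_exp_neg_abs \<alpha>)
  show "AE v in lborel. norm (exp (\<alpha> * v) * exp (- exp v)) \<le> norm (2 * exp (- (\<alpha> * \<bar>v\<bar>)))"
  proof (rule AE_I2)
    fix v :: real
    show "norm (exp (\<alpha> * v) * exp (- exp v)) \<le> norm (2 * exp (- (\<alpha> * \<bar>v\<bar>)))"
    proof (cases "0 \<le> v")
      case True
      have "exp (2 * v) / 2 \<le> exp (exp v)"
      proof -
        have "1 + exp v + (exp v)\<^sup>2 / 2 \<le> exp (exp v)"
          by (rule exp_lower_Taylor_quadratic) simp
        moreover have "exp (2 * v) = (exp v)\<^sup>2" by (rule exp_double)
        ultimately show ?thesis using exp_gt_zero[of v] by linarith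
      qed
      then have "inverse (exp (exp v)) \<le> inverse (exp (2 * v) / 2)"
        by (rule le_imp_inverse_le) simp
      then have "exp (- exp v) \<le> 2 * exp (- (2 * v))"
        by (simp only: exp_minus inverse_divide) (simp only: divide_inverse)
      then have "exp (\<alpha> * v) * exp (- exp v) \<le> exp (\<alpha> * v) * (2 * exp (- (2 * v)))"
        by (intro mult_left_mono) auto
      also have "\<dots> = 2 * exp (\<alpha> * v - 2 * v)" by (simp add: exp_diff exp_minus divide_inverse)
      also have "\<dots> \<le> 2 * exp (- (\<alpha> * v))"
      proof -
        have "\<alpha> * v \<le> 1 * v" using \<alpha> True by (intro mult_right_mono) auto
        then show ?thesis by simp
      qed
      finally show ?thesis using True by simp
    next
      case False
      have "exp (\<alpha> * v) * exp (- exp v) \<le> exp (\<alpha> * v) * 2"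
      proof (rule mult_left_mono)
        have "exp (- exp v) \<le> exp (0 :: real)" by (subst exp_le_cancel_iff) simp
        then have "exp (- exp v) \<le> 1" by (simp only: exp_zero)
        then show "exp (- exp v) \<le> 2" by linarith
      qed simp
      then show ?thesis using False by simp
    qed
  qed
qed simp

context relaxation_contour
begin

text \<open>The shift \<open>v = ln t + x\<close> absorbs \<open>t\<close> into the double
  exponential and brings out the factor \<open>t powr \<alpha>\<close>.\<close>

lemma norm_J_le_powr:
  assumes t: "0 < t"
  shows "t powr \<alpha> * cmod (J t) \<le> K0 * (LINT v|lborel. exp (\<alpha> * v) * exp (- exp v))"
proof -
  let ?g = "\<lambda>v. exp (\<alpha> * v) * exp (- exp v)"
  have g: "integrable lborel ?g" by (rule integrable_Gompertz[OF \<alpha>(1,2)])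
  have "integrable lborel (\<lambda>x. ?g (ln t + 1 * x))"
    by (rule lborel_integrable_real_affine[OF g]) simp
  moreover have "?g (ln t + 1 * x) = t powr \<alpha> * (X x * exp (- (t * exp x)))" for x
    using t by (simp add: exp_add powr_def X_def distrib_left mult_ac)
  ultimately have i: "integrable lborel (\<lambda>x. t powr \<alpha> * (X x * exp (- (t * exp x))))"
    and e: "(LINT x|lborel. t powr \<alpha> * (X x * exp (- (t * exp x)))) = (LINT v|lborel. ?g v)"
    using lborel_integral_real_affine[of 1 ?g "ln t"] by simp_all
  have "t powr \<alpha> * cmod (J t) \<le> t powr \<alpha> * (LINT x|lborel. cmod (exp (- (t * exp x)) *\<^sub>R kern x))"
    unfolding J_def by (intro mult_left_mono integral_norm_bound) simp
  also have "\<dots> = (LINT x|lborel. t powr \<alpha> * cmod (exp (- (t * exp x)) *\<^sub>R kern x))"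
    by simp
  also have "\<dots> \<le> (LINT x|lborel. K0 * (t powr \<alpha> * (X x * exp (- (t * exp x)))))"
  proof (rule integral_mono)
    show "integrable lborel (\<lambda>x. t powr \<alpha> * cmod (exp (- (t * exp x)) *\<^sub>R kern x))"
      using J_integrable[of t] t by (intro integrable_mult_right integrable_norm) simp
    show "integrable lborel (\<lambda>x. K0 * (t powr \<alpha> * (X x * exp (- (t * exp x)))))"
      by (rule integrable_mult_right[OF i])
    fix x
    have "exp (- (t * exp x)) * cmod (kern x) \<le> exp (- (t * exp x)) * (K0 * X x)"
      by (intro mult_left_mono kern_le_X) simp
    then have "t powr \<alpha> * (exp (- (t * exp x)) * cmod (kern x)) \<le> t powr \<alpha> * (exp (- (t * exp x)) * (K0 * X x))"
      by (rule mult_left_mono) simp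
    then show "t powr \<alpha> * cmod (exp (- (t * exp x)) *\<^sub>R kern x) \<le> K0 * (t powr \<alpha> * (X x * exp (- (t * exp x))))"
      by (simp add: mult_ac)
  qed
  also have "\<dots> = K0 * (LINT v|lborel. ?g v)"
    unfolding e[symmetric] by (rule integral_mult_right_zero)
  finally show ?thesis .
qed

section \<open>Sign and size of the imaginary part of the integral\<close>

lemma Re_den: "Re (den x) = (X x)\<^sup>2 - 1"
  by (simp add: den_def)

lemma Im_kern: "Im (kern x) = s / pi * X x * ((X x)\<^sup>2 - 1) / (cmod (den x))\<^sup>2"
proof -
  have "Im (\<i> * of_real a / z) = a * Re z / (cmod z)\<^sup>2" for a z
    by (simp add: Im_divide cmod_power2)
  from this[of "s / pi * X x" "den x"] show ?thesis
    unfolding kern_def by (simp only: Re_den)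
qed

text \<open>Reflection replaces \<open>y = X x\<close> by \<open>1 / y\<close>. This divides
  \<open>y * (y\<^sup>2 - 1)\<close> by \<open>- y ^ 4\<close> and the squared modulus of the
  denominator by \<open>y ^ 4\<close>.\<close>

lemma Im_kern_minus: "Im (kern (- x)) = - Im (kern x)"
proof -
  define y where "y = X x"
  define D where "D = (cmod (den x))\<^sup>2"
  have y: "y > 0" by (simp add: y_def X_pos)
  have D: "D > 0" using den_nz[of x] by (simp add: D_def)
  have Xm: "X (- x) = 1 / y" by (simp add: y_def X_def exp_minus inverse_eq_divide)
  have "(cmod (den (- x)))\<^sup>2 = ((1 / y)\<^sup>2 - 1)\<^sup>2 + 4 * (1 / y)\<^sup>2 * c\<^sup>2"
    unfolding norm_den Xm ..
  also have "\<dots> = ((y\<^sup>2 - 1)\<^sup>2 + 4 * y\<^sup>2 * c\<^sup>2) / y ^ 4"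
    using y by (simp add: field_simps power2_eq_square power4_eq_xxxx)
  also have "(y\<^sup>2 - 1)\<^sup>2 + 4 * y\<^sup>2 * c\<^sup>2 = D" by (simp add: D_def norm_den y_def)
  finally have dm: "(cmod (den (- x)))\<^sup>2 = D / y ^ 4" .
  have "1 / y * ((1 / y)\<^sup>2 - 1) / (D / y ^ 4) = - (y * (y\<^sup>2 - 1) / D)"
    using y D by (simp add: field_simps power2_eq_square power4_eq_xxxx)
  moreover have gen: "a * b * d / k = a * (b * d / k)" for a b d k :: real by simp
  have "Im (kern (- x)) = s / pi * (1 / y * ((1 / y)\<^sup>2 - 1) / (D / y ^ 4))"
    unfolding Im_kern dm Xm by (rule gen)
  moreover have "Im (kern x) = s / pi * (y * (y\<^sup>2 - 1) / D)"
    unfolding Im_kern D_def y_def by (rule gen)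
  ultimately show ?thesis by (simp only: mult_minus_right)
qed

text \<open>Minus the sum of the integrand of \<open>Im (J t)\<close> and its reflection. Both
  factors are odd in \<open>x\<close>, and for \<open>t \<ge> 0\<close> and \<open>x \<ge> 0\<close>
  both are nonnegative.\<close>

definition \<phi> :: "real \<Rightarrow> real \<Rightarrow> real" where
  "\<phi> t x = Im (kern x) * (exp (- (t * exp (- x))) - exp (- (t * exp x)))"

lemma \<phi>_integral:
  assumes t: "0 \<le> t"
  shows "integrable lborel (\<phi> t)" and "- Im (J t) = (LINT x|lborel. \<phi> t x) / 2"
proof -
  define f where "f x = exp (- (t * exp x)) * Im (kern x)" for x
  have f: "has_bochner_integral lborel f (Im (J t))"
    using has_bochner_integral_bounded_linear[OF bounded_linear_Im
        has_bochner_integral_integrable[OF J_integrable[OF t]]]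
    by (simp add: f_def [abs_def] J_def)
  have f': "has_bochner_integral lborel (\<lambda>x. f (0 + (-1) * x)) (Im (J t))"
    using lborel_has_bochner_integral_real_affine_iff[of "-1" f "Im (J t)" 0] f by simp
  have "has_bochner_integral lborel (\<lambda>x. - (f x + f (0 + (-1) * x))) (- (Im (J t) + Im (J t)))"
    by (rule has_bochner_integral_minus[OF has_bochner_integral_add[OF f f']])
  moreover have "(\<lambda>x. - (f x + f (0 + (-1) * x))) = \<phi> t"
    by (auto simp: f_def \<phi>_def Im_kern_minus algebra_simps)
  ultimately have *: "has_bochner_integral lborel (\<phi> t) (- (Im (J t) + Im (J t)))" by simp
  then show "integrable lborel (\<phi> t)" by (simp add: has_bochner_integral_iff)
  show "- Im (J t) = (LINT x|lborel. \<phi> t x) / 2"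
    using has_bochner_integral_integral_eq[OF *] by simp
qed

lemma Im_kern_nonneg: "0 \<le> x \<Longrightarrow> 0 \<le> Im (kern x)"
proof -
  assume "0 \<le> x"
  then have "1 \<le> X x" using \<alpha> by (simp add: X_def)
  then have "1 \<le> (X x)\<^sup>2" by simp
  then show ?thesis unfolding Im_kern using s_pos X_pos[of x] by simp
qed

lemma \<phi>_nonneg:
  assumes t: "0 \<le> t" shows "0 \<le> \<phi> t x"
proof -
  have pos: "0 \<le> \<phi> t x" if "0 \<le> x" for x
  proof -
    have "t * exp (- x) \<le> t * exp x" using that t by (intro mult_left_mono) auto
    then show ?thesis unfolding \<phi>_def using Im_kern_nonneg[OF that] by (intro mult_nonneg_nonneg) auto
  qed
  have "\<phi> t (- x) = \<phi> t x" by (simp add: \<phi>_def Im_kern_minus algebra_simps)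
  then show ?thesis using pos[of x] pos[of "- x"] by (cases "0 \<le> x") auto
qed

text \<open>The formula of \<open>Im_kern\<close> with \<open>cmod (den x)\<close> replaced by its
  upper bound; it is the derivative of
  \<open>- (s / (pi * \<alpha>) * (X x / ((X x)\<^sup>2 + 1)))\<close>.\<close>

definition q :: "real \<Rightarrow> real" where
  "q x = s / pi * X x * ((X x)\<^sup>2 - 1) / ((X x)\<^sup>2 + 1)\<^sup>2"

lemma q_nonneg: "0 \<le> x \<Longrightarrow> 0 \<le> q x"
proof -
  assume "0 \<le> x"
  then have "1 \<le> X x" using \<alpha> by (simp add: X_def)
  then have "1 \<le> (X x)\<^sup>2" by simp
  then show ?thesis unfolding q_def using s_pos X_pos[of x] by simp
qed

lemma q_le_Im_kern: "0 \<le> x \<Longrightarrow> q x \<le> Im (kern x)"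
proof -
  assume "0 \<le> x"
  then have "1 \<le> X x" using \<alpha> by (simp add: X_def)
  then have "1 \<le> (X x)\<^sup>2" by simp
  moreover have "(cmod (den x))\<^sup>2 \<le> ((X x)\<^sup>2 + 1)\<^sup>2" by (intro power_mono den_le) simp
  ultimately show ?thesis
    unfolding Im_kern q_def using s_pos X_pos[of x] den_nz[of x]
    by (intro divide_left_mono mult_pos_pos mult_nonneg_nonneg) (auto simp: add_nonneg_pos)
qed

lemma has_bochner_integral_q:
  assumes l: "0 \<le> l"
  shows "has_bochner_integral lborel (\<lambda>x. indicat_real {l..} x * q x) (s / (pi * \<alpha>) * (X l / ((X l)\<^sup>2 + 1)))"
proof -
  let ?F = "\<lambda>x. - (s / (pi * \<alpha>) * (X x / ((X x)\<^sup>2 + 1)))"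
  have nz: "(X x)\<^sup>2 + 1 \<noteq> 0" for x using zero_le_power2[of "X x"] by linarith
  have dX: "(X has_real_derivative \<alpha> * X x) (at x)" for x
    unfolding X_def [abs_def] by (auto intro!: derivative_eq_intros)
  have dF: "(?F has_real_derivative q x) (at x)" for x
  proof -
    have "((\<lambda>x. (X x)\<^sup>2 + 1) has_real_derivative 2 * X x * (\<alpha> * X x)) (at x)"
      by (auto intro!: derivative_eq_intros dX)
    from DERIV_minus[OF DERIV_cmult[OF DERIV_divide[OF dX this nz]]]
    have "(?F has_real_derivative - (s / (pi * \<alpha>) * ((\<alpha> * X x * ((X x)\<^sup>2 + 1) - X x * (2 * X x * (\<alpha> * X x))) / (((X x)\<^sup>2 + 1) * ((X x)\<^sup>2 + 1))))) (at x)" .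
    moreover have "- (s / (pi * \<alpha>) * ((\<alpha> * X x * ((X x)\<^sup>2 + 1) - X x * (2 * X x * (\<alpha> * X x))) / (((X x)\<^sup>2 + 1) * ((X x)\<^sup>2 + 1)))) = q x"
    proof -
      have "\<alpha> * X x * ((X x)\<^sup>2 + 1) - X x * (2 * X x * (\<alpha> * X x)) = - (\<alpha> * (X x * ((X x)\<^sup>2 - 1)))"
        by (simp add: power2_eq_square algebra_simps)
      then show ?thesis
        using \<alpha> by (simp add: q_def power2_eq_square[of "(X x)\<^sup>2 + 1"])
    qed
    ultimately show ?thesis by simp
  qed
  have limX: "((\<lambda>x. exp (- (\<alpha> * x))) \<longlongrightarrow> 0) at_top"
    using \<alpha> by (intro filterlim_compose[OF exp_at_bot])
      (auto simp: filterlim_uminus_at_bot intro!: filterlim_tendsto_pos_mult_at_top[OF tendsto_const] filterlim_ident)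
  have "((\<lambda>x. X x / ((X x)\<^sup>2 + 1)) \<longlongrightarrow> 0) at_top"
  proof (rule Lim_null_comparison[OF _ limX], rule always_eventually, rule allI)
    fix x
    have "X x / ((X x)\<^sup>2 + 1) \<le> X x / (X x)\<^sup>2"
      using X_pos[of x] by (intro divide_left_mono) (auto simp: add_nonneg_pos)
    also have "\<dots> = exp (- (\<alpha> * x))"
      by (simp add: X_def power2_eq_square exp_minus field_simps)
    finally show "norm (X x / ((X x)\<^sup>2 + 1)) \<le> exp (- (\<alpha> * x))"
      using X_pos[of x] by simp
  qed
  then have "(?F \<longlongrightarrow> - (s / (pi * \<alpha>) * 0)) at_top"
    by (intro tendsto_intros)
  then have lim: "(?F \<longlongrightarrow> 0) at_top" by simp
  have qm: "q \<in> borel_measurable borel"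
    unfolding q_def [abs_def] X_def [abs_def] by measurable
  have "(\<integral>\<^sup>+x. ennreal (q x) * indicator {l ..} x \<partial>lborel) = 0 - ?F l"
    by (rule nn_integral_FTC_atLeast[OF qm dF q_nonneg lim]) (use l in auto)
  moreover have "(\<integral>\<^sup>+x. ennreal (q x) * indicator {l ..} x \<partial>lborel) = (\<integral>\<^sup>+x. ennreal (indicat_real {l..} x * q x) \<partial>lborel)"
    by (intro nn_integral_cong) (auto simp: indicator_def)
  ultimately show ?thesis
    using qm s_pos \<alpha> X_pos[of l] l q_nonneg
    by (intro has_bochner_integral_nn_integral) (auto simp: indicator_def intro!: AE_I2)
qed

text \<open>The kernel of \<^term>\<open>J\<close> is odd in its imaginary part, so that folding the integral at the origin
  exhibits a definite sign; restricting it to \<open>x \<ge> l\<close> keeps half of a closed-form integral.\<close>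

lemma Im_J_le:
  assumes t: "0 \<le> t" and l: "0 \<le> l"
  shows "s / (2 * pi * \<alpha>) * (X l / ((X l)\<^sup>2 + 1)) * (exp (- (t * exp (- l))) - exp (- (t * exp l))) \<le> - Im (J t)"
proof -
  define E where "E = exp (- (t * exp (- l))) - exp (- (t * exp l))"
  have "t * exp (- l) \<le> t * exp l" using l t by (intro mult_left_mono) auto
  then have E: "0 \<le> E" by (simp add: E_def)
  have "(LINT x|lborel. E * (indicat_real {l..} x * q x)) \<le> (LINT x|lborel. \<phi> t x)"
  proof (rule integral_mono)
    show "integrable lborel (\<lambda>x. E * (indicat_real {l..} x * q x))"
      using has_bochner_integral_q[OF l] by (intro integrable_mult_right) (simp add: has_bochner_integral_iff)
    show "integrable lborel (\<phi> t)" by (rule \<phi>_integral(1)[OF t])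
    fix x
    show "E * (indicat_real {l..} x * q x) \<le> \<phi> t x"
    proof (cases "l \<le> x")
      case True
      \<comment> \<open>Beyond \<open>l\<close> the two exponentials only move further apart, so
        their difference is at least \<open>E\<close>.\<close>
      have "t * exp (- x) \<le> t * exp (- l)" "t * exp l \<le> t * exp x"
        using True t by (auto intro!: mult_left_mono)
      then have "E \<le> exp (- (t * exp (- x))) - exp (- (t * exp x))"
        unfolding E_def by (intro diff_mono) auto
      moreover have "q x \<le> Im (kern x)" "0 \<le> Im (kern x)"
        using q_le_Im_kern Im_kern_nonneg True l by auto
      ultimately have "q x * E \<le> \<phi> t x"
        unfolding \<phi>_def using E by (intro mult_mono) auto
      then show ?thesis using True by (simp add: mult.commute)
    qed (simp add: \<phi>_nonneg[OF t])
  qed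
  then have "E * (s / (pi * \<alpha>) * (X l / ((X l)\<^sup>2 + 1))) \<le> 2 * (- Im (J t))"
    using has_bochner_integral_integral_eq[OF has_bochner_integral_q[OF l]] \<phi>_integral(2)[OF t] by simp
  moreover have "a / (2 * pi * \<alpha>) * b * d = d * (a / (pi * \<alpha>) * b) / 2" for a b d :: real
    by (simp add: mult_ac)
  moreover have "x \<le> z" if "x = y / 2" "y \<le> 2 * z" for x y z :: real
    using that by linarith
  ultimately show ?thesis unfolding E_def by blast
qed

lemma Im_J_neg:
  assumes t: "0 < t" shows "Im (J t) < 0"
proof -
  have "exp (- 1) < exp (1 :: real)" by simp
  then have "t * exp (- 1) < t * exp 1" using t by simp
  then have "0 < s / (2 * pi * \<alpha>) * (X 1 / ((X 1)\<^sup>2 + 1)) * (exp (- (t * exp (- 1))) - exp (- (t * exp 1)))"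
    using s_pos \<alpha> X_pos[of 1] by (intro mult_pos_pos divide_pos_pos) (auto simp: add_nonneg_pos)
  then show ?thesis using Im_J_le[of t 1] t by linarith
qed

section \<open>The exponential against the integral\<close>

definition \<gamma> :: real where "\<gamma> = - cos \<theta>"

lemma \<gamma>_pos: "pole \<noteq> 0 \<Longrightarrow> 0 < \<gamma>"
proof -
  assume "pole \<noteq> 0"
  then have "\<theta> < pi" using \<theta>_less \<alpha> by (auto simp: pole_def split: if_splits)
  then have "cos \<theta> < cos (pi / 2)" using \<theta>_gt2 by (subst cos_mono_less_eq) auto
  then show ?thesis by (simp add: \<gamma>_def)
qed

lemma exp_p0: "exp (of_real t * p0) = of_real (exp (- (\<gamma> * t))) * cis (- (t * sin \<theta>))"
proof -
  have "p0 = cis (- \<theta>)" by (simp add: p0_def cis_conv_exp)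
  then have "of_real t * p0 = Complex (- (\<gamma> * t)) (- (t * sin \<theta>))"
    by (simp add: complex_eq_iff \<gamma>_def)
  then show ?thesis by (simp add: exp_eq_polar)
qed

lemma pole_nonneg: "0 \<le> pole" using \<alpha> by (simp add: pole_def)

lemma norm_pole_term: "cmod (of_real pole * exp (of_real t * p0)) = pole * exp (- (\<gamma> * t))"
  unfolding exp_p0 norm_mult norm_of_real norm_cis using pole_nonneg by simp

text \<open>From \<open>exp (\<gamma> * t) \<ge> (\<gamma> * t)\<^sup>2 / 2\<close>. For
  \<open>t > 1\<close> the weight \<open>t\<^sup>2\<close> exceeds \<open>t powr \<alpha>\<close> by
  more than a factor \<open>t\<close>, so relative to the integral the exponential tends to
  0.\<close>

lemma pole_term_decay:
  assumes t: "0 < t" and "pole \<noteq> 0"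
  shows "t\<^sup>2 * cmod (of_real pole * exp (of_real t * p0)) \<le> pole * (2 / \<gamma>\<^sup>2)"
proof -
  have g: "0 < \<gamma>" using assms \<gamma>_pos by simp
  have gt: "0 \<le> \<gamma> * t" using g t by simp
  have "(\<gamma> * t)\<^sup>2 / 2 \<le> exp (\<gamma> * t)"
    using exp_lower_Taylor_quadratic[OF gt] gt by linarith
  then have "t\<^sup>2 * exp (- (\<gamma> * t)) \<le> 2 / \<gamma>\<^sup>2"
    using g by (simp add: exp_minus field_simps)
  then have "pole * (t\<^sup>2 * exp (- (\<gamma> * t))) \<le> pole * (2 / \<gamma>\<^sup>2)"
    using pole_nonneg by (rule mult_left_mono)
  then show ?thesis
    by (simp only: norm_pole_term mult.left_commute)
qed

lemma relaxation_upper_bound: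
  obtains C where "\<And>t. 1 \<le> t \<Longrightarrow> t powr \<alpha> * cmod (relaxation \<alpha> (- \<i>) t) \<le> C"
proof -
  let ?C = "K0 * (LINT v|lborel. exp (\<alpha> * v) * exp (- exp v))"
  have "t powr \<alpha> * cmod (relaxation \<alpha> (- \<i>) t) \<le> pole * (2 / \<gamma>\<^sup>2) + ?C" if t: "1 \<le> t" for t
  proof -
    have "t powr \<alpha> \<le> t powr 2" using t \<alpha> by (intro powr_mono) auto
    then have t2: "t powr \<alpha> \<le> t\<^sup>2" using t by simp
    have "t powr \<alpha> * cmod (of_real pole * exp (of_real t * p0)) \<le> t\<^sup>2 * cmod (of_real pole * exp (of_real t * p0))"
      by (rule mult_right_mono[OF t2]) simp
    also have "\<dots> \<le> pole * (2 / \<gamma>\<^sup>2)"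
      using pole_term_decay[of t] t by (cases "pole = 0") auto
    finally have 1: "t powr \<alpha> * cmod (of_real pole * exp (of_real t * p0)) \<le> pole * (2 / \<gamma>\<^sup>2)" .
    have 2: "t powr \<alpha> * cmod (J t) \<le> ?C" using norm_J_le_powr[of t] t by simp
    have "cmod (relaxation \<alpha> (- \<i>) t) \<le> cmod (of_real pole * exp (of_real t * p0)) + cmod (J t)"
      using relaxation_eq[of t] t by (simp add: norm_triangle_ineq)
    then have "t powr \<alpha> * cmod (relaxation \<alpha> (- \<i>) t) \<le> t powr \<alpha> * (cmod (of_real pole * exp (of_real t * p0)) + cmod (J t))"
      by (rule mult_left_mono) simp
    then show ?thesis using 1 2 by (simp add: distrib_left)
  qed
  then show thesis by (rule that)
qed

text \<open>\<open>Im_J_le\<close> is used at \<open>l = ln t\<close>: then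
  \<open>t * exp (- l) = 1\<close>, \<open>t * exp l = t * t\<close> and
  \<open>X l = t powr \<alpha>\<close>, which exhibits the order of decay.\<close>

lemma relaxation_lower_bound:
  obtains c1 T1 where "0 < c1" "1 \<le> T1" "\<And>t. T1 \<le> t \<Longrightarrow> c1 \<le> t powr \<alpha> * cmod (relaxation \<alpha> (- \<i>) t)"
proof -
  \<comment> \<open>For \<open>t \<ge> 2\<close> the two exponentials are \<open>exp (- 1)\<close>
    and at most \<open>exp (- 4)\<close>; a factor 1/2 comes from
    \<open>Y / (Y\<^sup>2 + 1) \<ge> 1 / (2 * Y)\<close>.\<close>
  define a where "a = s / (4 * pi * \<alpha>) * (exp (- 1) - exp (- 4))"
  have a: "0 < a" using s_pos \<alpha> by (simp add: a_def)
  define P where "P = pole * (2 / \<gamma>\<^sup>2)"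
  have P: "0 \<le> P" using pole_nonneg by (simp add: P_def)
  \<comment> \<open>From \<open>2 * P / a\<close> on, the exponential term multiplied by
    \<open>Y\<close> is at most \<open>P / t\<close> and takes away no more than half of
    \<open>a\<close>.\<close>
  define T1 where "T1 = max 2 (2 * P / a)"
  have "a / 2 \<le> t powr \<alpha> * cmod (relaxation \<alpha> (- \<i>) t)" if t: "T1 \<le> t" for t
  proof -
    have t2: "2 \<le> t" and tP: "2 * P / a \<le> t" using t by (auto simp: T1_def)
    define Y where "Y = t powr \<alpha>"
    have Y: "1 \<le> Y" using t2 \<alpha> by (simp add: Y_def ge_one_powr_ge_zero)
    have Xl: "X (ln t) = Y" using t2 by (simp add: X_def Y_def powr_def)
    have "exp (- 1) - exp (- 4) \<le> exp (- (t * exp (- ln t))) - exp (- (t * exp (ln t)))"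
    proof -
      have "2 * 2 \<le> t * t" using t2 by (intro mult_mono) auto
      then show ?thesis using t2 by (simp add: exp_minus)
    qed
    moreover have "1 / (2 * Y) \<le> Y / (Y\<^sup>2 + 1)"
      using Y by (simp add: field_simps power2_eq_square) (use mult_mono[of 1 Y 1 Y] in simp)
    ultimately have "s / (2 * pi * \<alpha>) * (1 / (2 * Y)) * (exp (- 1) - exp (- 4))
      \<le> s / (2 * pi * \<alpha>) * (Y / (Y\<^sup>2 + 1)) * (exp (- (t * exp (- ln t))) - exp (- (t * exp (ln t))))"
      using s_pos \<alpha> Y by (intro mult_mono mult_left_mono) (auto intro!: mult_nonneg_nonneg)
    also have "\<dots> \<le> - Im (J t)"
      using Im_J_le[of t "ln t"] t2 unfolding Xl by simp
    finally have "Y * (s / (2 * pi * \<alpha>) * (1 / (2 * Y)) * (exp (- 1) - exp (- 4))) \<le> Y * (- Im (J t))"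
      using Y by (intro mult_left_mono) auto
    moreover have "Y * (s / (2 * pi * \<alpha>) * (1 / (2 * Y)) * (exp (- 1) - exp (- 4))) = a"
      using Y by (simp add: a_def)
    ultimately have 1: "a \<le> Y * (- Im (J t))" by simp
    define Z where "Z = of_real pole * exp (of_real t * p0)"
    have "Y \<le> t powr 1" unfolding Y_def using t2 \<alpha> by (intro powr_mono) auto
    then have Yt: "Y \<le> t" using t2 by simp
    have "Y * cmod Z \<le> t * cmod Z" by (rule mult_right_mono[OF Yt]) simp
    also have "\<dots> \<le> P / t"
    proof -
      have "t\<^sup>2 * cmod Z \<le> P"
        using pole_term_decay[of t, folded Z_def P_def] t2 P by (cases "pole = 0") (auto simp: Z_def)
      then show ?thesis using t2 by (simp add: le_divide_eq power2_eq_square mult_ac)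
    qed
    also have "\<dots> \<le> a / 2" using tP t2 a by (simp add: field_simps)
    finally have 2: "Y * cmod Z \<le> a / 2" .
    have "- Im (J t) - cmod Z \<le> cmod (relaxation \<alpha> (- \<i>) t)"
    proof -
      have "- Im (Z + J t) \<le> cmod (Z + J t)" using abs_Im_le_cmod[of "Z + J t"] by linarith
      moreover have "Im Z \<le> cmod Z" using abs_Im_le_cmod[of Z] by linarith
      ultimately show ?thesis using relaxation_eq[of t] t2 by (simp add: Z_def)
    qed
    then have "Y * (- Im (J t) - cmod Z) \<le> Y * cmod (relaxation \<alpha> (- \<i>) t)"
      using Y by (intro mult_left_mono) auto
    then show ?thesis using 1 2 unfolding Y_def[symmetric] by (simp add: right_diff_distrib)
  qed
  moreover have "1 \<le> T1" by (simp add: T1_def)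
  ultimately show thesis using a by (intro that[of "a / 2" T1]) auto
qed

lemma relaxation_nonzero:
  assumes le: "\<alpha> \<le> 3/5" and t: "0 < t"
  shows "relaxation \<alpha> (- \<i>) t \<noteq> 0"
proof -
  have "Im (of_real pole * exp (of_real t * p0)) + Im (J t) < 0"
  \<comment> \<open>In the first case the exponential term is absent or has imaginary part at most
    0, and \<open>Im_J_neg\<close> suffices.\<close>
  proof (cases "pole = 0 \<or> t * sin \<theta> \<le> pi")
    case True
    have "Im (of_real pole * exp (of_real t * p0)) \<le> 0"
    proof (cases "pole = 0")
      case False
      then have "\<theta> < pi" using \<theta>_less \<alpha> by (auto simp: pole_def split: if_splits)
      then have "0 \<le> sin \<theta>" using \<theta>_pos by (intro sin_ge_zero) auto
      then have "0 \<le> sin (t * sin \<theta>)"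
        using True False t by (intro sin_ge_zero[of "t * sin \<theta>"]) auto
      then show ?thesis using pole_nonneg by (simp add: exp_p0)
    qed simp
    then show ?thesis using Im_J_neg[OF t] by linarith
  next
    case False
    then have half: "1/2 < \<alpha>" and pl: "pole = 1 / \<alpha>" and big: "pi < t * sin \<theta>"
      using \<alpha> by (auto simp: pole_def split: if_splits)
    have \<theta>b: "pi - \<theta> \<le> pi / 6" "0 < pi - \<theta>"
      using le half \<theta>_less by (auto simp: \<theta>_def field_simps)
    have "sin \<theta> = sin (pi - \<theta>)" by simp
    also have "\<dots> \<le> sin (pi / 6)" using \<theta>b pi_gt_zero by (intro sin_monotone_2pi_le) auto
    finally have "sin \<theta> \<le> 1/2" by (simp add: sin_30)
    then have "t * sin \<theta> \<le> t * (1/2)" using t by (intro mult_left_mono) auto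
    then have t6: "6 \<le> t" using big pi_ge_3 by linarith
    have sq3: "86/50 \<le> sqrt 3" by (rule real_le_rsqrt) (simp add: power2_eq_square)
    have "cos (pi / 6) \<le> cos (pi - \<theta>)" using \<theta>b pi_gt_zero by (intro cos_monotone_0_pi_le) auto
    then have \<gamma>: "3/4 \<le> \<gamma>" using sq3 by (simp add: cos_30 \<gamma>_def)
    have "sin (pi / 3) \<le> sin (pi - pi * \<alpha>)"
      using le half by (intro sin_monotone_2pi_le) (auto simp: field_simps)
    then have sge: "86/100 \<le> s" using sq3 by (simp add: sin_60 s_def)
    \<comment> \<open>The unit of comparison. \<open>Im_J_le\<close> at \<open>l = ln 8\<close>
      bounds the integral below by a multiple of \<open>z - z ^ 64\<close>, while
      \<open>\<gamma> \<ge> 3/4\<close> bounds the exponential by \<open>z ^ 6\<close>; the surplus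
      factor \<open>z ^ 5\<close> is small because \<open>t \<ge> 6\<close>.\<close>
    define z where "z = exp (- (t / 8))"
    have z0: "0 < z" by (simp add: z_def)
    have zp: "z ^ n = exp (- (real n * t / 8))" for n by (simp add: z_def flip: exp_of_nat_mult)
    have z5: "z ^ 5 \<le> 26/1000"
    proof -
      have "z ^ 5 \<le> exp (- (15/4))" unfolding zp using t6 by simp
      moreover have ge: "385/10 \<le> exp (15/4 :: real)"
      proof -
        \<comment> \<open>The exponent \<open>15/4\<close> is divided by 8, where the quadratic
          Taylor polynomial is accurate enough, and the bound is raised to the eighth power.\<close>
        have "15786/10000 \<le> exp (15/32 :: real)"
          using exp_lower_Taylor_quadratic[of "15/32"] by (simp add: power2_eq_square)
        then have "(15786/10000) ^ 8 \<le> exp (15/32 :: real) ^ 8" by (rule power_mono) simp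
        also have "exp (15/32 :: real) ^ 8 = exp (15/4)" by (simp flip: exp_of_nat_mult)
        finally show ?thesis by (rule order_trans[rotated]) (simp add: power_divide)
      qed
      from ge have "inverse (exp (15/4)) \<le> inverse (385/10 :: real)"
        by (rule le_imp_inverse_le) simp
      then have "exp (- (15/4)) \<le> (26/1000 :: real)"
        unfolding exp_minus by simp
      ultimately show ?thesis by linarith
    qed
    have z64: "z ^ 64 \<le> z * (26/1000)"
    proof -
      have "z \<le> 1" using t by (simp add: z_def)
      then have "z ^ 63 \<le> z ^ 5" using z0 by (intro power_decreasing) auto
      then have "z * z ^ 63 \<le> z * (26/1000)" using z5 z0 by (intro mult_left_mono) auto
      then show ?thesis by (simp flip: power_Suc)
    qed
    define Y where "Y = X (ln 8)"
    have Y1: "1 \<le> Y" using \<alpha> by (simp add: Y_def X_def)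
    have Y: "Y \<le> 7/2"
    proof -
      have "Y \<le> 8 powr (3/5)" using le by (simp add: Y_def X_def powr_def)
      \<comment> \<open>\<open>8 ^ 3 = 512\<close> lies below \<open>(7/2) ^ 5\<close>, which is
        about 525.\<close>
      also have "(8::real) powr (3/5) \<le> 7/2"
      proof (rule power_le_imp_le_base[of _ 4])
        have "((8::real) powr (3/5)) ^ Suc 4 = 8 powr (3/5 * 5)"
          by (simp add: powr_powr flip: powr_realpow)
        also have "\<dots> = 8 ^ 3" by simp
        finally show "((8::real) powr (3/5)) ^ Suc 4 \<le> (7/2) ^ Suc 4" by (simp add: power_divide)
      qed simp
      finally show ?thesis .
    qed
    \<comment> \<open>Another form of \<open>Y + 1 / Y \<le> 7/2 + 2/7 = 53/14\<close>.\<close>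
    have "(Y - 7/2) * (Y - 2/7) \<le> 0" using Y Y1 by (intro mult_nonpos_nonneg) auto
    then have "Y\<^sup>2 + 1 \<le> 53/14 * Y" by (simp add: power2_eq_square algebra_simps)
    then have "264/1000 * (Y\<^sup>2 + 1) \<le> 264/1000 * (53/14 * Y)" by (rule mult_left_mono) simp
    also have "\<dots> = 13992/14000 * Y" by simp
    also have "\<dots> \<le> 1 * Y" using Y1 by (intro mult_right_mono) auto
    finally have "264/1000 * (Y\<^sup>2 + 1) \<le> Y" by simp
    moreover have "0 < Y\<^sup>2 + 1" by (simp add: add_nonneg_pos)
    ultimately have Yq: "264/1000 \<le> Y / (Y\<^sup>2 + 1)"
      by (simp only: pos_le_divide_eq)
    have e8: "exp (- (t * exp (- ln 8))) = z" "exp (- (t * exp (ln 8))) = z ^ 64"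
      unfolding zp by (simp_all add: z_def exp_minus mult.commute)
    have diff: "974/1000 * z \<le> z - z ^ 64" using z64 by simp
    have "86/100 / 8 \<le> s / (2 * pi)"
      using sge pi_less_4 by (intro frac_le) auto
    then have "86/800 * (264/1000) * (974/1000 * z) \<le> s / (2 * pi) * (Y / (Y\<^sup>2 + 1)) * (z - z ^ 64)"
      using Yq diff z0 s_pos Y1 by (intro mult_mono) (auto intro!: mult_nonneg_nonneg divide_nonneg_nonneg)
    also have "\<dots> = \<alpha> * (s / (2 * pi * \<alpha>) * (Y / (Y\<^sup>2 + 1)) * (z - z ^ 64))" using \<alpha> by simp
    also have "\<dots> \<le> \<alpha> * (- Im (J t))"
      using Im_J_le[of t "ln 8"] t \<alpha> unfolding e8 Y_def[symmetric] by (intro mult_left_mono) auto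
    finally have A: "86/800 * (264/1000) * (974/1000 * z) \<le> \<alpha> * (- Im (J t))" .
    have "\<alpha> * Im (of_real pole * exp (of_real t * p0)) = exp (- (\<gamma> * t)) * sin (- (t * sin \<theta>))"
      using \<alpha> by (simp add: exp_p0 pl)
    also have "\<dots> \<le> exp (- (\<gamma> * t)) * 1" by (intro mult_left_mono sin_le_one) simp
    also have "\<dots> \<le> z ^ 6"
    proof -
      have "3/4 * t \<le> \<gamma> * t" using \<gamma> t by (intro mult_right_mono) auto
      then show ?thesis unfolding zp by simp
    qed
    also have "\<dots> = z * z ^ 5" by (simp add: power_Suc[symmetric] del: power_Suc)
    also have "\<dots> \<le> z * (26/1000)" using z5 z0 by (intro mult_left_mono) auto
    \<comment> \<open>The product of constants on the right is about 0.0276, against 0.026 on the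
      left.\<close>
    also have "\<dots> < 86/800 * (264/1000) * (974/1000 * z)" using z0 by simp
    also note A
    finally have "\<alpha> * (Im (of_real pole * exp (of_real t * p0)) + Im (J t)) < 0"
      by (simp add: distrib_left)
    then show ?thesis using \<alpha> by (simp add: mult_less_0_iff)
  qed
  then have "Im (relaxation \<alpha> (- \<i>) t) < 0" using relaxation_eq[OF t] by simp
  then show ?thesis by auto
qed

end

section \<open>The order one half\<close>

lemma mittag_leffler_half_derivative:
  "mittag_leffler' (1/2) z = 2 / of_real (sqrt pi) + 2 * z * mittag_leffler (1/2) z"
proof -
  let ?c = "\<lambda>k. complex_of_real (ml_coeff (1/2) k)"
  have d0: "diffs ?c 0 = 2 / of_real (sqrt pi)"
    using diffs_ml_coeff[of "1/2" 0] by (simp add: Gamma_one_half_real diffs_def)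
  have dS: "diffs ?c (Suc k) = 2 * ?c k" for k
  proof -
    \<comment> \<open>Since \<open>(real k + 2) / 2 = real k / 2 + 1\<close>, the derivative repeats
      the coefficients of the function one place later, up to the factor 2.\<close>
    have "1/2 * diffs (ml_coeff (1/2)) (Suc k) = ml_coeff (1/2) k"
      using diffs_ml_coeff[of "1/2" "Suc k"] by (simp add: ml_coeff_def add_divide_distrib add.commute)
    then have "diffs (ml_coeff (1/2)) (Suc k) = 2 * ml_coeff (1/2) k" by simp
    moreover have "diffs ?c (Suc k) = of_real (diffs (ml_coeff (1/2)) (Suc k))" by (simp add: diffs_def)
    ultimately show ?thesis by simp
  qed
  have "summable (\<lambda>k. diffs ?c k * z ^ k)"
    by (rule termdiff_converges_all[OF summable_norm_cancel[OF summable_norm_ml_coeff]]) simp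
  then have "mittag_leffler' (1/2) z = diffs ?c 0 * z ^ 0 + (\<Sum>k. diffs ?c (Suc k) * z ^ Suc k)"
    unfolding mittag_leffler'_def by (subst suminf_split_head) simp_all
  also have "(\<Sum>k. diffs ?c (Suc k) * z ^ Suc k) = (\<Sum>k. (2 * z) * (?c k * z ^ k))"
    by (simp add: dS mult_ac)
  also have "\<dots> = 2 * z * mittag_leffler (1/2) z"
    using sums_mult[OF mittag_leffler_sums[of "1/2" z], of "2 * z"] by (simp add: sums_iff)
  finally show ?thesis by (simp add: d0)
qed

text \<open>For \<open>\<alpha> = 1/2\<close> the pole lies on the cut and the contour argument fails, but
  \<open>exp (y\<^sup>2) * mittag_leffler (1/2) (- \<i> y)\<close> has the elementary derivative \<open>- 2 \<i> exp (y\<^sup>2) / sqrt pi\<close>.\<close>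

lemma mittag_leffler_half_bounds:
  assumes y: "0 < y"
  shows "Re (mittag_leffler (1/2) (- \<i> * of_real y)) = exp (- y\<^sup>2)"
    and "(1 - exp (- y\<^sup>2)) / (sqrt pi * y) \<le> - Im (mittag_leffler (1/2) (- \<i> * of_real y))"
    and "- Im (mittag_leffler (1/2) (- \<i> * of_real y)) \<le> 2 / (sqrt pi * y)"
proof -
  define f where "f t = mittag_leffler (1/2) (- \<i> * of_real t)" for t
  define v where "v t = of_real (exp (t\<^sup>2)) * f t" for t
  define \<kappa> where "\<kappa> = 2 / sqrt pi"
  have \<kappa>: "0 < \<kappa>" by (simp add: \<kappa>_def)
  have v': "(v has_vector_derivative Complex 0 (- (\<kappa> * exp (t\<^sup>2)))) (at t within S)" for t S
  proof -
    have "((\<lambda>t. - \<i> * complex_of_real t) has_vector_derivative - \<i> * of_real 1) (at t)"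
      by (intro has_vector_derivative_mult_right has_vector_derivative_of_real DERIV_ident)
    from field_vector_diff_chain_at[OF this mittag_leffler_has_derivative[of "1/2"]]
    have "(f has_vector_derivative (- \<i> * of_real 1 * mittag_leffler' (1/2) (- \<i> * of_real t))) (at t)"
      by (simp add: f_def [abs_def] o_def)
    then have "(f has_vector_derivative (- \<i> * of_real \<kappa> - of_real (2 * t) * f t)) (at t)"
      unfolding mittag_leffler_half_derivative f_def[symmetric]
      by (simp add: \<kappa>_def algebra_simps)
    moreover have "((\<lambda>t. complex_of_real (exp (t\<^sup>2))) has_vector_derivative of_real (exp (t\<^sup>2) * (2 * t))) (at t)"
      by (intro has_vector_derivative_of_real)
         (auto intro!: derivative_eq_intros simp flip: has_real_derivative_iff_has_vector_derivative)
    ultimately have "(v has_vector_derivative (of_real (exp (t\<^sup>2)) * (- \<i> * of_real \<kappa> - of_real (2 * t) * f t)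
        + of_real (exp (t\<^sup>2) * (2 * t)) * f t)) (at t)"
      unfolding v_def [abs_def] by (rule has_vector_derivative_mult[rotated])
    moreover have "of_real (exp (t\<^sup>2)) * (- \<i> * of_real \<kappa> - of_real (2 * t) * f t)
        + of_real (exp (t\<^sup>2) * (2 * t)) * f t = Complex 0 (- (\<kappa> * exp (t\<^sup>2)))"
      by (simp add: complex_eq_iff algebra_simps)
    ultimately show ?thesis by (metis has_vector_derivative_at_within)
  qed
  have Im': "((\<lambda>t. Im (v t)) has_real_derivative - (\<kappa> * exp (t\<^sup>2))) (at t)" for t
    using bounded_linear.has_vector_derivative[OF bounded_linear_Im v'[of t UNIV]]
    by (simp add: has_real_derivative_iff_has_vector_derivative)
  have Re': "((\<lambda>t. Re (v t)) has_real_derivative 0) (at t)" for t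
    using bounded_linear.has_vector_derivative[OF bounded_linear_Re v'[of t UNIV]]
    by (simp add: has_real_derivative_iff_has_vector_derivative)
  have v0: "v 0 = 1" by (simp add: v_def f_def)
  have fv: "f y = of_real (exp (- y\<^sup>2)) * v y"
    by (simp add: v_def mult.assoc[symmetric] exp_minus)
  \<comment> \<open>The derivative of \<open>v\<close> is purely imaginary, so its real part keeps
    the initial value 1.\<close>
  have "Re (v y) = Re (v 0)" by (rule DERIV_isconst_all) (simp add: Re')
  then show "Re (mittag_leffler (1/2) (- \<i> * of_real y)) = exp (- y\<^sup>2)"
    unfolding f_def[symmetric] fv v0 by simp
  have lower: "\<kappa> * (exp (y\<^sup>2) - 1) / (2 * y) \<le> - Im (v y)"
  proof -
    \<comment> \<open>Integrates \<open>exp (t\<^sup>2) \<ge> (t / y) * exp (t\<^sup>2)\<close> for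
      \<open>t \<le> y\<close>, whose right side has an elementary primitive.\<close>
    let ?w = "\<lambda>t. - Im (v t) - \<kappa> * (exp (t\<^sup>2) - 1) / (2 * y)"
    have "?w 0 \<le> ?w y"
    proof (rule DERIV_nonneg_imp_nondecreasing[OF less_imp_le[OF y]])
      fix t assume t: "0 \<le> t" "t \<le> y"
      have "(?w has_real_derivative (\<kappa> * exp (t\<^sup>2) - \<kappa> * (exp (t\<^sup>2) * (2 * t)) / (2 * y))) (at t)"
      proof -
        have "((\<lambda>t. \<kappa> * (exp (t\<^sup>2) - 1) / (2 * y)) has_real_derivative \<kappa> * (exp (t\<^sup>2) * (2 * t)) / (2 * y)) (at t)"
          using y by (auto intro!: derivative_eq_intros)
        from DERIV_diff[OF DERIV_minus[OF Im'[of t]] this] show ?thesis by (simp only: minus_minus)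
      qed
      moreover have "\<kappa> * exp (t\<^sup>2) - \<kappa> * (exp (t\<^sup>2) * (2 * t)) / (2 * y) = \<kappa> * exp (t\<^sup>2) * (1 - t / y)"
        using y by (simp add: field_simps)
      moreover have "0 \<le> \<kappa> * exp (t\<^sup>2) * (1 - t / y)" using \<kappa> t y by simp
      ultimately show "\<exists>d. (?w has_real_derivative d) (at t) \<and> 0 \<le> d" by auto
    qed
    then show ?thesis by (simp add: v0)
  qed
  have upper: "- Im (v y) \<le> \<kappa> * (exp (y\<^sup>2) - 1) / y"
  proof -
    \<comment> \<open>Integrates \<open>exp (t\<^sup>2) \<le> exp (y * t)\<close> for
      \<open>t \<le> y\<close>.\<close>
    let ?w = "\<lambda>t. \<kappa> * (exp (y * t) - 1) / y + Im (v t)"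
    have "?w 0 \<le> ?w y"
    proof (rule DERIV_nonneg_imp_nondecreasing[OF less_imp_le[OF y]])
      fix t assume t: "0 \<le> t" "t \<le> y"
      have "(?w has_real_derivative (\<kappa> * (exp (y * t) * y) / y + - (\<kappa> * exp (t\<^sup>2)))) (at t)"
      proof (rule DERIV_add[OF _ Im'])
        show "((\<lambda>t. \<kappa> * (exp (y * t) - 1) / y) has_real_derivative \<kappa> * (exp (y * t) * y) / y) (at t)"
          using y by (auto intro!: derivative_eq_intros)
      qed
      moreover have "\<kappa> * (exp (y * t) * y) / y + - (\<kappa> * exp (t\<^sup>2)) = \<kappa> * (exp (y * t) - exp (t\<^sup>2))"
        using y by (simp add: algebra_simps)
      moreover have "0 \<le> \<kappa> * (exp (y * t) - exp (t\<^sup>2))"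
        using \<kappa> t by (simp add: power2_eq_square mult_right_mono)
      ultimately show "\<exists>d. (?w has_real_derivative d) (at t) \<and> 0 \<le> d" by auto
    qed
    then show ?thesis by (simp add: v0 power2_eq_square)
  qed
  have Imf: "- Im (f y) = exp (- y\<^sup>2) * (- Im (v y))" unfolding fv by simp
  have ee: "exp (- y\<^sup>2) * (exp (y\<^sup>2) - 1) = 1 - exp (- y\<^sup>2)"
    by (simp add: right_diff_distrib exp_minus)
  have "exp (- y\<^sup>2) * (\<kappa> * (exp (y\<^sup>2) - 1) / (2 * y)) \<le> - Im (f y)"
    unfolding Imf by (rule mult_left_mono[OF lower]) simp
  moreover have "exp (- y\<^sup>2) * (\<kappa> * (exp (y\<^sup>2) - 1) / (2 * y)) = \<kappa> / (2 * y) * (exp (- y\<^sup>2) * (exp (y\<^sup>2) - 1))"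
    by simp
  ultimately show "(1 - exp (- y\<^sup>2)) / (sqrt pi * y) \<le> - Im (mittag_leffler (1/2) (- \<i> * of_real y))"
    unfolding ee f_def[symmetric] by (simp add: \<kappa>_def)
  have "- Im (f y) \<le> exp (- y\<^sup>2) * (\<kappa> * (exp (y\<^sup>2) - 1) / y)"
    unfolding Imf by (rule mult_left_mono[OF upper]) simp
  also have "\<dots> = \<kappa> / y * (exp (- y\<^sup>2) * (exp (y\<^sup>2) - 1))" by simp
  also have "\<dots> \<le> \<kappa> / y * 1" unfolding ee using \<kappa> y by (intro mult_left_mono) auto
  finally show "- Im (mittag_leffler (1/2) (- \<i> * of_real y)) \<le> 2 / (sqrt pi * y)"
    unfolding f_def[symmetric] by (simp add: \<kappa>_def)
qed

section \<open>Bounds for all orders on the negative imaginary axis\<close>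

lemma mittag_leffler_imaginary_eq_relaxation:
  assumes "0 < \<alpha>" "0 \<le> y"
  shows "mittag_leffler \<alpha> (- \<i> * of_real y) = relaxation \<alpha> (- \<i>) (y powr (1 / \<alpha>))"
  using assms by (simp add: relaxation_def powr_powr)

text \<open>For \<open>y \<ge> 1\<close> the weighted estimate comes from the representation, or
  from the explicit bounds at order 1/2, and it implies the unweighted one; on \<open>{0..1}\<close>
  compactness gives both.\<close>

lemma mittag_leffler_imaginary_upper:
  assumes \<alpha>: "0 < \<alpha>" "\<alpha> < 1"
  obtains C where "0 < C" "\<And>y. 0 \<le> y \<Longrightarrow> cmod (mittag_leffler \<alpha> (- \<i> * of_real y)) \<le> C"
    "\<And>y. 0 \<le> y \<Longrightarrow> y * cmod (mittag_leffler \<alpha> (- \<i> * of_real y)) \<le> C"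
proof -
  let ?E = "\<lambda>y. cmod (mittag_leffler \<alpha> (- \<i> * of_real y))"
  have "\<exists>C. \<forall>y\<ge>1. y * ?E y \<le> C"
  proof (cases "\<alpha> = 1/2")
    case True
    have "y * ?E y \<le> 1 + 2 / sqrt pi" if y: "1 \<le> y" for y
    proof -
      have y0: "0 < y" using y by simp
      note b = mittag_leffler_half_bounds[OF y0, folded True]
      have "0 \<le> (1 - exp (- y\<^sup>2)) / (sqrt pi * y)" using y0 by simp
      then have Im: "\<bar>Im (mittag_leffler \<alpha> (- \<i> * of_real y))\<bar> \<le> 2 / (sqrt pi * y)"
        using b by linarith
      have Re: "\<bar>Re (mittag_leffler \<alpha> (- \<i> * of_real y))\<bar> \<le> 1 / y"
      proof -
        have "y * 1 \<le> y\<^sup>2" using y by (simp add: power2_eq_square)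
        then have "y \<le> exp (y\<^sup>2)" using exp_ge_add_one_self[of "y\<^sup>2"] by linarith
        then show ?thesis unfolding b(1) using y0 by (simp add: exp_minus field_simps)
      qed
      have "?E y \<le> 1 / y + 2 / (sqrt pi * y)"
        using cmod_le[of "mittag_leffler \<alpha> (- \<i> * of_real y)"] Im Re by linarith
      then have "y * ?E y \<le> y * (1 / y + 2 / (sqrt pi * y))" using y0 by (intro mult_left_mono) auto
      also have "\<dots> = 1 + 2 / sqrt pi" using y0 by (simp add: field_simps)
      finally show ?thesis .
    qed
    then show ?thesis by blast
  next
    case False
    then interpret relaxation_contour \<alpha> by unfold_locales (use \<alpha> in auto)
    obtain C where C: "\<And>t. 1 \<le> t \<Longrightarrow> t powr \<alpha> * cmod (relaxation \<alpha> (- \<i>) t) \<le> C"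
      using relaxation_upper_bound by blast
    have "y * ?E y \<le> C" if y: "1 \<le> y" for y
    proof -
      have "mittag_leffler \<alpha> (- \<i> * of_real y) = relaxation \<alpha> (- \<i>) (y powr (1 / \<alpha>))"
        by (rule mittag_leffler_imaginary_eq_relaxation) (use y \<alpha> in auto)
      then show ?thesis
        proof (simp only:)
        show "y * cmod (relaxation \<alpha> (- \<i>) (y powr (1 / \<alpha>))) \<le> C"
          using C[of "y powr (1 / \<alpha>)"] y \<alpha> by (simp add: ge_one_powr_ge_zero powr_powr)
      qed
    qed
    then show ?thesis by blast
  qed
  then obtain C where C: "\<And>y. 1 \<le> y \<Longrightarrow> y * ?E y \<le> C" by blast
  have "continuous_on {0..1} (\<lambda>y. mittag_leffler \<alpha> (- \<i> * of_real y))"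
    by (intro continuous_on_compose2[OF continuous_on_mittag_leffler[OF \<alpha>(1), of UNIV]] continuous_intros) auto
  then have "bounded ((\<lambda>y. mittag_leffler \<alpha> (- \<i> * of_real y)) ` {0..1})"
    by (intro compact_imp_bounded compact_continuous_image) auto
  then obtain B where B: "\<forall>y\<in>{0..1}. ?E y \<le> B" by (auto simp: bounded_iff)
  define M where "M = max 1 (max B C)"
  have M: "B \<le> M" "C \<le> M" "0 < M" by (auto simp: M_def)
  have 1: "?E y \<le> M" if "0 \<le> y" for y
  proof (cases "y \<le> 1")
    case True
    then have "?E y \<le> B" using B that by simp
    then show ?thesis using M by simp
  next
    case False
    then have "1 * ?E y \<le> y * ?E y" by (intro mult_right_mono) auto
    then show ?thesis using C[of y] M False by simp
  qed
  have 2: "y * ?E y \<le> M" if "0 \<le> y" for y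
  proof (cases "y \<le> 1")
    case True
    then have "y * ?E y \<le> 1 * ?E y" by (intro mult_right_mono) auto
    then show ?thesis using 1[OF that] by simp
  next
    case False
    then show ?thesis using C[of y] M by simp
  qed
  show thesis by (rule that[OF M(3) 1 2])
qed

lemma mittag_leffler_imaginary_lower:
  assumes \<alpha>: "0 < \<alpha>" "\<alpha> < 1"
  obtains c1 y1 where "0 < c1" "0 < y1" "\<And>y. y1 \<le> y \<Longrightarrow> c1 \<le> y * cmod (mittag_leffler \<alpha> (- \<i> * of_real y))"
proof (cases "\<alpha> = 1/2")
  case True
  have "(1 - exp (- 1)) / sqrt pi \<le> y * cmod (mittag_leffler \<alpha> (- \<i> * of_real y))" if y: "1 \<le> y" for y
  proof -
    have y0: "0 < y" using y by simp
    have "1 \<le> y\<^sup>2" using y by simp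
    then have "1 - exp (- 1) \<le> 1 - exp (- y\<^sup>2)" by simp
    then have "(1 - exp (- 1)) / sqrt pi \<le> (1 - exp (- y\<^sup>2)) / sqrt pi"
      by (intro divide_right_mono) auto
    also have "\<dots> = y * ((1 - exp (- y\<^sup>2)) / (sqrt pi * y))" using y0 by simp
    also have "\<dots> \<le> y * (- Im (mittag_leffler \<alpha> (- \<i> * of_real y)))"
      using mittag_leffler_half_bounds(2)[OF y0, folded True] y0 by (intro mult_left_mono) auto
    also have "\<dots> \<le> y * cmod (mittag_leffler \<alpha> (- \<i> * of_real y))"
      using abs_Im_le_cmod[of "mittag_leffler \<alpha> (- \<i> * of_real y)"] y0
      by (intro mult_left_mono) linarith+
    finally show ?thesis .
  qed
  moreover have "0 < (1 - exp (- 1)) / sqrt pi" by simp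
  ultimately show thesis by (intro that[of "(1 - exp (- 1)) / sqrt pi" 1]) auto
next
  case False
  then interpret relaxation_contour \<alpha> by unfold_locales (use \<alpha> in auto)
  obtain c1 T1 where c: "0 < c1" "1 \<le> T1" and b: "\<And>t. T1 \<le> t \<Longrightarrow> c1 \<le> t powr \<alpha> * cmod (relaxation \<alpha> (- \<i>) t)"
    using relaxation_lower_bound by blast
  have "c1 \<le> y * cmod (mittag_leffler \<alpha> (- \<i> * of_real y))" if y: "T1 powr \<alpha> \<le> y" for y
  proof -
    have y0: "0 < y" using y c by (smt (verit) powr_gt_zero)
    have "(T1 powr \<alpha>) powr (1 / \<alpha>) \<le> y powr (1 / \<alpha>)"
      using y \<alpha> by (intro powr_mono2) auto
    then have "T1 \<le> y powr (1 / \<alpha>)" using c \<alpha> by (simp add: powr_powr)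
    from b[OF this] have "c1 \<le> y * cmod (relaxation \<alpha> (- \<i>) (y powr (1 / \<alpha>)))"
      using y0 \<alpha> by (simp add: powr_powr)
    moreover have "mittag_leffler \<alpha> (- \<i> * of_real y) = relaxation \<alpha> (- \<i>) (y powr (1 / \<alpha>))"
      by (rule mittag_leffler_imaginary_eq_relaxation) (use y0 \<alpha> in auto)
    ultimately show ?thesis by (simp only:)
  qed
  then show thesis using c by (intro that[of c1 "T1 powr \<alpha>"]) auto
qed

lemma mittag_leffler_imaginary_nonzero:
  assumes \<alpha>: "0 < \<alpha>" "\<alpha> \<le> 3/5" and y: "0 < y"
  shows "mittag_leffler \<alpha> (- \<i> * of_real y) \<noteq> 0"
proof (cases "\<alpha> = 1/2")
  case True
  have "Re (mittag_leffler \<alpha> (- \<i> * of_real y)) = exp (- y\<^sup>2)"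
    by (rule mittag_leffler_half_bounds(1)[OF y, folded True])
  then show ?thesis by auto
next
  case False
  then interpret relaxation_contour \<alpha> by unfold_locales (use \<alpha> in auto)
  show ?thesis
  proof -
    have "mittag_leffler \<alpha> (- \<i> * of_real y) = relaxation \<alpha> (- \<i>) (y powr (1 / \<alpha>))"
      by (rule mittag_leffler_imaginary_eq_relaxation) (use y \<alpha> in auto)
    then show ?thesis using relaxation_nonzero[OF assms(2), of "y powr (1 / \<alpha>)"] y by simp
  qed
qed

section \<open>The time-fractional Schroedinger equation\<close>

lemma absolutely_continuous_on_cmult:
  assumes ac: "absolutely_continuous_on x y g" and f: "\<And>t. t \<in> {x..y} \<Longrightarrow> f t = c * g t"
  shows "absolutely_continuous_on x y f"
  unfolding absolutely_continuous_on_def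
proof (intro allI impI)
  fix \<epsilon> :: real assume \<epsilon>: "0 < \<epsilon>"
  then have \<epsilon>': "0 < \<epsilon> / (cmod c + 1)" by (simp add: add_nonneg_pos)
  obtain d where d: "0 < d" "\<forall>(n::nat) a b.
        (\<forall>i<n. x \<le> a i \<and> a i \<le> b i \<and> b i \<le> y) \<longrightarrow>
        (\<forall>i<n. \<forall>j<n. i \<noteq> j \<longrightarrow> {a i<..<b i} \<inter> {a j<..<b j} = {}) \<longrightarrow>
        (\<Sum>i<n. b i - a i) < d \<longrightarrow> (\<Sum>i<n. cmod (g (b i) - g (a i))) < \<epsilon> / (cmod c + 1)"
    using ac \<epsilon>' unfolding absolutely_continuous_on_def by blast
  show "\<exists>d>0. \<forall>(n::nat) a b.
        (\<forall>i<n. x \<le> a i \<and> a i \<le> b i \<and> b i \<le> y) \<longrightarrow>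
        (\<forall>i<n. \<forall>j<n. i \<noteq> j \<longrightarrow> {a i<..<b i} \<inter> {a j<..<b j} = {}) \<longrightarrow>
        (\<Sum>i<n. b i - a i) < d \<longrightarrow> (\<Sum>i<n. cmod (f (b i) - f (a i))) < \<epsilon>"
  proof (intro exI[of _ d] conjI allI impI d(1))
    fix n :: nat and a b :: "nat \<Rightarrow> real"
    assume ab: "\<forall>i<n. x \<le> a i \<and> a i \<le> b i \<and> b i \<le> y"
      and *: "\<forall>i<n. \<forall>j<n. i \<noteq> j \<longrightarrow> {a i<..<b i} \<inter> {a j<..<b j} = {}" "(\<Sum>i<n. b i - a i) < d"
    from d(2)[THEN spec, THEN spec, THEN spec, THEN mp, THEN mp, THEN mp, OF ab *]
    have less: "(\<Sum>i<n. cmod (g (b i) - g (a i))) < \<epsilon> / (cmod c + 1)" .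
    have "(\<Sum>i<n. cmod (f (b i) - f (a i))) = (\<Sum>i<n. cmod c * cmod (g (b i) - g (a i)))"
    proof (rule sum.cong[OF refl])
      fix i assume "i \<in> {..<n}"
      then have "f (b i) = c * g (b i)" "f (a i) = c * g (a i)" using ab by (auto intro!: f intro: order_trans)
      then show "cmod (f (b i) - f (a i)) = cmod c * cmod (g (b i) - g (a i))"
        by (simp flip: right_diff_distrib norm_mult)
    qed
    also have "\<dots> = cmod c * (\<Sum>i<n. cmod (g (b i) - g (a i)))"
      by (rule sum_distrib_left[symmetric])
    also have "\<dots> \<le> (cmod c + 1) * (\<Sum>i<n. cmod (g (b i) - g (a i)))"
      by (intro mult_right_mono sum_nonneg) auto
    also have "\<dots> < (cmod c + 1) * (\<epsilon> / (cmod c + 1))"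
      using less by (intro mult_strict_left_mono) (auto simp: add_nonneg_pos)
    also have "\<dots> = \<epsilon>"
    proof -
      have "cmod c + 1 \<noteq> 0" using norm_ge_zero[of c] by linarith
      then show ?thesis by simp
    qed
    finally show "(\<Sum>i<n. cmod (f (b i) - f (a i))) < \<epsilon>" .
  qed
qed

lemma has_caputo_cmult:
  assumes g: "has_caputo \<alpha> g d t" and diff: "\<And>s. 0 < s \<Longrightarrow> g differentiable (at s)"
    and f: "\<And>s. 0 < s \<Longrightarrow> f s = c * g s"
  shows "has_caputo \<alpha> f (c * d) t"
proof -
  have fd: "(f has_vector_derivative c * vector_derivative g (at s)) (at s)" if s: "0 < s" for s
  proof (rule has_vector_derivative_transform_within_open)
    show "((\<lambda>s. c * g s) has_vector_derivative c * vector_derivative g (at s)) (at s)"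
      using diff[OF s] by (intro has_vector_derivative_mult_right) (simp add: vector_derivative_works)
    show "c * g r = f r" if "r \<in> {0<..}" for r using f that by simp
  qed (use s in auto)
  have eq: "(t - s) powr (- \<alpha>) *\<^sub>R vector_derivative f (at s)
      = c * ((t - s) powr (- \<alpha>) *\<^sub>R vector_derivative g (at s))" if "s \<in> {0<..<t}" for s
    using vector_derivative_at[OF fd[of s]] that by simp
  have "AE s in lebesgue. s \<in> {0<..<t} \<longrightarrow> f differentiable (at s)"
    using fd by (intro AE_I2) (auto intro: differentiableI_vector)
  moreover have "set_integrable lebesgue {0<..<t} (\<lambda>s. (t - s) powr (- \<alpha>) *\<^sub>R vector_derivative f (at s))"
  proof -
    have "set_integrable lebesgue {0<..<t} (\<lambda>s. c * ((t - s) powr (- \<alpha>) *\<^sub>R vector_derivative g (at s)))"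
      using g by (intro set_integrable_mult_right) (simp add: has_caputo_def)
    then show ?thesis by (subst set_integrable_cong[OF refl refl eq]) auto
  qed
  moreover have "(LINT s:{0<..<t}|lebesgue. (t - s) powr (- \<alpha>) *\<^sub>R vector_derivative f (at s))
      = c * (LINT s:{0<..<t}|lebesgue. (t - s) powr (- \<alpha>) *\<^sub>R vector_derivative g (at s))"
  proof -
    have "(LINT s:{0<..<t}|lebesgue. (t - s) powr (- \<alpha>) *\<^sub>R vector_derivative f (at s))
      = (LINT s:{0<..<t}|lebesgue. c * ((t - s) powr (- \<alpha>) *\<^sub>R vector_derivative g (at s)))"
      by (rule set_lebesgue_integral_cong) (use eq in auto)
    then show ?thesis by (simp only: set_integral_mult_right)
  qed
  ultimately show ?thesis using g by (simp add: has_caputo_def)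
qed

lemma exists_positive_lower_bound:
  fixes f :: "nat \<Rightarrow> real"
  assumes "\<And>n. 0 < f n" shows "\<exists>c>0. \<forall>n<N. c \<le> f n"
proof (induction N)
  case 0 then show ?case by (intro exI[of _ 1]) simp
next
  case (Suc N)
  then obtain c where "c > 0" "\<forall>n<N. c \<le> f n" by blast
  then show ?case using assms[of N]
    by (intro exI[of _ "min c (f N)"]) (auto simp: less_Suc_eq min_le_iff_disj)
qed

section \<open>The solution operator\<close>

locale fractional_schroedinger = spectral_operator \<phi> D A lam
  for \<phi> :: "nat \<Rightarrow> 'a::complex_hilbert_space" and D A lam +
  fixes \<alpha> :: real
  assumes \<alpha>: "0 < \<alpha>" "\<alpha> < 1"
begin

definition e :: "nat \<Rightarrow> real \<Rightarrow> complex" where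
  "e n = relaxation \<alpha> (- \<i> * of_real (lam n))"

definition sol :: "'a \<Rightarrow> real \<Rightarrow> 'a" where
  "sol u0 t = synth (\<lambda>n. cinner u0 (\<phi> n) * e n t)"

lemma e_eq: "e n t = mittag_leffler \<alpha> (- \<i> * of_real (lam n * t powr \<alpha>))"
  by (simp add: e_def relaxation_def mult.assoc)

lemma e_0: "e n 0 = 1" by (simp add: e_def)

text \<open>Both bounds come from \<open>y = lam n * t powr \<alpha>\<close>. The second is the
  smoothing effect: for \<open>t > 0\<close> initial data in H are carried into
  \<open>Hs lam \<phi> 1\<close>, with norm of order \<open>t powr (- \<alpha>)\<close>.\<close>

lemma e_bounds:
  obtains C where "0 < C" "\<And>n t. cmod (e n t) \<le> C" "\<And>n t. 0 < t \<Longrightarrow> lam n * cmod (e n t) \<le> C * t powr (- \<alpha>)"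
proof -
  obtain C where C: "0 < C" "\<And>y. 0 \<le> y \<Longrightarrow> cmod (mittag_leffler \<alpha> (- \<i> * of_real y)) \<le> C"
    "\<And>y. 0 \<le> y \<Longrightarrow> y * cmod (mittag_leffler \<alpha> (- \<i> * of_real y)) \<le> C"
    using mittag_leffler_imaginary_upper[OF \<alpha>] by blast
  have nn: "0 \<le> lam n * t powr \<alpha>" for n t using lam_pos[of n] by simp
  have "cmod (e n t) \<le> C" for n t unfolding e_eq by (rule C(2)[OF nn])
  moreover have "lam n * cmod (e n t) \<le> C * t powr (- \<alpha>)" if "0 < t" for n t
    using C(3)[OF nn[of n t]] that unfolding e_eq by (simp add: powr_minus field_simps)
  ultimately show thesis using that C(1) by blast
qed

text \<open>Continuity of the coefficient functional; convergence of the series stands in for the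
  square summability asked for in \<open>coef_synth\<close>.\<close>

lemma coef_sums: "(\<lambda>n. d n *\<^sub>C \<phi> n) sums w \<Longrightarrow> cinner w (\<phi> m) = d m"
proof -
  assume "(\<lambda>n. d n *\<^sub>C \<phi> n) sums w"
  then have "(\<lambda>n. cinner (d n *\<^sub>C \<phi> n) (\<phi> m)) sums cinner w (\<phi> m)"
    by (rule bounded_linear.sums[OF bounded_linear_cinner_left])
  then have "(\<lambda>n. if n = m then d n else 0) sums cinner w (\<phi> m)"
    by (simp add: cinner_scaleC_left cinner_basis if_distrib[of "(*) _"] cong: if_cong)
  then show ?thesis using sums_single[of m d] sums_unique2 by blast
qed

lemma weak_solution_initial:
  assumes ws: "weak_solution \<alpha> D A \<phi> T u0 u" and T: "0 < T"
  shows "u 0 = u0"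
proof -
  have "(u \<longlongrightarrow> u 0) (at 0 within {0..T})"
    using ws T by (auto simp: weak_solution_def continuous_on_def)
  then have "(u \<longlongrightarrow> u 0) (at_right 0)" using T by (simp add: at_within_Icc_at_right)
  moreover have "(u \<longlongrightarrow> u0) (at_right 0)"
  proof -
    have "((\<lambda>t. norm (u t - u0)) \<longlongrightarrow> 0) (at_right 0)" using ws by (simp add: weak_solution_def)
    then show ?thesis by (simp only: tendsto_norm_zero_iff LIM_zero_iff)
  qed
  ultimately show ?thesis using tendsto_unique trivial_limit_at_right_real by blast
qed

lemma e_differentiable: "0 < s \<Longrightarrow> e n differentiable (at s)"
  unfolding e_def using relaxation_has_vector_derivative[OF \<alpha>(1)] by (rule differentiableI_vector)

lemma weak_solution_coef:
  assumes ws: "weak_solution \<alpha> D A \<phi> T u0 u" and T: "0 < T" and t: "t \<in> {0..T}"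
  shows "cinner (u t) (\<phi> n) = cinner u0 (\<phi> n) * e n t"
proof -
  let ?f = "\<lambda>s. cinner (u s) (\<phi> n)"
  let ?g = "\<lambda>s. cinner u0 (\<phi> n) * e n s"
  let ?\<mu> = "- \<i> * of_real (lam n)"
  show ?thesis
  proof (rule caputo_equation_unique[OF \<alpha>, of T ?f ?\<mu> ?g])
    show "absolutely_continuous_on 0 T ?f" using ws by (simp add: weak_solution_def)
    show "absolutely_continuous_on 0 T ?g"
      by (rule absolutely_continuous_on_cmult[where c = "cinner u0 (\<phi> n)",
            OF absolutely_continuous_on_relaxation[OF \<alpha>, of T ?\<mu>]])
         (simp add: e_def)
    have "AE t in lebesgue. t \<in> {0<..<T} \<longrightarrow>
        u t \<in> D \<and> (\<exists>w. has_caputo_H \<alpha> \<phi> u w t \<and> \<i> *\<^sub>C w + A (u t) = 0)"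
      using ws by (simp add: weak_solution_def)
    then show "AE t in lebesgue. t \<in> {0<..<T} \<longrightarrow> has_caputo \<alpha> ?f (?\<mu> * ?f t) t"
    proof (elim AE_mp, intro AE_I2 impI)
      fix t assume *: "t \<in> {0<..<T} \<longrightarrow> u t \<in> D \<and> (\<exists>w. has_caputo_H \<alpha> \<phi> u w t \<and> \<i> *\<^sub>C w + A (u t) = 0)"
        and t: "t \<in> {0<..<T}"
      then obtain w d where D: "u t \<in> D" and d: "\<And>n. has_caputo \<alpha> (\<lambda>s. cinner (u s) (\<phi> n)) (d n) t"
        and s: "(\<lambda>n. d n *\<^sub>C \<phi> n) sums w" and w: "\<i> *\<^sub>C w + A (u t) = 0"
        unfolding has_caputo_H_def by blast
      have "cinner (\<i> *\<^sub>C w + A (u t)) (\<phi> n) = 0" unfolding w by simp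
      then have "\<i> * d n = of_real (lam n) * ?f t"
        by (simp add: cinner_add_left cinner_scaleC_left coef_sums[OF s] coef_A[OF D])
      then have "- \<i> * (\<i> * d n) = - \<i> * (of_real (lam n) * ?f t)" by (rule arg_cong)
      then have "d n = ?\<mu> * ?f t" by (simp add: mult.assoc[symmetric])
      then show "has_caputo \<alpha> ?f (?\<mu> * ?f t) t" using d[of n] by simp
    qed
    show "AE t in lebesgue. t \<in> {0<..<T} \<longrightarrow> has_caputo \<alpha> ?g (?\<mu> * ?g t) t"
    proof (rule AE_I2, rule impI)
      fix t assume "t \<in> {0<..<T}"
      then have "has_caputo \<alpha> (e n) (?\<mu> * e n t) t"
        unfolding e_def by (intro has_caputo_relaxation \<alpha>) auto
      from has_caputo_cmult[OF this e_differentiable, of ?g "cinner u0 (\<phi> n)"]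
      show "has_caputo \<alpha> ?g (?\<mu> * ?g t) t" by (simp add: mult_ac)
    qed
    show "?f 0 = ?g 0" using weak_solution_initial[OF ws T] by (simp add: e_0)
  qed (rule t)
qed

lemma square_summable_e: "square_summable (\<lambda>n. cinner u0 (\<phi> n) * e n t)"
proof -
  obtain C where C: "\<And>n t. cmod (e n t) \<le> C" using e_bounds by metis
  show ?thesis
  proof (rule square_summable_comparison[OF square_summable_coef[of u0], of _ C])
    show "cmod (cinner u0 (\<phi> n) * e n t) \<le> C * cmod (cinner u0 (\<phi> n))" for n
      unfolding norm_mult mult.commute[of C] by (rule mult_left_mono[OF C norm_ge_zero])
  qed
qed

lemma coef_sol: "cinner (sol u0 t) (\<phi> n) = cinner u0 (\<phi> n) * e n t"
  unfolding sol_def by (rule coef_synth[OF square_summable_e])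

lemma weak_solution_eq_sol:
  assumes "weak_solution \<alpha> D A \<phi> T u0 u" "0 < T" "t \<in> {0..T}"
  shows "u t = sol u0 t"
  by (rule coef_eqI) (simp add: weak_solution_coef[OF assms] coef_sol)

lemma square_summable_lam_e:
  assumes t: "0 < t" shows "square_summable (\<lambda>n. of_real (lam n) * (cinner u0 (\<phi> n) * e n t))"
proof -
  obtain C where C: "\<And>n t. 0 < t \<Longrightarrow> lam n * cmod (e n t) \<le> C * t powr (- \<alpha>)" using e_bounds by metis
  show ?thesis
  proof (rule square_summable_comparison[OF square_summable_coef[of u0], of _ "C * t powr (- \<alpha>)"])
    fix n
    have "cmod (cinner u0 (\<phi> n)) * (lam n * cmod (e n t)) \<le> cmod (cinner u0 (\<phi> n)) * (C * t powr (- \<alpha>))"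
      by (intro mult_left_mono C t) simp
    then show "cmod (of_real (lam n) * (cinner u0 (\<phi> n) * e n t)) \<le> C * t powr (- \<alpha>) * cmod (cinner u0 (\<phi> n))"
      using lam_pos[of n] by (simp add: norm_mult mult_ac)
  qed
qed

lemma continuous_on_e: "continuous_on {0..} (e n)"
  unfolding e_def by (rule continuous_on_relaxation[OF \<alpha>(1)])

lemma continuous_on_sol: "continuous_on {0..} (sol u0)"
proof -
  obtain C where C: "\<And>n t. cmod (e n t) \<le> C" using e_bounds by metis
  show ?thesis
    unfolding sol_def [abs_def]
  proof (rule continuous_on_synth[OF square_summable_coef[of u0], of _ _ C])
    show "continuous_on {0..} (\<lambda>t. cinner u0 (\<phi> n) * e n t)" for n
      by (intro continuous_intros continuous_on_e)
    show "cmod (cinner u0 (\<phi> n) * e n t) \<le> C * cmod (cinner u0 (\<phi> n))" for n t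
      unfolding norm_mult mult.commute[of C] by (rule mult_left_mono[OF C norm_ge_zero])
  qed
qed

text \<open>The majorant \<open>C * t powr (- \<alpha>)\<close> is uniform only away from 0, hence
  the detour over the intervals \<open>{a<..}\<close>. The factor \<open>k\<close> is
  \<open>- 1\<close> for \<open>A\<close> and \<open>- \<i>\<close> for the Caputo
  derivative.\<close>

lemma continuous_on_lam_sol:
  "continuous_on {0<..} (\<lambda>t. synth (\<lambda>n. k * of_real (lam n) * (cinner u0 (\<phi> n) * e n t)))"
proof -
  obtain C where C: "0 < C" "\<And>n t. 0 < t \<Longrightarrow> lam n * cmod (e n t) \<le> C * t powr (- \<alpha>)" using e_bounds by metis
  have "continuous_on {a<..} (\<lambda>t. synth (\<lambda>n. k * of_real (lam n) * (cinner u0 (\<phi> n) * e n t)))" if a: "0 < a" for a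
  proof (rule continuous_on_synth[OF square_summable_coef[of u0], of _ _ "cmod k * (C * a powr (- \<alpha>))"])
    show "continuous_on {a<..} (\<lambda>t. k * of_real (lam n) * (cinner u0 (\<phi> n) * e n t))" for n
      using a by (intro continuous_intros continuous_on_subset[OF continuous_on_e]) auto
    fix t n assume t: "t \<in> {a<..}"
    have "t powr (- \<alpha>) \<le> a powr (- \<alpha>)" using t a \<alpha> by (intro powr_mono2') auto
    then have "lam n * cmod (e n t) \<le> C * a powr (- \<alpha>)"
      using C(2)[of t n] t a C(1) by (smt (verit) greaterThan_iff mult_left_mono)
    then have "cmod k * cmod (cinner u0 (\<phi> n)) * (lam n * cmod (e n t)) \<le> cmod k * cmod (cinner u0 (\<phi> n)) * (C * a powr (- \<alpha>))"
      by (rule mult_left_mono) simp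
    then show "cmod (k * of_real (lam n) * (cinner u0 (\<phi> n) * e n t)) \<le> cmod k * (C * a powr (- \<alpha>)) * cmod (cinner u0 (\<phi> n))"
      using lam_pos[of n] by (simp add: norm_mult mult_ac)
  qed
  then have "continuous_on (\<Union>a\<in>{0<..}. {a<..}) (\<lambda>t. synth (\<lambda>n. k * of_real (lam n) * (cinner u0 (\<phi> n) * e n t)))"
    by (intro continuous_on_open_UN) auto
  moreover have "(\<Union>a\<in>{0<..}. {a<..}) = {0::real<..}"
    by (auto intro: exI[of _ "_ / 2"]) (metis dense greaterThan_iff)
  ultimately show ?thesis by simp
qed

lemma sol_in_Hs: "0 < t \<Longrightarrow> sol u0 t \<in> Hs lam \<phi> 1"
  unfolding Hs_1_iff coef_sol by (rule square_summable_lam_e)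

lemma sol_in_D: "0 < t \<Longrightarrow> sol u0 t \<in> D"
  and A_sol: "0 < t \<Longrightarrow> A (sol u0 t) = synth (\<lambda>n. - 1 * of_real (lam n) * (cinner u0 (\<phi> n) * e n t))"
  using domainI[of "sol u0 t"] square_summable_lam_e[of t u0] by (simp_all add: coef_sol)

text \<open>The norm of \<open>Hs lam \<phi> 1\<close> is the norm of the image under
  \<open>A\<close>, which reduces continuity of \<open>sol u0\<close> in that space to continuity of
  \<open>A (sol u0 t)\<close>.\<close>

lemma Hs_norm_diff:
  assumes "x \<in> Hs lam \<phi> 1" "y \<in> Hs lam \<phi> 1"
  shows "Hs_norm lam \<phi> 1 (x - y) = norm (A x - A y)"
proof -
  have D: "x \<in> D" "y \<in> D" using assms domainI(1) by (auto simp: Hs_1_iff)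
  then have Dd: "x - y \<in> D"
    using self_adjoint by (auto simp: self_adjoint_def linear_operator_def intro: complex_vector.subspace_diff)
  have co: "of_real (lam n) * cinner (x - y) (\<phi> n) = - cinner (A (x - y)) (\<phi> n)" for n
    by (simp add: coef_A[OF Dd])
  have ss: "square_summable (\<lambda>n. of_real (lam n) * cinner (x - y) (\<phi> n))"
    unfolding co by (rule square_summable_comparison[OF square_summable_coef[of "A (x - y)"], of _ 1]) simp
  then have Hd: "x - y \<in> Hs lam \<phi> 1" by (simp add: Hs_1_iff)
  have "A x - A y = - synth (\<lambda>n. of_real (lam n) * cinner (x - y) (\<phi> n))"
  proof (rule coef_eqI)
    fix n
    have "cinner (- synth (\<lambda>n. of_real (lam n) * cinner (x - y) (\<phi> n))) (\<phi> n) = - (of_real (lam n) * cinner (x - y) (\<phi> n))"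
      using cinner_diff_left[of 0 "synth (\<lambda>n. of_real (lam n) * cinner (x - y) (\<phi> n))" "\<phi> n"] by (simp add: coef_synth[OF ss])
    then show "cinner (A x - A y) (\<phi> n) = cinner (- synth (\<lambda>n. of_real (lam n) * cinner (x - y) (\<phi> n))) (\<phi> n)"
      by (simp add: cinner_diff_left coef_A D algebra_simps)
  qed
  then show ?thesis using Hs_norm_1_eq[OF Hd] by simp
qed

lemma regular_sol:
  assumes T: "0 < T"
  shows "weak_solution \<alpha> D A \<phi> T u0 (sol u0)" and "regular_weak_solution \<alpha> D A lam \<phi> T (sol u0)"
proof -
  \<comment> \<open>The Caputo derivative of the solution, prescribed mode by mode.\<close>
  define w where "w t = synth (\<lambda>n. (- \<i>) * of_real (lam n) * (cinner u0 (\<phi> n) * e n t))" for t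
  have ssw: "square_summable (\<lambda>n. (- \<i>) * of_real (lam n) * (cinner u0 (\<phi> n) * e n t))" if "0 < t" for t
    by (rule square_summable_comparison[OF square_summable_lam_e[OF that, of u0], of _ 1]) (simp add: norm_mult)
  have cap: "has_caputo_H \<alpha> \<phi> (sol u0) (w t) t" if t: "0 < t" for t
    unfolding has_caputo_H_def
  proof (intro exI conjI allI)
    show "(\<lambda>n. ((- \<i>) * of_real (lam n) * (cinner u0 (\<phi> n) * e n t)) *\<^sub>C \<phi> n) sums w t"
      unfolding w_def by (rule Riesz_Fischer[OF ssw[OF t]])
    fix n
    have "has_caputo \<alpha> (e n) ((- \<i> * of_real (lam n)) * e n t) t"
      unfolding e_def by (rule has_caputo_relaxation[OF \<alpha> t])
    from has_caputo_cmult[OF this e_differentiable, of "\<lambda>s. cinner (sol u0 s) (\<phi> n)" "cinner u0 (\<phi> n)"]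
    show "has_caputo \<alpha> (\<lambda>s. cinner (sol u0 s) (\<phi> n)) ((- \<i>) * of_real (lam n) * (cinner u0 (\<phi> n) * e n t)) t"
      by (simp add: coef_sol mult_ac)
  qed
  have eq: "\<i> *\<^sub>C w t + A (sol u0 t) = 0" if t: "0 < t" for t
  proof (rule coef_eqI)
    fix n
    show "cinner (\<i> *\<^sub>C w t + A (sol u0 t)) (\<phi> n) = cinner 0 (\<phi> n)"
      unfolding cinner_add_left cinner_scaleC_left w_def coef_synth[OF ssw[OF t]] coef_A[OF sol_in_D[OF t]] coef_sol
      by (simp add: mult.assoc[symmetric])
  qed
  have s0: "sol u0 0 = u0"
    by (rule coef_eqI) (simp add: coef_sol e_0)
  show ws: "weak_solution \<alpha> D A \<phi> T u0 (sol u0)"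
    unfolding weak_solution_def
  proof (intro conjI allI)
    show "continuous_on {0..T} (sol u0)" by (rule continuous_on_subset[OF continuous_on_sol]) auto
    show "absolutely_continuous_on 0 T (\<lambda>t. cinner (sol u0 t) (\<phi> n))" for n
      by (rule absolutely_continuous_on_cmult[OF absolutely_continuous_on_relaxation[OF \<alpha>, of T "- \<i> * of_real (lam n)"], of _ "cinner u0 (\<phi> n)"])
         (simp add: coef_sol e_def)
    show "AE t in lebesgue. t \<in> {0<..<T} \<longrightarrow>
        sol u0 t \<in> D \<and> (\<exists>w. has_caputo_H \<alpha> \<phi> (sol u0) w t \<and> \<i> *\<^sub>C w + A (sol u0 t) = 0)"
    proof (rule AE_I2, intro impI conjI)
      fix t assume "t \<in> {0<..<T}"
      then have t: "0 < t" by simp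
      show "sol u0 t \<in> D" by (rule sol_in_D[OF t])
      show "\<exists>w. has_caputo_H \<alpha> \<phi> (sol u0) w t \<and> \<i> *\<^sub>C w + A (sol u0 t) = 0"
        using cap[OF t] eq[OF t] by blast
    qed
    have "(sol u0 \<longlongrightarrow> sol u0 0) (at 0 within {0..T})"
      using continuous_on_subset[OF continuous_on_sol, of "{0..T}" u0] T by (auto simp: continuous_on_def)
    then have "(sol u0 \<longlongrightarrow> u0) (at_right 0)" using T by (simp add: at_within_Icc_at_right s0)
    then show "((\<lambda>t. norm (sol u0 t - u0)) \<longlongrightarrow> 0) (at_right 0)"
      by (simp only: tendsto_norm_zero_iff LIM_zero_iff)
  qed
  have cA: "continuous_on {0<..} (\<lambda>t. A (sol u0 t))"
    by (rule continuous_on_eq[OF continuous_on_lam_sol[of "- 1" u0]]) (simp add: A_sol)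
  have cAT: "continuous_on {0<..T} (\<lambda>t. A (sol u0 t))"
    by (rule continuous_on_subset[OF cA]) auto
  show "regular_weak_solution \<alpha> D A lam \<phi> T (sol u0)"
    unfolding regular_weak_solution_def
  proof (intro conjI)
    show "\<exists>u0'. weak_solution \<alpha> D A \<phi> T u0' (sol u0)" using ws by blast
    show "Hs_continuous_on lam \<phi> 1 {0<..T} (sol u0)"
      unfolding Hs_continuous_on_def
    proof (intro conjI ballI)
      fix t assume t: "t \<in> {0<..T}"
      then show "sol u0 t \<in> Hs lam \<phi> 1" by (intro sol_in_Hs) simp
      have "((\<lambda>r. A (sol u0 r)) \<longlongrightarrow> A (sol u0 t)) (at t within {0<..T})"
        using cAT t unfolding continuous_on_def by blast
      then have "((\<lambda>r. norm (A (sol u0 r) - A (sol u0 t))) \<longlongrightarrow> 0) (at t within {0<..T})"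
        by (simp only: tendsto_norm_zero_iff LIM_zero_iff)
      moreover have "\<forall>\<^sub>F r in at t within {0<..T}. norm (A (sol u0 r) - A (sol u0 t)) = Hs_norm lam \<phi> 1 (sol u0 r - sol u0 t)"
        unfolding eventually_at_filter
        by (intro always_eventually allI impI Hs_norm_diff[symmetric] sol_in_Hs) (use t in auto)
      ultimately show "((\<lambda>r. Hs_norm lam \<phi> 1 (sol u0 r - sol u0 t)) \<longlongrightarrow> 0) (at t within {0<..T})"
        by (rule Lim_transform_eventually)
    qed
    show "\<exists>w. continuous_on {0<..T} w \<and> (\<forall>t\<in>{0<..T}. has_caputo_H \<alpha> \<phi> (sol u0) (w t) t)"
    proof (intro exI conjI ballI)
      show "continuous_on {0<..T} w"
        unfolding w_def by (rule continuous_on_subset[OF continuous_on_lam_sol]) auto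
      show "has_caputo_H \<alpha> \<phi> (sol u0) (w t) t" if "t \<in> {0<..T}" for t using that by (intro cap) simp
    qed
    show "\<forall>t\<in>{0<..T}. sol u0 t \<in> D" by (auto intro: sol_in_D)
    show "continuous_on {0<..T} (\<lambda>t. A (sol u0 t))" by (rule cAT)
  qed
qed

section \<open>The backward problem and the data with vanishing final state\<close>

lemma e_lower_eventually:
  assumes T: "0 < T"
  obtains c N where "0 < c" "\<And>n. N \<le> n \<Longrightarrow> c \<le> lam n * cmod (e n T)"
proof -
  obtain c1 y1 where c: "0 < c1" "0 < y1" "\<And>y. y1 \<le> y \<Longrightarrow> c1 \<le> y * cmod (mittag_leffler \<alpha> (- \<i> * of_real y))"
    using mittag_leffler_imaginary_lower[OF \<alpha>] by blast
  have Ta: "0 < T powr \<alpha>" using T by simp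
  have "\<forall>\<^sub>F n in sequentially. y1 / T powr \<alpha> \<le> lam n"
    using eigensystem by (auto simp: eigensystem_def filterlim_at_top)
  then obtain N where N: "\<And>n. N \<le> n \<Longrightarrow> y1 / T powr \<alpha> \<le> lam n"
    unfolding eventually_sequentially by blast
  have "c1 / T powr \<alpha> \<le> lam n * cmod (e n T)" if "N \<le> n" for n
  proof -
    have "y1 \<le> lam n * T powr \<alpha>" using N[OF that] Ta by (simp add: divide_le_eq)
    from c(3)[OF this] show ?thesis unfolding e_eq using Ta by (simp add: divide_le_eq mult_ac)
  qed
  then show thesis using c(1) Ta by (intro that[of "c1 / T powr \<alpha>" N]) auto
qed

text \<open>The map from \<open>u 0\<close> to \<open>u T\<close>, followed by \<open>- A\<close>,
  multiplies the coefficient of index \<open>n\<close> by \<open>lam n * e n T\<close>. These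
  factors are bounded above and away from zero in modulus, so the map is an isomorphism of H onto
  \<open>Hs lam \<phi> 1\<close>; existence, uniqueness and stability are read off from it.\<close>

lemma backward_problem:
  assumes T: "0 < T" and nz: "\<And>n. e n T \<noteq> 0"
  shows "\<And>uT. uT \<in> Hs lam \<phi> 1 \<Longrightarrow> \<exists>u. regular_weak_solution \<alpha> D A lam \<phi> T u \<and> u T = uT \<and>
          (\<forall>v. regular_weak_solution \<alpha> D A lam \<phi> T v \<and> v T = uT \<longrightarrow> (\<forall>t\<in>{0..T}. v t = u t))"
    and "\<exists>C1>0. \<exists>C2>0. \<forall>u0 u. weak_solution \<alpha> D A \<phi> T u0 u \<longrightarrow>
          u T \<in> Hs lam \<phi> 1 \<and> C1 * norm (u 0) \<le> Hs_norm lam \<phi> 1 (u T) \<and>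
          Hs_norm lam \<phi> 1 (u T) \<le> C2 * norm (u 0)"
proof -
  obtain c where c: "0 < c" "\<And>n. c \<le> lam n * cmod (e n T)"
  proof -
    obtain c1 N where c1: "0 < c1" "\<And>n. N \<le> n \<Longrightarrow> c1 \<le> lam n * cmod (e n T)"
      using e_lower_eventually[OF T] by blast
    \<comment> \<open>Only finitely many modes escape \<open>e_lower_eventually\<close>; for them
      \<open>nz\<close> gives a positive minimum.\<close>
    have "\<exists>c>0. \<forall>n<N. c \<le> lam n * cmod (e n T)"
      by (rule exists_positive_lower_bound) (use lam_pos nz in simp)
    then obtain c2 where c2: "0 < c2" "\<forall>n<N. c2 \<le> lam n * cmod (e n T)" by (elim exE conjE)
    show thesis
    proof (rule that[of "min c1 c2"])
      show "0 < min c1 c2" using c1 c2 by simp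
      show "min c1 c2 \<le> lam n * cmod (e n T)" for n
        using c1(2)[of n] c2(2) by (cases "N \<le> n") (auto simp: min_le_iff_disj)
    qed
  qed
  have inv: "cmod x \<le> 1 / c * cmod (of_real (lam n) * (x * e n T))" for n x
  proof -
    have "cmod x * c \<le> cmod x * (lam n * cmod (e n T))" by (intro mult_left_mono c) simp
    also have "\<dots> = cmod (of_real (lam n) * (x * e n T))" using lam_pos[of n] by (simp add: norm_mult)
    finally have "cmod x * c / c \<le> cmod (of_real (lam n) * (x * e n T)) / c"
      using c(1) by (intro divide_right_mono) auto
    then show ?thesis using c(1) by simp
  qed
  show "\<exists>u. regular_weak_solution \<alpha> D A lam \<phi> T u \<and> u T = uT \<and>
          (\<forall>v. regular_weak_solution \<alpha> D A lam \<phi> T v \<and> v T = uT \<longrightarrow> (\<forall>t\<in>{0..T}. v t = u t))"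
    if uT: "uT \<in> Hs lam \<phi> 1" for uT
  proof -
    have ss: "square_summable (\<lambda>n. cinner uT (\<phi> n) / e n T)"
    proof (rule square_summable_comparison[OF uT[unfolded Hs_1_iff], of _ "1 / c"])
      show "cmod (cinner uT (\<phi> n) / e n T) \<le> 1 / c * cmod (of_real (lam n) * cinner uT (\<phi> n))" for n
        using inv[of "cinner uT (\<phi> n) / e n T" n] nz[of n] by simp
    qed
    \<comment> \<open>The final condition is solved mode by mode by dividing by
      \<open>e n T\<close>.\<close>
    define u0 where "u0 = synth (\<lambda>n. cinner uT (\<phi> n) / e n T)"
    have u0: "cinner u0 (\<phi> n) * e n T = cinner uT (\<phi> n)" for n
      using nz[of n] by (simp add: u0_def coef_synth[OF ss])
    have "sol u0 T = uT" by (rule coef_eqI) (simp add: coef_sol u0)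
    moreover have "v t = sol u0 t"
      if v: "regular_weak_solution \<alpha> D A lam \<phi> T v" "v T = uT" and t: "t \<in> {0..T}" for v t
    proof -
      obtain v0 where v0: "weak_solution \<alpha> D A \<phi> T v0 v" using v(1) by (auto simp: regular_weak_solution_def)
      have "v0 = u0"
      proof (rule coef_eqI)
        fix n
        have "cinner v0 (\<phi> n) * e n T = cinner u0 (\<phi> n) * e n T"
          using weak_solution_coef[OF v0 T, of T n] T v(2) by (simp add: u0)
        then show "cinner v0 (\<phi> n) = cinner u0 (\<phi> n)" using nz[of n] by simp
      qed
      then show ?thesis using weak_solution_eq_sol[OF v0 T t] by simp
    qed
    ultimately show ?thesis using regular_sol(2)[OF T, of u0] by blast
  qed
  obtain C where C: "0 < C" "\<And>n t. 0 < t \<Longrightarrow> lam n * cmod (e n t) \<le> C * t powr (- \<alpha>)" using e_bounds by metis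
  define C2 where "C2 = C * T powr (- \<alpha>)"
  have C2: "0 < C2" using C(1) T by (simp add: C2_def)
  have "u T \<in> Hs lam \<phi> 1 \<and> c * norm (u 0) \<le> Hs_norm lam \<phi> 1 (u T) \<and> Hs_norm lam \<phi> 1 (u T) \<le> C2 * norm (u 0)"
    if ws: "weak_solution \<alpha> D A \<phi> T u0 u" for u0 u
  proof -
    have u: "u T = sol u0 T" "u 0 = u0"
      using weak_solution_eq_sol[OF ws T] weak_solution_initial[OF ws T] T by auto
    define z where "z = synth (\<lambda>n. of_real (lam n) * (cinner u0 (\<phi> n) * e n T))"
    have z: "cinner z (\<phi> n) = of_real (lam n) * (cinner u0 (\<phi> n) * e n T)" for n
      unfolding z_def by (rule coef_synth[OF square_summable_lam_e[OF T]])
    have Hn: "Hs_norm lam \<phi> 1 (sol u0 T) = norm z"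
      using Hs_norm_1_eq[OF sol_in_Hs[OF T, of u0]] by (simp add: coef_sol z_def)
    have "norm u0 \<le> 1 / c * norm z"
      by (rule norm_le_of_coef_le) (use inv c(1) in \<open>auto simp: z\<close>)
    then have 1: "c * norm u0 \<le> norm z" using c(1) by (simp add: field_simps)
    have 2: "norm z \<le> C2 * norm u0"
    proof (rule norm_le_of_coef_le)
      fix n
      have "cmod (cinner u0 (\<phi> n)) * (lam n * cmod (e n T)) \<le> cmod (cinner u0 (\<phi> n)) * C2"
        unfolding C2_def by (intro mult_left_mono C T) simp
      then show "cmod (cinner z (\<phi> n)) \<le> C2 * cmod (cinner u0 (\<phi> n))"
        using lam_pos[of n] by (simp add: z norm_mult mult_ac)
    qed (use C2 in simp)
    show ?thesis unfolding u Hn using 1 2 sol_in_Hs[OF T] by blast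
  qed
  then show "\<exists>C1>0. \<exists>C2>0. \<forall>u0 u. weak_solution \<alpha> D A \<phi> T u0 u \<longrightarrow>
          u T \<in> Hs lam \<phi> 1 \<and> C1 * norm (u 0) \<le> Hs_norm lam \<phi> 1 (u T) \<and>
          Hs_norm lam \<phi> 1 (u T) \<le> C2 * norm (u 0)"
    using c(1) C2 by blast
qed

lemma final_state_zero_iff:
  assumes T: "0 < T"
  shows "(\<exists>u. weak_solution \<alpha> D A \<phi> T u0 u \<and> u T = 0) \<longleftrightarrow> (\<forall>n. cinner u0 (\<phi> n) = 0 \<or> e n T = 0)"
proof
  assume "\<exists>u. weak_solution \<alpha> D A \<phi> T u0 u \<and> u T = 0"
  then obtain u where u: "weak_solution \<alpha> D A \<phi> T u0 u" "u T = 0" by blast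
  show "\<forall>n. cinner u0 (\<phi> n) = 0 \<or> e n T = 0"
    using weak_solution_coef[OF u(1) T, of T] u(2) T by simp
next
  assume "\<forall>n. cinner u0 (\<phi> n) = 0 \<or> e n T = 0"
  then have "sol u0 T = 0" by (intro coef_eqI) (auto simp: coef_sol)
  then show "\<exists>u. weak_solution \<alpha> D A \<phi> T u0 u \<and> u T = 0" using regular_sol(1)[OF T] by blast
qed

text \<open>The space is spanned by the basis vectors whose mode vanishes at time \<open>T\<close>,
  and by \<open>e_lower_eventually\<close> their indices are bounded.\<close>

lemma finite_dim_final_state_zero:
  assumes T: "0 < T"
  shows "finite_dim_csubspace {u0. \<exists>u. weak_solution \<alpha> D A \<phi> T u0 u \<and> u T = 0}"
proof -
  define B where "B = \<phi> ` {n. e n T = 0}"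
  let ?V = "{u0. \<forall>n. cinner u0 (\<phi> n) = 0 \<or> e n T = 0}"
  obtain c N where cN: "0 < c" "\<And>n. N \<le> n \<Longrightarrow> c \<le> lam n * cmod (e n T)"
    using e_lower_eventually[OF T] by blast
  have less: "n < N" if "e n T = 0" for n
    using cN(2)[of n] cN(1) that by (cases "N \<le> n") auto
  then have "{n. e n T = 0} \<subseteq> {..<N}" by auto
  then have fin: "finite B" unfolding B_def by (intro finite_imageI finite_subset[OF _ finite_lessThan])
  have sub: "csubspace ?V"
    unfolding complex_vector.subspace_def
    by (auto simp: cinner_add_left cinner_scaleC_left) (metis add_0)
  have "?V = cspan B"
  proof
    show "cspan B \<subseteq> ?V"
      using sub by (intro complex_vector.span_minimal) (auto simp: B_def cinner_basis)
    show "?V \<subseteq> cspan B"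
    proof
      fix u0 assume u0: "u0 \<in> ?V"
      have zero: "cinner u0 (\<phi> n) = 0" if "\<not> n < N" for n using u0 less that by blast
      have "u0 = (\<Sum>n<N. cinner u0 (\<phi> n) *\<^sub>C \<phi> n)"
        by (rule coef_eqI) (simp add: cinner_sum zero)
      moreover have "(\<Sum>n<N. cinner u0 (\<phi> n) *\<^sub>C \<phi> n) \<in> cspan B"
      proof (rule complex_vector.span_sum)
        fix n
        show "cinner u0 (\<phi> n) *\<^sub>C \<phi> n \<in> cspan B"
        proof (cases "e n T = 0")
          case True
          then show ?thesis by (intro complex_vector.span_scale complex_vector.span_base) (auto simp: B_def)
        next
          case False
          then have "cinner u0 (\<phi> n) = 0" using u0 by auto
          then show ?thesis by (simp add: complex_vector.span_zero)
        qed
      qed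
      ultimately show "u0 \<in> cspan B" by simp
    qed
  qed
  then show ?thesis
    unfolding final_state_zero_iff[OF T] finite_dim_csubspace_def using sub fin by blast
qed

lemma e_nonzero:
  assumes "0 < T" "\<alpha> \<le> 3/5" shows "e n T \<noteq> 0"
  unfolding e_eq using assms \<alpha> lam_pos[of n] by (intro mittag_leffler_imaginary_nonzero) auto

lemma e_nonzero_large:
  obtains T0 where "0 < T0" "\<And>T n. T0 < T \<Longrightarrow> e n T \<noteq> 0"
proof -
  obtain c1 y1 where c: "0 < c1" "0 < y1" "\<And>y. y1 \<le> y \<Longrightarrow> c1 \<le> y * cmod (mittag_leffler \<alpha> (- \<i> * of_real y))"
    using mittag_leffler_imaginary_lower[OF \<alpha>] by blast
  \<comment> \<open>At this time the smallest product \<open>lam 0 * T powr \<alpha>\<close> reaches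
    \<open>y1\<close>; all other modes have then passed it as well.\<close>
  let ?T0 = "(y1 / lam 0) powr (1 / \<alpha>)"
  have T0: "0 < ?T0" using c lam_pos[of 0] by simp
  have "e n T \<noteq> 0" if T: "?T0 < T" for T n
  proof -
    have "?T0 powr \<alpha> \<le> T powr \<alpha>" using T \<alpha> T0 by (intro powr_mono2) auto
    then have "y1 / lam 0 \<le> T powr \<alpha>" using c lam_pos[of 0] \<alpha> by (simp add: powr_powr)
    then have "y1 \<le> lam 0 * T powr \<alpha>" using lam_pos[of 0] by (simp add: divide_le_eq mult.commute)
    also have "\<dots> \<le> lam n * T powr \<alpha>" by (intro mult_right_mono lam_ge) simp
    finally have "c1 \<le> (lam n * T powr \<alpha>) * cmod (e n T)" unfolding e_eq by (rule c(3))
    then show ?thesis using c(1) by auto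
  qed
  with T0 show thesis by (rule that)
qed

end

theorem theorem3p4:
  fixes D :: "'a::complex_hilbert_space set" and A :: "'a \<Rightarrow> 'a"
    and lam :: "nat \<Rightarrow> real" and \<phi> :: "nat \<Rightarrow> 'a" and \<alpha> :: real
  assumes "self_adjoint D A" and "negative_definite D A" and "compact_resolvent D A"
    and "eigensystem D A lam \<phi>"
    and "0 < \<alpha>" and "\<alpha> < 1"
  shows
   "(\<alpha> \<le> 3 / 5 \<longrightarrow> (\<forall>T>0.
       (\<forall>u0 u. weak_solution \<alpha> D A \<phi> T u0 u \<and> u T = 0 \<longrightarrow>
          u0 = 0 \<and> (\<forall>t\<in>{0..T}. u t = 0)) \<and>
       (\<forall>uT\<in>Hs lam \<phi> 1. \<exists>u.
          regular_weak_solution \<alpha> D A lam \<phi> T u \<and> u T = uT \<and>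
          (\<forall>v. regular_weak_solution \<alpha> D A lam \<phi> T v \<and> v T = uT \<longrightarrow>
             (\<forall>t\<in>{0..T}. v t = u t))) \<and>
       (\<exists>C1>0. \<exists>C2>0. \<forall>u0 u. weak_solution \<alpha> D A \<phi> T u0 u \<longrightarrow>
          u T \<in> Hs lam \<phi> 1 \<and>
          C1 * norm (u 0) \<le> Hs_norm lam \<phi> 1 (u T) \<and>
          Hs_norm lam \<phi> 1 (u T) \<le> C2 * norm (u 0))))
    \<and>
    (3 / 5 < \<alpha> \<longrightarrow>
       (\<exists>T0>0. \<forall>T>T0.
          (\<forall>uT\<in>Hs lam \<phi> 1. \<exists>u.
             regular_weak_solution \<alpha> D A lam \<phi> T u \<and> u T = uT \<and>
             (\<forall>v. regular_weak_solution \<alpha> D A lam \<phi> T v \<and> v T = uT \<longrightarrow>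
                (\<forall>t\<in>{0..T}. v t = u t))) \<and>
          (\<exists>C1>0. \<exists>C2>0. \<forall>u0 u. weak_solution \<alpha> D A \<phi> T u0 u \<longrightarrow>
             u T \<in> Hs lam \<phi> 1 \<and>
             C1 * norm (u 0) \<le> Hs_norm lam \<phi> 1 (u T) \<and>
             Hs_norm lam \<phi> 1 (u T) \<le> C2 * norm (u 0))) \<and>
       (\<forall>T>0. finite_dim_csubspace
          {u0. \<exists>u. weak_solution \<alpha> D A \<phi> T u0 u \<and> u T = 0}))"
proof -
  have "orthonormal_basis \<phi>" using assms(4) by (simp add: eigensystem_def)
  then interpret fractional_schroedinger \<phi> D A lam \<alpha>
    by unfold_locales (use assms in auto)
  have uniq: "u0 = 0 \<and> (\<forall>t\<in>{0..T}. u t = 0)"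
    if T: "0 < T" and nz: "\<And>n. e n T \<noteq> 0" and u: "weak_solution \<alpha> D A \<phi> T u0 u" "u T = 0" for T u0 u
  proof -
    have "cinner u0 (\<phi> n) = 0" for n
      using final_state_zero_iff[OF T, of u0] u nz[of n] by blast
    then show ?thesis
      using weak_solution_coef[OF u(1) T] by (auto intro!: coef_eq_0_imp)
  qed
  show ?thesis
  proof (intro conjI impI allI ballI)
    fix T :: real and u0 u assume "\<alpha> \<le> 3/5" "0 < T" and "weak_solution \<alpha> D A \<phi> T u0 u \<and> u T = 0"
    then show "u0 = 0" using uniq e_nonzero by blast
  next
    fix T t :: real and u0 u assume "\<alpha> \<le> 3/5" "0 < T" "weak_solution \<alpha> D A \<phi> T u0 u \<and> u T = 0" "t \<in> {0..T}"
    then show "u t = 0" using uniq e_nonzero by blast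
  next
    fix T :: real and uT assume "\<alpha> \<le> 3/5" "0 < T" "uT \<in> Hs lam \<phi> 1"
    then show "\<exists>u. regular_weak_solution \<alpha> D A lam \<phi> T u \<and> u T = uT \<and>
          (\<forall>v. regular_weak_solution \<alpha> D A lam \<phi> T v \<and> v T = uT \<longrightarrow> (\<forall>t\<in>{0..T}. v t = u t))"
      by (intro backward_problem(1) e_nonzero)
  next
    fix T :: real assume "\<alpha> \<le> 3/5" "0 < T"
    then show "\<exists>C1>0. \<exists>C2>0. \<forall>u0 u. weak_solution \<alpha> D A \<phi> T u0 u \<longrightarrow>
          u T \<in> Hs lam \<phi> 1 \<and> C1 * norm (u 0) \<le> Hs_norm lam \<phi> 1 (u T) \<and>
          Hs_norm lam \<phi> 1 (u T) \<le> C2 * norm (u 0)"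
      by (intro backward_problem(2) e_nonzero)
  next
    obtain T0 where T0: "0 < T0" "\<And>T n. T0 < T \<Longrightarrow> e n T \<noteq> 0" using e_nonzero_large by blast
    have pos: "0 < T" if "T0 < T" for T using T0(1) that by simp
    show "\<exists>T0>0. \<forall>T>T0.
          (\<forall>uT\<in>Hs lam \<phi> 1. \<exists>u. regular_weak_solution \<alpha> D A lam \<phi> T u \<and> u T = uT \<and>
             (\<forall>v. regular_weak_solution \<alpha> D A lam \<phi> T v \<and> v T = uT \<longrightarrow> (\<forall>t\<in>{0..T}. v t = u t))) \<and>
          (\<exists>C1>0. \<exists>C2>0. \<forall>u0 u. weak_solution \<alpha> D A \<phi> T u0 u \<longrightarrow>
             u T \<in> Hs lam \<phi> 1 \<and> C1 * norm (u 0) \<le> Hs_norm lam \<phi> 1 (u T) \<and>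
             Hs_norm lam \<phi> 1 (u T) \<le> C2 * norm (u 0))"
      by (intro exI[of _ T0] conjI allI impI ballI T0(1) backward_problem pos T0(2))
  next
    fix T :: real assume "0 < T"
    then show "finite_dim_csubspace {u0. \<exists>u. weak_solution \<alpha> D A \<phi> T u0 u \<and> u T = 0}"
      by (rule finite_dim_final_state_zero)
  qed
qed

end
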